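(* Let $\{d_n\}_{n=1}^{\infty}\in \ell_2\setminus \ell_1$ be a sequence of positive numbers with $\lim_{n\to\infty}\frac{d_{n+1}}{d_n}=1$. Put $r_n=\sqrt{d_n+d_{n+1}}$ for $n\in\mathbb{N}$, and define $\tilde r_1=1$, $\tilde r_{n+1}=-\dfrac{d_{n+1}}{\tilde r_n}$ for $n\in\mathbb{N}$. Suppose that: (A) $\{r_n\tilde r_n\}_{n=1}^\infty\in\ell_2$; (B) there is a real periodic sequence $\{u_n\}_{n=1}^\infty$ such that $$\Bigl(\frac{1}{d_n}+\frac{1}{d_{n+1}}\Bigr)\tilde r_n^{\,2}=u_n+O(r_n^2\tilde r_n^{\,2}).$$ Let $\alpha=\{\alpha_n\}_{n=1}^\infty$ be a real sequence with $$\alpha_n=a\Bigl(\frac{1}{d_n}+\frac{1}{d_{n+1}}\Bigr)+O(d_n),$$ where the real parameter $a$ satisfies $-2<a<0$. Let $X=\{x_n\}_{n=0}^\infty$ with $x_0=0$ and $x_n=x_{n-1}+d_n$ for $n\in\mathbb{N}$. Then the Hamiltonian $\mathrm{H}_{X,\alpha}$ is a symmetric operator with deficiency indices $n_\pm(\mathrm{H}_{X,\alpha})=1$.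
   Context: $\mathbb{N}=\{1,2,\dots\}$, $\mathbb{R}_+=(0,\infty)$; $\ell_1$ and $\ell_2$ are the spaces of absolutely summable and square-summable sequences. For a positive sequence $(b_n)$, $a_n=O(b_n)$ means that there is $K>0$ with $|a_n|\le K b_n$ for all sufficiently large $n$, and $a_n=c_n+O(b_n)$ means $a_n-c_n=O(b_n)$. Given a strictly increasing sequence $X=\{x_n\}_{n=0}^\infty$ with $x_0=0$, $x_n\to\infty$, and a real sequence $\alpha=\{\alpha_n\}_{n=1}^\infty$, let $\mathrm{H}^0_{X,\alpha}$ be the operator $f\mapsto -f''$ (derivatives taken on $\mathbb{R}_+\setminus X$) in $L^2(\mathbb{R}_+)$ with domain consisting of all $f\in W^{2,2}(\mathbb{R}_+\setminus X)$ with compact support in $[0,\infty)$ such that $f'(0+)=0$ and, for every $n\ge1$, $f(x_n+)=f(x_n-)=:f(x_n)$ and $f'(x_n+)-f'(x_n-)=\alpha_n f(x_n)$. The Hamiltonian $\mathrm{H}_{X,\alpha}$ is the closure of $\mathrm{H}^0_{X,\alpha}$ in $L^2(\mathbb{R}_+)$; it is the realization of $-\frac{d^2}{dx^2}+\sum_{n\ge1}\alpha_n\delta(x-x_n)$. Its deficiency indices are $n_\pm(\mathrm{H}_{X,\alpha})=\dim\ker(\mathrm{H}_{X,\alpha}^*\mp i)$. *)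

theory Defs
  imports "HOL-Analysis.Analysis" "HOL-Library.Landau_Symbols" "HOL-Library.Extended_Nat"
begin

section \<open>The complex Hilbert space of square-integrable functions on the half-line\<close>

definition square_integrable_on :: "real set \<Rightarrow> (real \<Rightarrow> complex) \<Rightarrow> bool" where
  "square_integrable_on S f \<longleftrightarrow>
     f \<in> borel_measurable (lebesgue_on S) \<and> integrable (lebesgue_on S) (\<lambda>t. (cmod (f t))\<^sup>2)"

definition l2_rel :: "(real \<Rightarrow> complex) \<Rightarrow> (real \<Rightarrow> complex) \<Rightarrow> bool" where
  "l2_rel f g \<longleftrightarrow> square_integrable_on {0<..} f \<and> square_integrable_on {0<..} g \<and>
     (AE t in lebesgue_on {0<..}. f t = g t)"

lemma square_integrable_on_zero: "square_integrable_on S (\<lambda>t. 0)"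
  by (simp add: square_integrable_on_def)

lemma square_integrable_on_scale:
  assumes "square_integrable_on S f"
  shows "square_integrable_on S (\<lambda>t. c * f t)"
  using assms unfolding square_integrable_on_def
  by (auto simp: norm_mult power_mult_distrib)

lemma square_integrable_on_add:
  assumes "square_integrable_on S f" "square_integrable_on S g"
  shows "square_integrable_on S (\<lambda>t. f t + g t)"
  unfolding square_integrable_on_def
proof
  have m [measurable]: "f \<in> borel_measurable (lebesgue_on S)" "g \<in> borel_measurable (lebesgue_on S)"
    and i: "integrable (lebesgue_on S) (\<lambda>t. (cmod (f t))\<^sup>2)" "integrable (lebesgue_on S) (\<lambda>t. (cmod (g t))\<^sup>2)"
    using assms by (auto simp: square_integrable_on_def)
  show "(\<lambda>t. f t + g t) \<in> borel_measurable (lebesgue_on S)"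
    by measurable
  have "integrable (lebesgue_on S) (\<lambda>t. 2 * (cmod (f t))\<^sup>2 + 2 * (cmod (g t))\<^sup>2)"
    using i by auto
  then show "integrable (lebesgue_on S) (\<lambda>t. (cmod (f t + g t))\<^sup>2)"
  proof (rule Bochner_Integration.integrable_bound)
    have "(cmod (f t + g t))\<^sup>2 \<le> 2 * (cmod (f t))\<^sup>2 + 2 * (cmod (g t))\<^sup>2" for t
    proof -
      have "(cmod (f t + g t))\<^sup>2 \<le> (cmod (f t) + cmod (g t))\<^sup>2"
        by (intro power_mono norm_triangle_ineq) auto
      also have "\<dots> \<le> 2 * (cmod (f t))\<^sup>2 + 2 * (cmod (g t))\<^sup>2"
        using sum_squares_ge_zero[of "cmod (f t) - cmod (g t)" 0] by (simp add: power2_eq_square algebra_simps)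
      finally show ?thesis .
    qed
    then show "AE t in lebesgue_on S. norm ((cmod (f t + g t))\<^sup>2)
        \<le> norm (2 * (cmod (f t))\<^sup>2 + 2 * (cmod (g t))\<^sup>2)"
      by auto
  qed measurable
qed

lemma square_integrable_on_integrable_cnj:
  assumes "square_integrable_on S f" "square_integrable_on S g"
  shows "integrable (lebesgue_on S) (\<lambda>t. f t * cnj (g t))"
proof -
  have m [measurable]: "f \<in> borel_measurable (lebesgue_on S)" "g \<in> borel_measurable (lebesgue_on S)"
    and i: "integrable (lebesgue_on S) (\<lambda>t. (cmod (f t))\<^sup>2)" "integrable (lebesgue_on S) (\<lambda>t. (cmod (g t))\<^sup>2)"
    using assms by (auto simp: square_integrable_on_def)
  have "integrable (lebesgue_on S) (\<lambda>t. (cmod (f t))\<^sup>2 + (cmod (g t))\<^sup>2)"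
    using i by auto
  then show ?thesis
  proof (rule Bochner_Integration.integrable_bound)
    have mc: "(\<lambda>t. cnj (g t)) \<in> borel_measurable (lebesgue_on S)"
      by (rule borel_measurable_continuous_on[OF _ m(2)]) (auto intro: continuous_intros)
    show "(\<lambda>t. f t * cnj (g t)) \<in> borel_measurable (lebesgue_on S)"
      by (rule borel_measurable_times[OF m(1) mc])
    have "cmod (f t) * cmod (g t) \<le> (cmod (f t))\<^sup>2 + (cmod (g t))\<^sup>2" for t
    proof -
      have "0 \<le> (cmod (f t) - cmod (g t))\<^sup>2" "0 \<le> cmod (f t) * cmod (g t)"
        by auto
      then show ?thesis
        unfolding power2_diff by linarith
    qed
    then show "AE t in lebesgue_on S. norm (f t * cnj (g t)) \<le> norm ((cmod (f t))\<^sup>2 + (cmod (g t))\<^sup>2)"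
      by (auto simp: norm_mult)
  qed
qed

lemma l2_relI:
  "square_integrable_on {0<..} f \<Longrightarrow> square_integrable_on {0<..} g \<Longrightarrow>
   (AE t in lebesgue_on {0<..}. f t = g t) \<Longrightarrow> l2_rel f g"
  by (simp add: l2_rel_def)

lemma integral_mult_cnj_commute:
  "integral\<^sup>L M (\<lambda>t. g t * cnj (f t)) = cnj (integral\<^sup>L M (\<lambda>t. f t * cnj (g t)))"
proof -
  have "cnj (integral\<^sup>L M (\<lambda>t. f t * cnj (g t))) = integral\<^sup>L M (\<lambda>t. cnj (f t * cnj (g t)))"
    by (rule Bochner_Integration.integral_cnj[symmetric])
  also have "(\<lambda>t. cnj (f t * cnj (g t))) = (\<lambda>t. g t * cnj (f t))"
    by (simp add: fun_eq_iff mult.commute)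
  finally show ?thesis
    by (rule sym)
qed

lemma Re_integral_mult_cnj:
  "Re (integral\<^sup>L M (\<lambda>t. f t * cnj (f t))) = integral\<^sup>L M (\<lambda>t. (cmod (f t))\<^sup>2)"
proof -
  have "(\<lambda>t. f t * cnj (f t)) = (\<lambda>t. complex_of_real ((cmod (f t))\<^sup>2))"
    by (simp only: complex_norm_square)
  then show ?thesis
    by (simp only: integral_complex_of_real Re_complex_of_real)
qed

lemma Re_integral_mult_cnj_eq_0_iff:
  assumes "l2_rel f f"
  shows "Re (integral\<^sup>L (lebesgue_on {0<..}) (\<lambda>t. f t * cnj (f t))) = 0 \<longleftrightarrow> l2_rel f (\<lambda>t. 0)"
proof -
  have sq: "square_integrable_on {0<..} f"
    using assms by (simp add: l2_rel_def)
  then have "integral\<^sup>L (lebesgue_on {0<..}) (\<lambda>t. (cmod (f t))\<^sup>2) = 0 \<longleftrightarrow>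
      (AE t in lebesgue_on {0<..}. (cmod (f t))\<^sup>2 = 0)"
    by (intro integral_nonneg_eq_0_iff_AE) (auto simp: square_integrable_on_def)
  then show ?thesis
    unfolding Re_integral_mult_cnj using sq
    by (simp add: l2_rel_def square_integrable_on_zero)
qed

quotient_type l2_halfline = "real \<Rightarrow> complex" / partial: l2_rel
proof (rule part_equivpI)
  show "\<exists>f. l2_rel f f"
    by (rule exI[of _ "\<lambda>_. 0"]) (simp add: l2_rel_def square_integrable_on_zero)
  show "symp l2_rel"
    by (auto simp: symp_def l2_rel_def)
  show "transp l2_rel"
    by (auto simp: transp_def l2_rel_def elim: AE_mp)
qed

lift_definition cinner_l2 :: "l2_halfline \<Rightarrow> l2_halfline \<Rightarrow> complex"
  is "\<lambda>f g. integral\<^sup>L (lebesgue_on {0<..}) (\<lambda>t. f t * cnj (g t))"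
  unfolding l2_rel_def
  by (intro integral_cong_AE)
     (auto intro!: borel_measurable_integrable square_integrable_on_integrable_cnj elim: AE_mp)

lift_definition scaleC_l2 :: "complex \<Rightarrow> l2_halfline \<Rightarrow> l2_halfline"
  is "\<lambda>c f t. c * f t"
  by (auto simp: l2_rel_def intro!: square_integrable_on_scale elim: AE_mp)

instantiation l2_halfline :: real_inner
begin

lift_definition zero_l2_halfline :: l2_halfline is "\<lambda>t. 0"
  by (simp add: l2_rel_def square_integrable_on_zero)

lift_definition plus_l2_halfline :: "l2_halfline \<Rightarrow> l2_halfline \<Rightarrow> l2_halfline"
  is "\<lambda>f g t. f t + g t"
  by (auto simp: l2_rel_def intro!: square_integrable_on_add elim: AE_mp)

definition uminus_l2_halfline :: "l2_halfline \<Rightarrow> l2_halfline" where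
  "- f = scaleC_l2 (- 1) f"

definition minus_l2_halfline :: "l2_halfline \<Rightarrow> l2_halfline \<Rightarrow> l2_halfline" where
  "f - g = f + - (g :: l2_halfline)"

definition scaleR_l2_halfline :: "real \<Rightarrow> l2_halfline \<Rightarrow> l2_halfline" where
  "c *\<^sub>R f = scaleC_l2 (of_real c) f"

definition inner_l2_halfline :: "l2_halfline \<Rightarrow> l2_halfline \<Rightarrow> real" where
  "inner f g = Re (cinner_l2 f g)"

definition norm_l2_halfline :: "l2_halfline \<Rightarrow> real" where
  "norm f = sqrt (inner f (f :: l2_halfline))"

definition sgn_l2_halfline :: "l2_halfline \<Rightarrow> l2_halfline" where
  "sgn f = inverse (norm f) *\<^sub>R (f :: l2_halfline)"

definition dist_l2_halfline :: "l2_halfline \<Rightarrow> l2_halfline \<Rightarrow> real" where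
  "dist f g = norm (f - (g :: l2_halfline))"

definition uniformity_l2_halfline :: "(l2_halfline \<times> l2_halfline) filter" where
  "uniformity_l2_halfline = (INF e\<in>{0<..}. principal {(f, g). dist f g < e})"

definition open_l2_halfline :: "l2_halfline set \<Rightarrow> bool" where
  "open_l2_halfline U \<longleftrightarrow>
     (\<forall>f\<in>U. eventually (\<lambda>(f', g). f' = f \<longrightarrow> g \<in> U) (uniformity :: (l2_halfline \<times> l2_halfline) filter))"

instance
proof
  fix f g h :: l2_halfline and a b :: real
  show add_assoc: "f + g + h = f + (g + h)"
    by transfer (auto simp: l2_rel_def add.assoc intro!: square_integrable_on_add)
  show "f + g = g + f"
    by transfer (auto simp: l2_rel_def add.commute intro!: square_integrable_on_add)
  show "0 + f = f"
    by transfer (auto simp: l2_rel_def intro!: square_integrable_on_add square_integrable_on_zero)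
  show "- f + f = 0"
    unfolding uminus_l2_halfline_def
    by transfer (auto simp: l2_rel_def square_integrable_on_zero)
  show "f - g = f + - g"
    by (rule minus_l2_halfline_def)
  show "a *\<^sub>R (f + g) = a *\<^sub>R f + a *\<^sub>R g"
    unfolding scaleR_l2_halfline_def
    by transfer (auto simp: l2_rel_def ring_distribs
        intro!: square_integrable_on_add square_integrable_on_scale)
  show "(a + b) *\<^sub>R f = a *\<^sub>R f + b *\<^sub>R f"
    unfolding scaleR_l2_halfline_def
    by transfer (auto simp: l2_rel_def ring_distribs
        intro!: square_integrable_on_add square_integrable_on_scale)
  show "a *\<^sub>R b *\<^sub>R f = (a * b) *\<^sub>R f"
    unfolding scaleR_l2_halfline_def
    by transfer (auto simp: l2_rel_def mult.assoc intro!: square_integrable_on_scale)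
  show "1 *\<^sub>R f = f"
    unfolding scaleR_l2_halfline_def
    by transfer (auto simp: l2_rel_def)
  show "dist f g = norm (f - g)"
    by (rule dist_l2_halfline_def)
  show "sgn f = inverse (norm f) *\<^sub>R f"
    by (rule sgn_l2_halfline_def)
  show "uniformity = (INF e\<in>{0<..}. principal {(f, g :: l2_halfline). dist f g < e})"
    by (rule uniformity_l2_halfline_def)
  show "norm f = sqrt (inner f f)"
    by (rule norm_l2_halfline_def)
  show "inner f g = inner g f"
  proof -
    have "cinner_l2 g f = cnj (cinner_l2 f g)"
      by transfer (rule integral_mult_cnj_commute)
    then show ?thesis
      by (simp add: inner_l2_halfline_def)
  qed
  show "inner (f + g) h = inner f h + inner g h"
    unfolding inner_l2_halfline_def
    by transfer (simp add: l2_rel_def ring_distribs square_integrable_on_integrable_cnj)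
  show "inner (a *\<^sub>R f) g = a * inner f g"
    unfolding inner_l2_halfline_def scaleR_l2_halfline_def
    by transfer (simp add: mult.assoc)
  show "0 \<le> inner f f"
    unfolding inner_l2_halfline_def by transfer (simp only: Re_integral_mult_cnj, simp)
  show "inner f f = 0 \<longleftrightarrow> f = 0"
    unfolding inner_l2_halfline_def by transfer (rule Re_integral_mult_cnj_eq_0_iff)
next
  fix U :: "l2_halfline set"
  show "open U \<longleftrightarrow> (\<forall>f\<in>U. \<forall>\<^sub>F (f', g) in uniformity. f' = f \<longrightarrow> g \<in> U)"
    by (rule open_l2_halfline_def)
qed

end

interpretation l2: vector_space scaleC_l2
proof
  fix a b :: complex and f g :: l2_halfline
  show "scaleC_l2 a (f + g) = scaleC_l2 a f + scaleC_l2 a g"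
    by transfer (auto simp: l2_rel_def ring_distribs
        intro!: square_integrable_on_add square_integrable_on_scale)
  show "scaleC_l2 (a + b) f = scaleC_l2 a f + scaleC_l2 b f"
    by transfer (auto simp: l2_rel_def ring_distribs
        intro!: square_integrable_on_add square_integrable_on_scale)
  show "scaleC_l2 a (scaleC_l2 b f) = scaleC_l2 (a * b) f"
    by transfer (auto simp: l2_rel_def mult.assoc intro!: square_integrable_on_scale)
  show "scaleC_l2 1 f = f"
    by transfer (auto simp: l2_rel_def)
qed


section \<open>Unbounded operators, represented by their graphs\<close>

type_synonym l2_graph = "(l2_halfline \<times> l2_halfline) set"

definition linear_graph :: "l2_graph \<Rightarrow> bool" where
  "linear_graph T \<longleftrightarrow> (0, 0) \<in> T \<and>
     (\<forall>(f, f')\<in>T. \<forall>(g, g')\<in>T. (f + g, f' + g') \<in> T) \<and>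
     (\<forall>c. \<forall>(f, f')\<in>T. (scaleC_l2 c f, scaleC_l2 c f') \<in> T)"

definition symmetric_operator :: "l2_graph \<Rightarrow> bool" where
  "symmetric_operator T \<longleftrightarrow> single_valued T \<and> linear_graph T \<and> closure (Domain T) = UNIV \<and>
     (\<forall>(f, f')\<in>T. \<forall>(g, g')\<in>T. cinner_l2 f' g = cinner_l2 f g')"

definition adjoint_graph :: "l2_graph \<Rightarrow> l2_graph" where
  "adjoint_graph T = {(g, h). \<forall>(f, f')\<in>T. cinner_l2 f' g = cinner_l2 f h}"

definition eigenspace_graph :: "l2_graph \<Rightarrow> complex \<Rightarrow> l2_halfline set" where
  "eigenspace_graph T z = {g. (g, scaleC_l2 z g) \<in> T}"

text \<open>The library dimension \<open>l2.dim\<close> is \<open>0\<close> on infinite-dimensional spaces, so that case is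
  separated here.\<close>

definition cdim_l2 :: "l2_halfline set \<Rightarrow> enat" where
  "cdim_l2 V = (if \<exists>B. finite B \<and> V \<subseteq> l2.span B then enat (l2.dim V) else \<infinity>)"

definition deficiency_index_plus :: "l2_graph \<Rightarrow> enat" where
  "deficiency_index_plus T = cdim_l2 (eigenspace_graph (adjoint_graph T) \<i>)"

definition deficiency_index_minus :: "l2_graph \<Rightarrow> enat" where
  "deficiency_index_minus T = cdim_l2 (eigenspace_graph (adjoint_graph T) (- \<i>))"


section \<open>Sobolev functions and the Hamiltonian\<close>

definition C1_test_function :: "real set \<Rightarrow> (real \<Rightarrow> real) \<Rightarrow> (real \<Rightarrow> real) \<Rightarrow> bool" where
  "C1_test_function U \<phi> \<phi>' \<longleftrightarrow>
     (\<forall>t. (\<phi> has_real_derivative \<phi>' t) (at t)) \<and> continuous_on UNIV \<phi>' \<and>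
     compact (closure {t. \<phi> t \<noteq> 0}) \<and> closure {t. \<phi> t \<noteq> 0} \<subseteq> U"

definition weak_derivative_on :: "real set \<Rightarrow> (real \<Rightarrow> complex) \<Rightarrow> (real \<Rightarrow> complex) \<Rightarrow> bool" where
  "weak_derivative_on U f g \<longleftrightarrow>
     (\<forall>\<phi> \<phi>'. C1_test_function U \<phi> \<phi>' \<longrightarrow>
        integral\<^sup>L (lebesgue_on U) (\<lambda>t. of_real (\<phi>' t) * f t) =
        - integral\<^sup>L (lebesgue_on U) (\<lambda>t. of_real (\<phi> t) * g t))"

text \<open>\<open>W22_on U f f1 f2\<close>: \<open>f \<in> W\<^sup>2\<^sup>,\<^sup>2(U)\<close> with weak derivatives \<open>f' = f1\<close> and \<open>f'' = f2\<close>,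
  where \<open>f\<close> and \<open>f1\<close> are the continuous representatives (which exist and are unique on an open
  set \<open>U\<close> of reals, by the one-dimensional Sobolev embedding), so that their one-sided limits
  at the boundary of \<open>U\<close> are meaningful.\<close>

definition W22_on ::
  "real set \<Rightarrow> (real \<Rightarrow> complex) \<Rightarrow> (real \<Rightarrow> complex) \<Rightarrow> (real \<Rightarrow> complex) \<Rightarrow> bool" where
  "W22_on U f f1 f2 \<longleftrightarrow>
     square_integrable_on U f \<and> square_integrable_on U f1 \<and> square_integrable_on U f2 \<and>
     weak_derivative_on U f f1 \<and> weak_derivative_on U f1 f2 \<and>
     continuous_on U f \<and> continuous_on U f1"

text \<open>The values of \<open>f\<close> and \<open>f2\<close> on the null set \<open>range x\<close> are irrelevant, since functions are
  identified almost everywhere by \<open>abs_l2_halfline\<close>.\<close>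

definition hamiltonian0 :: "(nat \<Rightarrow> real) \<Rightarrow> (nat \<Rightarrow> real) \<Rightarrow> l2_graph" where
  "hamiltonian0 x \<alpha> =
     {(abs_l2_halfline f, - abs_l2_halfline f2) | f f1 f2.
        W22_on ({0<..} - range x) f f1 f2 \<and>
        (\<exists>K. compact K \<and> K \<subseteq> {0..} \<and> (\<forall>t\<in>{0<..} - range x - K. f t = 0)) \<and>
        (f1 \<longlongrightarrow> 0) (at_right 0) \<and>
        (\<forall>n\<ge>1. \<exists>v p m.
           (f \<longlongrightarrow> v) (at_right (x n)) \<and> (f \<longlongrightarrow> v) (at_left (x n)) \<and>
           (f1 \<longlongrightarrow> p) (at_right (x n)) \<and> (f1 \<longlongrightarrow> m) (at_left (x n)) \<and>
           p - m = of_real (\<alpha> n) * v)}"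

definition hamiltonian :: "(nat \<Rightarrow> real) \<Rightarrow> (nat \<Rightarrow> real) \<Rightarrow> l2_graph" where
  "hamiltonian x \<alpha> = closure (hamiltonian0 x \<alpha>)"

end

theory Submission
  imports Defs
begin

text \<open>
  An element of the kernel of \<open>H\<^sup>* - z\<close> is a function that solves \<open>- f'' = z f\<close> off the
  interaction points and satisfies the interface conditions together with \<open>f' (0+) = 0\<close>. Such a function is
  determined by its value at the origin, so a deficiency index is \<open>1\<close> as soon as the solution with
  initial values \<open>(1, 0)\<close> is square integrable (\<open>eigenspace_dim_eq_1\<close>). That this solution
  belongs to the kernel, and that \<open>H\<close> is symmetric, is Green's formula (\<open>Green_formula\<close>), for which
  weak derivatives have to be integrated by parts (\<open>weak_derivative_integration_by_parts\<close>). That the kernel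
  contains nothing else follows by duality: variation of parameters
  (\<open>inhomogeneous_equation_solvable\<close>) puts every smooth function with compact support off the interaction
  points that is orthogonal to the solution into the range of \<open>H - cnj z\<close>, to which the kernel is orthogonal,
  and such functions without the orthogonality are dense (\<open>C2_compact_support_dense\<close>).

  It remains to see that the solution is square integrable. Its values \<open>y n\<close> at the interaction points
  satisfy a three-term recurrence (\<open>state_recurrence\<close>) which for short intervals is close to
  \<open>y (n + 1) / d (n + 1) + y (n - 1) / d n = (1 + a) (1 / d n + 1 / d (n + 1)) y n\<close>.
  Since \<open>rt (n + 1) * rt n = - d (n + 1)\<close>, the quotients \<open>v n = y n / rt n\<close> satisfy
  \<open>v (n + 1) + v (n - 1) = - (1 + a) u n v n\<close> up to errors with the summable coefficients
  \<open>(d n)\<^sup>2\<close> and \<open>(r n)\<^sup>2 (rt n)\<^sup>2\<close>. As \<open>d (n + 1) / d n\<close> tends to \<open>1\<close>, the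
  periodic sequence \<open>u\<close> is positive with \<open>u n * u (n + 1) = 4\<close> (\<open>alternating_potential\<close>), and two
  alternating scaling constants turn the recurrence into
  \<open>w (n + 1) + w (n - 1) + 2 (1 + a) w n = 0\<close> (\<open>one_step_estimate\<close>). Here
  \<open>\<bar>1 + a\<bar> < 1\<close>, so an invariant positive definite quadratic form bounds \<open>w\<close> also after the summable
  perturbation (\<open>perturbed_oscillation_bounded\<close>). Hence \<open>y n\<close> is at most a constant times
  \<open>\<bar>rt n\<bar>\<close>, and hypothesis (A) makes the solution square integrable
  (\<open>sol_square_integrable\<close>).
\<close>

section \<open>The Hilbert space\<close>

lemma l2_rel_refl_iff: "l2_rel f f \<longleftrightarrow> square_integrable_on {0<..} f"
  by (auto simp: l2_rel_def)

lemma abs_l2_cases: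
  obtains f where "square_integrable_on {0<..} f" "F = abs_l2_halfline f"
  using l2_halfline.abs_induct[of "\<lambda>F. \<exists>f. square_integrable_on {0<..} f \<and> F = abs_l2_halfline f" F]
  by (auto simp: l2_rel_refl_iff)

lemma
  assumes "square_integrable_on {0<..} f" "square_integrable_on {0<..} g"
  shows cinner_abs_l2: "cinner_l2 (abs_l2_halfline f) (abs_l2_halfline g) =
      integral\<^sup>L (lebesgue_on {0<..}) (\<lambda>t. f t * cnj (g t))"
    and plus_abs_l2: "abs_l2_halfline f + abs_l2_halfline g = abs_l2_halfline (\<lambda>t. f t + g t)"
  using assms by (simp_all add: cinner_l2.abs_eq plus_l2_halfline.abs_eq l2_rel_refl_iff)

lemma scaleC_abs_l2:
  "square_integrable_on {0<..} f \<Longrightarrow>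
    scaleC_l2 c (abs_l2_halfline f) = abs_l2_halfline (\<lambda>t. c * f t)"
  by (simp add: scaleC_l2.abs_eq l2_rel_refl_iff)

lemma uminus_abs_l2:
  "square_integrable_on {0<..} f \<Longrightarrow> - abs_l2_halfline f = abs_l2_halfline (\<lambda>t. - f t)"
  unfolding uminus_l2_halfline_def by (subst scaleC_abs_l2) auto

lemma square_integrable_on_uminus:
  "square_integrable_on S f \<Longrightarrow> square_integrable_on S (\<lambda>t. - f t)"
  using square_integrable_on_scale[of S f "-1"] by simp

lemma square_integrable_on_diff:
  "square_integrable_on S f \<Longrightarrow> square_integrable_on S g \<Longrightarrow>
    square_integrable_on S (\<lambda>t. f t - g t)"
  using square_integrable_on_add[OF _ square_integrable_on_uminus, of S f g] by simp

lemma minus_abs_l2: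
  "square_integrable_on {0<..} f \<Longrightarrow> square_integrable_on {0<..} g \<Longrightarrow>
    abs_l2_halfline f - abs_l2_halfline g = abs_l2_halfline (\<lambda>t. f t - g t)"
  unfolding minus_l2_halfline_def
  by (subst uminus_abs_l2, assumption, subst plus_abs_l2) (simp_all add: square_integrable_on_uminus)

lemma norm_abs_l2:
  "square_integrable_on {0<..} f \<Longrightarrow>
    (norm (abs_l2_halfline f))\<^sup>2 = integral\<^sup>L (lebesgue_on {0<..}) (\<lambda>t. (cmod (f t))\<^sup>2)"
  by (simp add: norm_l2_halfline_def inner_l2_halfline_def cinner_abs_l2 Re_integral_mult_cnj)

lemma cinner_l2_commute: "cinner_l2 g f = cnj (cinner_l2 f g)"
  by transfer (rule integral_mult_cnj_commute)

lemma cinner_l2_add_left: "cinner_l2 (f + g) h = cinner_l2 f h + cinner_l2 g h"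
  by transfer (simp add: l2_rel_def ring_distribs square_integrable_on_integrable_cnj)

lemma cinner_l2_scaleC_left: "cinner_l2 (scaleC_l2 c f) g = c * cinner_l2 f g"
  by transfer (simp add: mult.assoc)

lemma cinner_l2_add_right: "cinner_l2 h (f + g) = cinner_l2 h f + cinner_l2 h g"
  by (metis cinner_l2_commute cinner_l2_add_left complex_cnj_add)

lemma cinner_l2_scaleC_right: "cinner_l2 f (scaleC_l2 c g) = cnj c * cinner_l2 f g"
  by (metis cinner_l2_commute cinner_l2_scaleC_left complex_cnj_mult)

lemma cinner_l2_uminus_left: "cinner_l2 (- f) g = - cinner_l2 f g"
  unfolding uminus_l2_halfline_def cinner_l2_scaleC_left by simp

lemma cinner_l2_uminus_right: "cinner_l2 f (- g) = - cinner_l2 f g"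
  unfolding uminus_l2_halfline_def cinner_l2_scaleC_right by simp

lemma cinner_l2_diff_left: "cinner_l2 (f - g) h = cinner_l2 f h - cinner_l2 g h"
  unfolding minus_l2_halfline_def cinner_l2_add_left cinner_l2_uminus_left by simp

lemma cinner_l2_diff_right: "cinner_l2 h (f - g) = cinner_l2 h f - cinner_l2 h g"
  unfolding minus_l2_halfline_def cinner_l2_add_right cinner_l2_uminus_right by simp

text \<open>The library knows the real inner product only; the complex one is recovered from it by
  polarisation, which transports continuity.\<close>

lemma cinner_l2_eq_inner: "cinner_l2 f g = Complex (inner f g) (inner f (scaleC_l2 \<i> g))"
  by (rule complex_eqI) (simp_all add: inner_l2_halfline_def cinner_l2_scaleC_right)

lemma norm_scaleC_l2: "norm (scaleC_l2 c f) = cmod c * norm f"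
proof -
  have "cinner_l2 (scaleC_l2 c f) (scaleC_l2 c f) = complex_of_real ((cmod c)\<^sup>2) * cinner_l2 f f"
    unfolding complex_norm_square cinner_l2_scaleC_left cinner_l2_scaleC_right by (simp add: mult_ac)
  then have "inner (scaleC_l2 c f) (scaleC_l2 c f) = (cmod c)\<^sup>2 * inner f f"
    by (simp add: inner_l2_halfline_def)
  then show ?thesis
    by (simp add: norm_l2_halfline_def real_sqrt_mult)
qed

lemma tendsto_scaleC_l2:
  assumes "(f \<longlongrightarrow> F) net"
  shows "((\<lambda>t. scaleC_l2 c (f t)) \<longlongrightarrow> scaleC_l2 c F) net"
proof -
  have "scaleC_l2 c u - scaleC_l2 c v = scaleC_l2 c (u - v)" for u v
    by (rule l2.scale_right_diff_distrib[symmetric])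
  then have "((\<lambda>t. norm (scaleC_l2 c (f t) - scaleC_l2 c F)) \<longlongrightarrow> cmod c * norm (F - F)) net"
    unfolding norm_scaleC_l2 by (simp only: norm_scaleC_l2) (intro tendsto_intros assms)
  then show ?thesis
    by (simp add: tendsto_norm_zero_iff LIM_zero_iff)
qed

lemma tendsto_cinner_l2:
  assumes "(f \<longlongrightarrow> F) net" "(g \<longlongrightarrow> G) net"
  shows "((\<lambda>t. cinner_l2 (f t) (g t)) \<longlongrightarrow> cinner_l2 F G) net"
  unfolding cinner_l2_eq_inner
  by (intro tendsto_Complex tendsto_inner assms tendsto_scaleC_l2)

lemma cinner_l2_self_eq_0: "cinner_l2 f f = 0 \<Longrightarrow> f = 0"
  using inner_eq_zero_iff[of f] by (simp add: inner_l2_halfline_def)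

lemma orthogonal_dense_eq_0:
  assumes dense: "closure D = UNIV" and orth: "\<And>h. h \<in> D \<Longrightarrow> cinner_l2 h g = 0"
  shows "g = 0"
proof -
  have "g \<in> closure D"
    using dense by simp
  then obtain s where s: "\<And>n. s n \<in> D" "s \<longlonglongrightarrow> g"
    by (auto simp: closure_sequential)
  have "(\<lambda>n. cinner_l2 (s n) g) \<longlonglongrightarrow> cinner_l2 g g"
    by (intro tendsto_cinner_l2 s tendsto_const)
  then have "cinner_l2 g g = 0"
    using s(1) orth by (simp add: LIMSEQ_const_iff)
  then show ?thesis
    by (rule cinner_l2_self_eq_0)
qed

text \<open>The approximants of the density theorem converge almost everywhere only; this turns such limits into
  limits in the Hilbert space.\<close>

lemma dominated_convergence_l2:
  assumes f: "square_integrable_on {0<..} f"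
    and m: "\<And>n. fs n \<in> borel_measurable (lebesgue_on {0<..})"
    and lim: "AE t in lebesgue_on {0<..}. (\<lambda>n. fs n t) \<longlonglongrightarrow> f t"
    and G: "integrable (lebesgue_on {0<..}) (\<lambda>t. (G t)\<^sup>2)"
    and bd: "\<And>n t. t > 0 \<Longrightarrow> cmod (fs n t) \<le> G t"
  shows "\<And>n. square_integrable_on {0<..} (fs n)"
    and "(\<lambda>n. abs_l2_halfline (fs n)) \<longlonglongrightarrow> abs_l2_halfline f"
proof -
  let ?M = "lebesgue_on {0<..} :: real measure"
  show fs: "square_integrable_on {0<..} (fs n)" for n
    unfolding square_integrable_on_def
  proof
    show "integrable ?M (\<lambda>t. (cmod (fs n t))\<^sup>2)"
    proof (rule Bochner_Integration.integrable_bound[OF G])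
      show "(\<lambda>t. (cmod (fs n t))\<^sup>2) \<in> borel_measurable ?M"
        using m[of n] by measurable
      show "AE t in ?M. norm ((cmod (fs n t))\<^sup>2) \<le> norm ((G t)\<^sup>2)"
        by (rule AE_I2) (auto intro!: power_mono bd)
    qed
  qed (rule m)
  have "(\<lambda>n. integral\<^sup>L ?M (\<lambda>t. (cmod (fs n t - f t))\<^sup>2)) \<longlonglongrightarrow> integral\<^sup>L ?M (\<lambda>t. 0 :: real)"
  proof (rule integral_dominated_convergence[where w = "\<lambda>t. 2 * (G t)\<^sup>2 + 2 * (cmod (f t))\<^sup>2"])
    have [measurable]: "f \<in> borel_measurable ?M" "\<And>n. fs n \<in> borel_measurable ?M"
      using f m by (auto simp: square_integrable_on_def)
    show "(\<lambda>t. (cmod (fs n t - f t))\<^sup>2) \<in> borel_measurable ?M" for n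
      by measurable
    show "integrable ?M (\<lambda>t. 2 * (G t)\<^sup>2 + 2 * (cmod (f t))\<^sup>2)"
      using f G by (auto simp: square_integrable_on_def)
    show "AE t in ?M. (\<lambda>n. (cmod (fs n t - f t))\<^sup>2) \<longlonglongrightarrow> 0"
      using lim
    proof eventually_elim
      case (elim t)
      then have "(\<lambda>n. (cmod (fs n t - f t))\<^sup>2) \<longlonglongrightarrow> (cmod (f t - f t))\<^sup>2"
        by (intro tendsto_intros)
      then show ?case by simp
    qed
    show "AE t in ?M. norm ((cmod (fs n t - f t))\<^sup>2) \<le> 2 * (G t)\<^sup>2 + 2 * (cmod (f t))\<^sup>2" for n
    proof (rule AE_I2)
      fix t :: real assume "t \<in> space ?M"
      then have "cmod (fs n t) \<le> G t"
        by (intro bd) simp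
      then have "cmod (fs n t - f t) \<le> G t + cmod (f t)"
        using norm_triangle_ineq4[of "fs n t" "f t"] by simp
      then have "(cmod (fs n t - f t))\<^sup>2 \<le> (G t + cmod (f t))\<^sup>2"
        by (intro power_mono) auto
      also have "\<dots> \<le> 2 * (G t)\<^sup>2 + 2 * (cmod (f t))\<^sup>2"
        using zero_le_power2[of "G t - cmod (f t)"]
        unfolding power2_diff power2_sum by linarith
      finally show "norm ((cmod (fs n t - f t))\<^sup>2) \<le> 2 * (G t)\<^sup>2 + 2 * (cmod (f t))\<^sup>2"
        by simp
    qed
  qed simp
  then have "(\<lambda>n. (norm (abs_l2_halfline (fs n) - abs_l2_halfline f))\<^sup>2) \<longlonglongrightarrow> 0"
    by (simp add: minus_abs_l2 norm_abs_l2 fs f square_integrable_on_diff)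
  then have "(\<lambda>n. sqrt ((norm (abs_l2_halfline (fs n) - abs_l2_halfline f))\<^sup>2)) \<longlonglongrightarrow> sqrt 0"
    by (rule tendsto_real_sqrt)
  then have "(\<lambda>n. norm (abs_l2_halfline (fs n) - abs_l2_halfline f)) \<longlonglongrightarrow> 0"
    by simp
  then show "(\<lambda>n. abs_l2_halfline (fs n)) \<longlonglongrightarrow> abs_l2_halfline f"
    by (simp add: tendsto_norm_zero_iff LIM_zero_iff)
qed

lemma abs_l2_eq_zeroD:
  assumes "square_integrable_on {0<..} f" "abs_l2_halfline f = 0"
  shows "AE t in lebesgue_on {0<..}. f t = 0"
proof -
  have "abs_l2_halfline f = abs_l2_halfline (\<lambda>t. 0)"
    using assms(2) by (simp add: zero_l2_halfline_def)
  moreover have "l2_rel f f" "l2_rel (\<lambda>t. 0) (\<lambda>t. 0)"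
    using assms(1) by (simp_all add: l2_rel_refl_iff square_integrable_on_zero)
  ultimately have "l2_rel f (\<lambda>t. 0)"
    using Quotient3_rel[OF Quotient3_l2_halfline, of f "\<lambda>t. 0"] by blast
  then show ?thesis by (simp add: l2_rel_def)
qed

section \<open>Closures and adjoints of operators\<close>

text \<open>For fixed \<open>(g, h)\<close> the defining identity of the adjoint is a closed condition on
  \<open>(f, f')\<close>.\<close>

lemma adjoint_graph_closure: "adjoint_graph (closure T) = adjoint_graph T"
proof
  show "adjoint_graph (closure T) \<subseteq> adjoint_graph T"
    using closure_subset[of T] by (fastforce simp: adjoint_graph_def)
  show "adjoint_graph T \<subseteq> adjoint_graph (closure T)"
  proof (clarsimp simp: adjoint_graph_def)
    fix g h f f'
    assume adj: "\<forall>(f, f')\<in>T. cinner_l2 f' g = cinner_l2 f h" and "(f, f') \<in> closure T"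
    then obtain s where s: "\<And>n. s n \<in> T" "s \<longlonglongrightarrow> (f, f')"
      by (auto simp: closure_sequential)
    have "(\<lambda>n. cinner_l2 (snd (s n)) g) \<longlonglongrightarrow> cinner_l2 (snd (f, f')) g"
      and "(\<lambda>n. cinner_l2 (fst (s n)) h) \<longlonglongrightarrow> cinner_l2 (fst (f, f')) h"
      by (intro tendsto_cinner_l2 tendsto_snd tendsto_fst s tendsto_const)+
    moreover have "cinner_l2 (snd (s n)) g = cinner_l2 (fst (s n)) h" for n
      using adj s(1)[of n] by (auto simp: case_prod_beta)
    ultimately show "cinner_l2 f' g = cinner_l2 f h"
      by (auto intro: LIMSEQ_unique)
  qed
qed

lemma linear_graph_closure:
  assumes "linear_graph T"
  shows "linear_graph (closure T)"
  unfolding linear_graph_def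
proof (intro conjI allI ballI; clarify?)
  show "(0, 0) \<in> closure T"
    using assms closure_subset[of T] by (auto simp: linear_graph_def)
next
  fix f f' g g' assume "(f, f') \<in> closure T" "(g, g') \<in> closure T"
  then obtain s t where s: "\<And>n. s n \<in> T" "s \<longlonglongrightarrow> (f, f')" and t: "\<And>n. t n \<in> T" "t \<longlonglongrightarrow> (g, g')"
    by (auto simp: closure_sequential)
  have "(\<lambda>n. s n + t n) \<longlonglongrightarrow> (f, f') + (g, g')"
    by (intro tendsto_intros s t)
  moreover have "s n + t n \<in> T" for n
    using assms s(1)[of n] t(1)[of n] by (force simp: linear_graph_def plus_prod_def)
  ultimately have "(f, f') + (g, g') \<in> closure T"
    unfolding closure_sequential by (intro exI[of _ "\<lambda>n. s n + t n"]) auto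
  then show "(f + g, f' + g') \<in> closure T"
    by simp
next
  fix c f f' assume "(f, f') \<in> closure T"
  then obtain s where s: "\<And>n. s n \<in> T" "s \<longlonglongrightarrow> (f, f')"
    by (auto simp: closure_sequential)
  have "(\<lambda>n. scaleC_l2 c (fst (s n))) \<longlonglongrightarrow> scaleC_l2 c (fst (f, f'))"
    and "(\<lambda>n. scaleC_l2 c (snd (s n))) \<longlonglongrightarrow> scaleC_l2 c (snd (f, f'))"
    by (intro tendsto_scaleC_l2 tendsto_fst tendsto_snd s)+
  then have "(\<lambda>n. (scaleC_l2 c (fst (s n)), scaleC_l2 c (snd (s n)))) \<longlonglongrightarrow> (scaleC_l2 c f, scaleC_l2 c f')"
    by (auto intro: tendsto_Pair)
  moreover have "(scaleC_l2 c (fst (s n)), scaleC_l2 c (snd (s n))) \<in> T" for n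
    using assms s(1)[of n] by (force simp: linear_graph_def)
  ultimately show "(scaleC_l2 c f, scaleC_l2 c f') \<in> closure T"
    unfolding closure_sequential
    by (intro exI[of _ "\<lambda>n. (scaleC_l2 c (fst (s n)), scaleC_l2 c (snd (s n)))"]) auto
qed

text \<open>Passing to the closure costs nothing: a limit of symmetric pairs is symmetric by continuity of
  the inner product, and a limit \<open>(0, h)\<close> is orthogonal to the dense domain, hence zero.\<close>

lemma symmetric_operator_closure:
  assumes lin: "linear_graph T" and dense: "closure (Domain T) = UNIV"
    and sym: "\<And>f f' g g'. (f, f') \<in> T \<Longrightarrow> (g, g') \<in> T \<Longrightarrow> cinner_l2 f' g = cinner_l2 f g'"
  shows "symmetric_operator (closure T)"
proof -
  have sub: "T \<subseteq> adjoint_graph T"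
    using sym by (auto simp: adjoint_graph_def)
  have sym1: "cinner_l2 f' g = cinner_l2 f g'" if "(f, f') \<in> closure T" "(g, g') \<in> T" for f f' g g'
  proof -
    have "(g, g') \<in> adjoint_graph (closure T)"
      using that(2) sub adjoint_graph_closure by auto
    then show ?thesis
      using that(1) by (auto simp: adjoint_graph_def)
  qed
  have sym2: "cinner_l2 f' g = cinner_l2 f g'" if "(f, f') \<in> closure T" "(g, g') \<in> closure T" for f f' g g'
  proof -
    have "cinner_l2 h' f = cinner_l2 h f'" if h: "(h, h') \<in> T" for h h'
      using sym1[OF \<open>(f, f') \<in> closure T\<close> h] by (metis cinner_l2_commute)
    then have "(f, f') \<in> adjoint_graph (closure T)"
      unfolding adjoint_graph_closure by (auto simp: adjoint_graph_def)
    then have "cinner_l2 g' f = cinner_l2 g f'"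
      using that(2) by (auto simp: adjoint_graph_def)
    then show ?thesis
      by (metis cinner_l2_commute)
  qed
  have lin': "linear_graph (closure T)"
    using lin by (rule linear_graph_closure)
  have "h = 0" if h: "(0, h) \<in> closure T" for h
  proof (rule orthogonal_dense_eq_0[OF dense])
    fix g assume "g \<in> Domain T"
    then obtain g' where "(g, g') \<in> T" by auto
    then have "cinner_l2 h g = cinner_l2 0 g'"
      using sym1[OF h] by simp
    moreover have "cinner_l2 0 g' = 0"
      using cinner_l2_diff_left[of g' g' g'] by simp
    ultimately show "cinner_l2 g h = 0"
      by (metis cinner_l2_commute complex_cnj_zero)
  qed
  moreover have "(f, f') \<in> closure T \<Longrightarrow> (f, f'') \<in> closure T \<Longrightarrow> (0, f' - f'') \<in> closure T" for f f' f''
  proof -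
    assume a: "(f, f') \<in> closure T" "(f, f'') \<in> closure T"
    then have "(scaleC_l2 (-1) f, scaleC_l2 (-1) f'') \<in> closure T"
      using lin' unfolding linear_graph_def by fast
    then have "(- f, - f'') \<in> closure T"
      unfolding uminus_l2_halfline_def .
    then have "(f + - f, f' + - f'') \<in> closure T"
      using a lin' unfolding linear_graph_def by fast
    then show ?thesis by simp
  qed
  ultimately have "single_valued (closure T)"
    unfolding single_valued_def by (metis eq_iff_diff_eq_0)
  moreover have "closure (Domain (closure T)) = UNIV"
    using dense closure_mono[OF Domain_mono[OF closure_subset[of T]]] by auto
  ultimately show ?thesis
    using lin' sym2 by (auto simp: symmetric_operator_def)
qed

lemma cdim_l2_span_singleton:
  assumes "\<Phi> \<noteq> 0"
  shows "cdim_l2 (range (\<lambda>c. scaleC_l2 c \<Phi>)) = 1"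
proof -
  have eq: "range (\<lambda>c. scaleC_l2 c \<Phi>) = l2.span {\<Phi>}"
    by (simp add: l2.span_singleton)
  have "l2.dim (l2.span {\<Phi>}) = card {\<Phi>}"
    using assms by (intro l2.dim_span_eq_card_independent) simp
  then show ?thesis
    unfolding cdim_l2_def eq by (auto simp: one_enat_def intro!: exI[of _ "{\<Phi>}"])
qed

section \<open>Integrals over subsets of the line\<close>

lemma emeasure_lebesgue_singleton: "emeasure lebesgue {t :: real} = 0"
  by simp

lemma integrable_lebesgue_on_iff:
  fixes f :: "real \<Rightarrow> 'b::euclidean_space"
  assumes "S \<in> sets lebesgue"
  shows "integrable (lebesgue_on S) f \<longleftrightarrow> integrable lebesgue (\<lambda>t. indicator S t *\<^sub>R f t)"
  using assms by (intro integrable_restrict_space) simp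

text \<open>Functions in the domain of the Hamiltonian are given off the countable set of interaction points, elements
  of the Hilbert space on the whole half-line; measurability and integrals do not see the difference.\<close>

lemma
  fixes f :: "real \<Rightarrow> 'b::euclidean_space"
  assumes S: "S \<in> sets lebesgue" and N: "countable N"
  shows integrable_lebesgue_on_diff_countable:
      "integrable (lebesgue_on (S - N)) f \<longleftrightarrow> integrable (lebesgue_on S) f" (is ?A)
    and integral_lebesgue_on_diff_countable:
      "integral\<^sup>L (lebesgue_on (S - N)) f = integral\<^sup>L (lebesgue_on S) f" (is ?B)
    and measurable_lebesgue_on_diff_countable:
      "f \<in> borel_measurable (lebesgue_on (S - N)) \<longleftrightarrow> f \<in> borel_measurable (lebesgue_on S)" (is ?C)
proof -
  have N': "N \<in> sets lebesgue"
    by (rule sets.countable[OF _ N]) simp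
  have *: "emeasure lebesgue {t :: real} = 0" "{t :: real} \<in> sets lebesgue" for t
    by (simp_all add: emeasure_lebesgue_singleton)
  have eq: "indicat_real (S - N) t *\<^sub>R f t = indicat_real S t *\<^sub>R f t" if "t \<notin> N" for t
    using that by (simp add: indicator_def)
  have S': "S \<inter> space lebesgue \<in> sets lebesgue" "(S - N) \<inter> space lebesgue \<in> sets lebesgue"
    using S N' by auto
  show ?A
    unfolding integrable_restrict_space[OF S'(1)] integrable_restrict_space[OF S'(2)]
    by (rule integrable_discrete_difference[OF N * eq])
  show ?B
    unfolding integral_restrict_space[OF S'(1)] integral_restrict_space[OF S'(2)]
    by (rule integral_discrete_difference[OF N * eq])
  show ?C
    unfolding borel_measurable_restrict_space_iff[OF S'(1)] borel_measurable_restrict_space_iff[OF S'(2)]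
  proof
    show "(\<lambda>t. indicat_real S t *\<^sub>R f t) \<in> borel_measurable lebesgue"
      if "(\<lambda>t. indicat_real (S - N) t *\<^sub>R f t) \<in> borel_measurable lebesgue"
      by (rule measurable_discrete_difference[OF that N *(2) _ eq]) auto
    show "(\<lambda>t. indicat_real (S - N) t *\<^sub>R f t) \<in> borel_measurable lebesgue"
      if "(\<lambda>t. indicat_real S t *\<^sub>R f t) \<in> borel_measurable lebesgue"
      by (rule measurable_discrete_difference[OF that N *(2) _ eq[symmetric]]) auto
  qed
qed

lemma
  fixes f :: "real \<Rightarrow> 'b::euclidean_space"
  assumes V: "V \<in> sets lebesgue" "V \<subseteq> U" and U: "U \<in> sets lebesgue"
    and zero: "\<And>t. t \<in> U - V \<Longrightarrow> f t = 0"
  shows integrable_lebesgue_on_subset_eq: "integrable (lebesgue_on V) f \<longleftrightarrow> integrable (lebesgue_on U) f"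
    and integral_lebesgue_on_subset_eq: "integral\<^sup>L (lebesgue_on V) f = integral\<^sup>L (lebesgue_on U) f"
proof -
  have "(\<lambda>t. indicator V t *\<^sub>R f t) = (\<lambda>t. indicator U t *\<^sub>R f t)"
    using zero V by (auto simp: fun_eq_iff indicator_def)
  then show "integrable (lebesgue_on V) f \<longleftrightarrow> integrable (lebesgue_on U) f"
    and "integral\<^sup>L (lebesgue_on V) f = integral\<^sup>L (lebesgue_on U) f"
    using V U by (simp_all add: integrable_restrict_space integral_restrict_space)
qed

lemma integrable_lebesgue_on_mono:
  fixes f :: "real \<Rightarrow> 'b::euclidean_space"
  assumes "integrable (lebesgue_on U) f" "V \<subseteq> U" "V \<in> sets lebesgue" "U \<in> sets lebesgue"
  shows "integrable (lebesgue_on V) f"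
proof -
  have "integrable lebesgue (\<lambda>t. indicator U t *\<^sub>R f t)"
    using assms by (simp only: integrable_lebesgue_on_iff)
  then have "integrable lebesgue (\<lambda>t. indicator V t *\<^sub>R (indicator U t *\<^sub>R f t))"
    by (rule integrable_mult_indicator[rotated]) (simp add: assms)
  moreover have "(\<lambda>t. indicator V t *\<^sub>R (indicator U t *\<^sub>R f t)) = (\<lambda>t. indicator V t *\<^sub>R f t)"
    using assms by (auto simp: fun_eq_iff indicator_def)
  ultimately show ?thesis
    using assms by (simp only: integrable_lebesgue_on_iff)
qed

lemma square_integrable_on_mono:
  assumes "square_integrable_on U f" "V \<subseteq> U" "V \<in> sets lebesgue" "U \<in> sets lebesgue"
  shows "square_integrable_on V f"
  using measurable_restrict_mono[of f lebesgue U borel V]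
    integrable_lebesgue_on_mono[of U "\<lambda>t. (cmod (f t))\<^sup>2" V] assms
  unfolding square_integrable_on_def by blast

lemma square_integrable_on_diff_countable:
  assumes "S \<in> sets lebesgue" "countable N"
  shows "square_integrable_on (S - N) f \<longleftrightarrow> square_integrable_on S f"
  using assms by (simp add: square_integrable_on_def integrable_lebesgue_on_diff_countable
      measurable_lebesgue_on_diff_countable)

lemma integrable_lebesgue_on_bounded_support:
  fixes f :: "real \<Rightarrow> 'b::euclidean_space"
  assumes S: "S \<in> sets lebesgue" and f: "f \<in> borel_measurable (lebesgue_on S)"
    and bd: "\<And>t. t \<in> S \<Longrightarrow> norm (f t) \<le> B" and supp: "\<And>t. t \<in> S \<Longrightarrow> R < \<bar>t\<bar> \<Longrightarrow> f t = 0"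
  shows "integrable (lebesgue_on S) f"
proof (rule Bochner_Integration.integrable_bound[OF _ f])
  have "integrable lebesgue (\<lambda>t. indicator {-R..R} t *\<^sub>R B)"
    by (intro integrable_scaleR_left integrable_real_indicator)
      (auto simp: emeasure_lborel_Icc_eq)
  then have "integrable lebesgue (\<lambda>t. indicator S t *\<^sub>R (indicator {-R..R} t *\<^sub>R B))"
    by (rule integrable_mult_indicator[OF S])
  then show "integrable (lebesgue_on S) (\<lambda>t. indicator {-R..R} t *\<^sub>R B)"
    using S by (simp only: integrable_lebesgue_on_iff)
  show "AE t in lebesgue_on S. norm (f t) \<le> norm (indicator {-R..R} t *\<^sub>R B)"
  proof (rule AE_I2)
    fix t assume "t \<in> space (lebesgue_on S)"
    then have t: "t \<in> S" by simp
    show "norm (f t) \<le> norm (indicator {-R..R} t *\<^sub>R B)"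
      using bd[OF t] supp[OF t] by (cases "\<bar>t\<bar> \<le> R") (auto simp: indicator_def abs_le_iff)
  qed
qed

lemma square_integrable_on_bounded_support:
  assumes S: "S \<in> sets lebesgue" and f: "f \<in> borel_measurable (lebesgue_on S)"
    and bd: "\<And>t. t \<in> S \<Longrightarrow> cmod (f t) \<le> B" and supp: "\<And>t. t \<in> S \<Longrightarrow> R < \<bar>t\<bar> \<Longrightarrow> f t = 0"
  shows "square_integrable_on S f"
  unfolding square_integrable_on_def
proof
  show "integrable (lebesgue_on S) (\<lambda>t. (cmod (f t))\<^sup>2)"
  proof (rule integrable_lebesgue_on_bounded_support[OF S])
    show "(\<lambda>t. (cmod (f t))\<^sup>2) \<in> borel_measurable (lebesgue_on S)"
      using f by measurable
    show "norm ((cmod (f t))\<^sup>2) \<le> B\<^sup>2" if "t \<in> S" for t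
      using bd[OF that] by (auto intro: power_mono)
  qed (use supp in auto)
qed fact

lemma square_integrable_on_cnj:
  assumes "square_integrable_on S f"
  shows "square_integrable_on S (\<lambda>t. cnj (f t))"
proof -
  have "f \<in> borel_measurable (lebesgue_on S)"
    using assms by (simp add: square_integrable_on_def)
  then have "(\<lambda>t. cnj (f t)) \<in> borel_measurable (lebesgue_on S)"
    by (rule borel_measurable_continuous_on[rotated]) (auto intro: continuous_intros)
  then show ?thesis
    using assms by (simp add: square_integrable_on_def)
qed

lemma square_integrable_on_integrable_mult:
  assumes "square_integrable_on S f" "square_integrable_on S g"
  shows "integrable (lebesgue_on S) (\<lambda>t. f t * g t)"
  using square_integrable_on_integrable_cnj[OF assms(1) square_integrable_on_cnj[OF assms(2)]] by simp

lemma integrable_continuous_compact_support: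
  fixes f :: "real \<Rightarrow> 'b::euclidean_space"
  assumes "continuous_on UNIV f" "compact K" "\<And>t. t \<notin> K \<Longrightarrow> f t = 0"
  shows "integrable lebesgue f"
proof -
  have "integrable lborel (\<lambda>t. indicator K t *\<^sub>R f t)"
    by (intro borel_integrable_compact assms continuous_on_subset[OF assms(1)]) auto
  moreover have "(\<lambda>t. indicator K t *\<^sub>R f t) = f"
    using assms(3) by (auto simp: indicator_def fun_eq_iff)
  ultimately have "integrable lborel f" by simp
  then show ?thesis
    by (simp add: integrable_completion borel_measurable_integrable)
qed

lemma square_integrable_on_continuous_compact_support:
  assumes S: "S \<in> sets lebesgue" and c: "continuous_on UNIV c" "compact K" "\<And>t. t \<notin> K \<Longrightarrow> c t = 0"
  shows "square_integrable_on S c"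
proof -
  obtain R where R: "\<And>t. t \<in> K \<Longrightarrow> \<bar>t\<bar> \<le> R"
    using compact_imp_bounded[OF c(2)] by (auto simp: bounded_iff)
  have "compact (c ` K)"
    by (intro compact_continuous_image c continuous_on_subset[OF c(1)]) auto
  then obtain B where "\<And>t. t \<in> K \<Longrightarrow> cmod (c t) \<le> B"
    using compact_imp_bounded by (force simp: bounded_iff)
  then have B: "cmod (c t) \<le> \<bar>B\<bar>" for t
    using c(3) by (cases "t \<in> K") force+
  show ?thesis
  proof (rule square_integrable_on_bounded_support[OF S])
    show "c \<in> borel_measurable (lebesgue_on S)"
      by (intro continuous_imp_measurable_on_sets_lebesgue S continuous_on_subset[OF c(1)]) auto
    show "\<And>t. t \<in> S \<Longrightarrow> cmod (c t) \<le> \<bar>B\<bar>" by (rule B)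
    show "\<And>t. t \<in> S \<Longrightarrow> R < \<bar>t\<bar> \<Longrightarrow> c t = 0" using c(3) R by force
  qed
qed

lemma integral_derivative_compact_support:
  fixes h :: "real \<Rightarrow> 'b::euclidean_space"
  assumes h: "\<And>t. (h has_vector_derivative h1 t) (at t)" and cont: "continuous_on UNIV h1"
    and K: "compact K" "\<And>t. t \<notin> K \<Longrightarrow> h t = 0" "\<And>t. t \<notin> K \<Longrightarrow> h1 t = 0"
  shows "integral\<^sup>L lebesgue h1 = 0"
proof -
  obtain R where R: "\<And>t. t \<in> K \<Longrightarrow> \<bar>t\<bar> \<le> R"
    using compact_imp_bounded[OF K(1)] by (auto simp: bounded_iff)
  have R': "h t = 0" "h1 t = 0" if "\<bar>t\<bar> > R" for t
    using K R that by force+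
  let ?R = "\<bar>R\<bar> + 1"
  have "(h1 has_integral (h ?R - h (- ?R))) {- ?R..?R}"
    by (intro fundamental_theorem_of_calculus) (auto intro: has_vector_derivative_at_within[OF h])
  then have "(h1 has_integral 0) {- ?R..?R}"
    by (simp add: R')
  then have "(h1 has_integral 0) UNIV"
    by (rule has_integral_on_superset) (auto simp: R')
  moreover have "(h1 has_integral integral\<^sup>L lebesgue h1) UNIV"
    by (intro has_integral_integral_lebesgue integrable_continuous_compact_support[OF cont K(1) K(3)])
  ultimately show ?thesis
    by (rule has_integral_unique[OF _ , symmetric])
qed

section \<open>Weak derivatives\<close>

text \<open>A product of a compactly supported function with a function that is differentiable on \<open>U\<close> only
  becomes differentiable everywhere when extended by zero: \<open>U\<close> and the complement of the support are two
  open sets that cover the line.\<close>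

lemma
  fixes \<eta> :: "real \<Rightarrow> complex"
  assumes U: "open U" and K: "compact K" "K \<subseteq> U"
    and \<eta>: "\<And>t. (\<eta> has_vector_derivative \<eta>' t) (at t)" "continuous_on UNIV \<eta>'"
    and supp': "\<forall>t. t \<notin> K \<longrightarrow> \<eta> t = 0"
    and g': "\<forall>t\<in>U. (g has_vector_derivative g1 t) (at t)" "continuous_on U g1"
  shows extend_by_zero_support: "\<And>t. t \<notin> K \<Longrightarrow> \<eta>' t = 0" (is "\<And>t. t \<notin> K \<Longrightarrow> ?T t")
    and extend_by_zero_derivative:
      "\<And>t. ((\<lambda>t. if t \<in> U then \<eta> t * g t else 0) has_vector_derivative
          (if t \<in> U then \<eta>' t * g t + \<eta> t * g1 t else 0)) (at t)" (is "\<And>t. ?D t")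
    and extend_by_zero_continuous:
      "continuous_on UNIV (\<lambda>t. if t \<in> U then \<eta> t * g t else 0)"
      "continuous_on UNIV (\<lambda>t. if t \<in> U then \<eta>' t * g t else 0)"
      "continuous_on UNIV (\<lambda>t. if t \<in> U then \<eta> t * g1 t else 0)"
proof -
  note supp = supp'[rule_format] and g = g'(1)[rule_format] g'(2)
  have cK: "open (- K)"
    using compact_imp_closed[OF K(1)] by (simp add: open_Compl)
  show T: "?T t" if t: "t \<notin> K" for t
  proof -
    have "(\<eta> has_vector_derivative 0) (at t)"
      by (rule has_vector_derivative_transform_within_open[where f = "\<lambda>t. 0" and S = "- K"])
        (use cK t supp in auto)
    then show ?thesis
      using vector_derivative_unique_at \<eta>(1) by blast
  qed
  show "?D t" for t
  proof (cases "t \<in> U")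
    case True
    have "((\<lambda>t. \<eta> t * g t) has_vector_derivative (\<eta> t * g1 t + \<eta>' t * g t)) (at t)"
      by (intro has_vector_derivative_mult \<eta> g True)
    then have "((\<lambda>t. if t \<in> U then \<eta> t * g t else 0) has_vector_derivative (\<eta> t * g1 t + \<eta>' t * g t)) (at t)"
      by (rule has_vector_derivative_transform_within_open[OF _ U True]) auto
    then show ?thesis
      using True by (simp add: add.commute)
  next
    case False
    have "((\<lambda>t. if t \<in> U then \<eta> t * g t else 0) has_vector_derivative 0) (at t)"
      by (rule has_vector_derivative_transform_within_open[where f = "\<lambda>t. 0" and S = "- K"])
        (use cK False K supp in auto)
    then show ?thesis
      using False by simp
  qed
  have ext: "continuous_on UNIV (\<lambda>t. if t \<in> U then c t * e t else 0)"
    if "continuous_on UNIV c" "continuous_on U e" "\<And>t. t \<notin> K \<Longrightarrow> c t = 0" for c e :: "real \<Rightarrow> complex"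
  proof -
    have "continuous_on U (\<lambda>t. if t \<in> U then c t * e t else 0)"
      using continuous_on_mult[OF continuous_on_subset[OF that(1)] that(2)]
      by (subst continuous_on_cong[OF refl, of _ _ "\<lambda>t. c t * e t"]) auto
    moreover have "continuous_on (- K) (\<lambda>t. if t \<in> U then c t * e t else 0)"
      using that(3) by (subst continuous_on_cong[OF refl, of _ _ "\<lambda>t. 0"]) auto
    ultimately have "continuous_on (U \<union> - K) (\<lambda>t. if t \<in> U then c t * e t else 0)"
      by (rule continuous_on_open_Un[OF U cK])
    moreover have "U \<union> - K = UNIV"
      using K by auto
    ultimately show ?thesis by simp
  qed
  have "continuous_on U g"
    using g(1) by (meson continuous_at_imp_continuous_on has_vector_derivative_continuous)
  moreover have "continuous_on UNIV \<eta>"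
    using \<eta>(1) by (meson continuous_at_imp_continuous_on has_vector_derivative_continuous)
  ultimately show
      "continuous_on UNIV (\<lambda>t. if t \<in> U then \<eta> t * g t else 0)"
      "continuous_on UNIV (\<lambda>t. if t \<in> U then \<eta>' t * g t else 0)"
      "continuous_on UNIV (\<lambda>t. if t \<in> U then \<eta> t * g1 t else 0)"
    using T supp \<eta>(2) g(2) by (intro ext; blast)+
qed

text \<open>The product of \<open>g\<close> with a test function, extended by zero, has a continuous derivative, whose
  integral vanishes by the fundamental theorem of calculus.\<close>

lemma weak_derivative_on_classical:
  assumes U: "open U" and g: "\<And>t. t \<in> U \<Longrightarrow> (g has_vector_derivative g1 t) (at t)" "continuous_on U g1"
  shows "weak_derivative_on U g g1"
  unfolding weak_derivative_on_def
proof (intro allI impI)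
  fix \<phi> \<phi>' assume test: "C1_test_function U \<phi> \<phi>'"
  let ?K = "closure {t. \<phi> t \<noteq> 0}"
  have K: "compact ?K" "?K \<subseteq> U"
    using test by (auto simp: C1_test_function_def)
  have \<phi>: "((\<lambda>t. of_real (\<phi> t) :: complex) has_vector_derivative of_real (\<phi>' t)) (at t)" for t
    using test by (auto simp: C1_test_function_def intro: has_vector_derivative_of_real)
  have \<phi>': "continuous_on UNIV (\<lambda>t. of_real (\<phi>' t) :: complex)"
    using test by (auto simp: C1_test_function_def intro: continuous_intros)
  have supp: "complex_of_real (\<phi> t) = 0" if "t \<notin> ?K" for t
    using that closure_subset[of "{t. \<phi> t \<noteq> 0}"] by auto
  have supp': "\<forall>t. t \<notin> ?K \<longrightarrow> complex_of_real (\<phi> t) = 0"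
    and g': "\<forall>t\<in>U. (g has_vector_derivative g1 t) (at t)"
    using supp g(1) by blast+
  note ext = extend_by_zero_support[where \<eta> = "\<lambda>t. of_real (\<phi> t)" and \<eta>' = "\<lambda>t. of_real (\<phi>' t)" and g = g and ?g1.0 = g1,
      OF U K \<phi> \<phi>' supp' g' g(2)]
    extend_by_zero_derivative[where \<eta> = "\<lambda>t. of_real (\<phi> t)" and \<eta>' = "\<lambda>t. of_real (\<phi>' t)" and g = g and ?g1.0 = g1,
      OF U K \<phi> \<phi>' supp' g' g(2)]
    extend_by_zero_continuous[where \<eta> = "\<lambda>t. of_real (\<phi> t)" and \<eta>' = "\<lambda>t. of_real (\<phi>' t)" and g = g and ?g1.0 = g1,
      OF U K \<phi> \<phi>' supp' g' g(2)]
  let ?a = "\<lambda>t. if t \<in> U then of_real (\<phi>' t) * g t else 0"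
  let ?b = "\<lambda>t. if t \<in> U then of_real (\<phi> t) * g1 t else 0"
  have zero: "?a t = 0" "?b t = 0" if "t \<notin> ?K" for t
    by (simp_all only: ext(1)[OF that] supp[OF that] mult_zero_left if_cancel)
  have i: "integrable lebesgue ?a" "integrable lebesgue ?b"
    by (rule integrable_continuous_compact_support[OF ext(4) K(1)], fact zero,
        rule integrable_continuous_compact_support[OF ext(5) K(1)], fact zero)
  have "integral\<^sup>L lebesgue (\<lambda>t. ?a t + ?b t) = 0"
  proof (rule integral_derivative_compact_support[OF _ _ K(1)])
    show "((\<lambda>t. if t \<in> U then of_real (\<phi> t) * g t else 0) has_vector_derivative ?a t + ?b t) (at t)" for t
      using ext(2)[of t] by (auto split: if_splits)
    show "continuous_on UNIV (\<lambda>t. ?a t + ?b t)"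
      by (intro continuous_on_add ext(4) ext(5))
    show "(if t \<in> U then of_real (\<phi> t) * g t else 0) = 0" if "t \<notin> ?K" for t
      by (simp only: supp[OF that] mult_zero_left if_cancel)
    show "?a t + ?b t = 0" if "t \<notin> ?K" for t
      by (simp only: zero[OF that] add_0_left)
  qed
  then have "integral\<^sup>L lebesgue ?a = - integral\<^sup>L lebesgue ?b"
    using i by (simp add: add_eq_0_iff)
  moreover have "integral\<^sup>L lebesgue ?a = integral\<^sup>L (lebesgue_on U) (\<lambda>t. of_real (\<phi>' t) * g t)"
    using U by (subst integral_restrict_space) (auto intro!: Bochner_Integration.integral_cong simp: indicator_def)
  moreover have "integral\<^sup>L lebesgue ?b = integral\<^sup>L (lebesgue_on U) (\<lambda>t. of_real (\<phi> t) * g1 t)"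
    using U by (subst integral_restrict_space) (auto intro!: Bochner_Integration.integral_cong simp: indicator_def)
  ultimately show "integral\<^sup>L (lebesgue_on U) (\<lambda>t. of_real (\<phi>' t) * g t) =
      - integral\<^sup>L (lebesgue_on U) (\<lambda>t. of_real (\<phi> t) * g1 t)"
    by simp
qed

lemma C1_test_function_derivative_eq_0:
  assumes "C1_test_function U \<phi> \<phi>'" "t \<notin> closure {t. \<phi> t \<noteq> 0}"
  shows "\<phi> t = 0" "\<phi>' t = 0"
proof -
  show "\<phi> t = 0"
    using assms(2) closure_subset[of "{t. \<phi> t \<noteq> 0}"] by auto
  have "(\<phi> has_real_derivative 0) (at t)"
    by (rule has_field_derivative_transform_within_open[where f = "\<lambda>t. 0" and S = "- closure {t. \<phi> t \<noteq> 0}"])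
      (use assms closure_subset[of "{t. \<phi> t \<noteq> 0}"] in auto)
  moreover have "(\<phi> has_real_derivative \<phi>' t) (at t)"
    using assms by (auto simp: C1_test_function_def)
  ultimately show "\<phi>' t = 0"
    by (rule DERIV_unique[symmetric])
qed

lemma weak_derivative_on_subset:
  assumes "weak_derivative_on U f f1" "open U" "open V" "V \<subseteq> U"
  shows "weak_derivative_on V f f1"
  unfolding weak_derivative_on_def
proof (intro allI impI)
  fix \<phi> \<phi>' assume test: "C1_test_function V \<phi> \<phi>'"
  then have "C1_test_function U \<phi> \<phi>'" and sub: "closure {t. \<phi> t \<noteq> 0} \<subseteq> V"
    using assms(4) by (auto simp: C1_test_function_def)
  then have "integral\<^sup>L (lebesgue_on U) (\<lambda>t. of_real (\<phi>' t) * f t) =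
        - integral\<^sup>L (lebesgue_on U) (\<lambda>t. of_real (\<phi> t) * f1 t)"
    using assms(1) by (auto simp: weak_derivative_on_def)
  moreover have zero: "of_real (\<phi>' t) * f t = 0" "of_real (\<phi> t) * f1 t = 0" if "t \<in> U - V" for t
  proof -
    have "t \<notin> closure {t. \<phi> t \<noteq> 0}"
      using that sub by blast
    from C1_test_function_derivative_eq_0[OF test this]
    show "of_real (\<phi>' t) * f t = 0" "of_real (\<phi> t) * f1 t = 0" by simp_all
  qed
  have "V \<in> sets lebesgue" "U \<in> sets lebesgue"
    using assms by auto
  note integral_lebesgue_on_subset_eq[OF this(1) assms(4) this(2), OF zero(1)]
    integral_lebesgue_on_subset_eq[OF this(1) assms(4) this(2), OF zero(2)]
  ultimately show "integral\<^sup>L (lebesgue_on V) (\<lambda>t. of_real (\<phi>' t) * f t) =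
        - integral\<^sup>L (lebesgue_on V) (\<lambda>t. of_real (\<phi> t) * f1 t)"
    by simp
qed

lemma weak_derivative_on_cnj:
  assumes "weak_derivative_on U f f1"
  shows "weak_derivative_on U (\<lambda>t. cnj (f t)) (\<lambda>t. cnj (f1 t))"
  unfolding weak_derivative_on_def
proof (intro allI impI)
  fix \<phi> \<phi>' assume "C1_test_function U \<phi> \<phi>'"
  then have "cnj (integral\<^sup>L (lebesgue_on U) (\<lambda>t. of_real (\<phi>' t) * f t)) =
      cnj (- integral\<^sup>L (lebesgue_on U) (\<lambda>t. of_real (\<phi> t) * f1 t))"
    using assms by (auto simp: weak_derivative_on_def)
  then show "integral\<^sup>L (lebesgue_on U) (\<lambda>t. of_real (\<phi>' t) * cnj (f t)) =
      - integral\<^sup>L (lebesgue_on U) (\<lambda>t. of_real (\<phi> t) * cnj (f1 t))"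
    by (simp flip: Bochner_Integration.integral_cnj)
qed

lemma C1_test_function_square_integrable:
  assumes "C1_test_function U \<phi> \<phi>'" "S \<in> sets lebesgue"
  shows "square_integrable_on S (\<lambda>t. of_real (\<phi> t))" "square_integrable_on S (\<lambda>t. of_real (\<phi>' t))"
proof -
  have d: "\<And>t. (\<phi> has_real_derivative \<phi>' t) (at t)" and c: "continuous_on UNIV \<phi>'"
    and K: "compact (closure {t. \<phi> t \<noteq> 0})"
    using assms(1) by (auto simp: C1_test_function_def)
  have c0: "continuous_on UNIV \<phi>"
    using d by (rule DERIV_continuous_on)
  have c1: "continuous_on UNIV (\<lambda>t. complex_of_real (\<phi> t))" "continuous_on UNIV (\<lambda>t. complex_of_real (\<phi>' t))"
    by (rule continuous_on_of_real[OF c0], rule continuous_on_of_real[OF c])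
  show "square_integrable_on S (\<lambda>t. of_real (\<phi> t))"
  proof (rule square_integrable_on_continuous_compact_support[OF assms(2) c1(1) K])
    fix t assume "t \<notin> closure {t. \<phi> t \<noteq> 0}"
    from C1_test_function_derivative_eq_0(1)[OF assms(1) this]
    show "complex_of_real (\<phi> t) = 0" by simp
  qed
  show "square_integrable_on S (\<lambda>t. of_real (\<phi>' t))"
  proof (rule square_integrable_on_continuous_compact_support[OF assms(2) c1(2) K])
    fix t assume "t \<notin> closure {t. \<phi> t \<noteq> 0}"
    from C1_test_function_derivative_eq_0(2)[OF assms(1) this]
    show "complex_of_real (\<phi>' t) = 0" by simp
  qed
qed

lemma weak_derivative_on_add:
  assumes "weak_derivative_on U f f1" "weak_derivative_on U g g1" and U: "U \<in> sets lebesgue"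
    and sq: "square_integrable_on U f" "square_integrable_on U f1"
      "square_integrable_on U g" "square_integrable_on U g1"
  shows "weak_derivative_on U (\<lambda>t. f t + g t) (\<lambda>t. f1 t + g1 t)"
  unfolding weak_derivative_on_def
proof (intro allI impI)
  fix \<phi> \<phi>' assume t: "C1_test_function U \<phi> \<phi>'"
  let ?L = "integral\<^sup>L (lebesgue_on U)"
  note s = C1_test_function_square_integrable[OF t U]
  note m = square_integrable_on_integrable_mult
  have "?L (\<lambda>t. of_real (\<phi>' t) * (f t + g t)) = ?L (\<lambda>t. of_real (\<phi>' t) * f t) + ?L (\<lambda>t. of_real (\<phi>' t) * g t)"
    unfolding distrib_left by (rule Bochner_Integration.integral_add[OF m[OF s(2) sq(1)] m[OF s(2) sq(3)]])
  moreover have "?L (\<lambda>t. of_real (\<phi> t) * (f1 t + g1 t)) = ?L (\<lambda>t. of_real (\<phi> t) * f1 t) + ?L (\<lambda>t. of_real (\<phi> t) * g1 t)"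
    unfolding distrib_left by (rule Bochner_Integration.integral_add[OF m[OF s(1) sq(2)] m[OF s(1) sq(4)]])
  moreover have "?L (\<lambda>t. of_real (\<phi>' t) * f t) = - ?L (\<lambda>t. of_real (\<phi> t) * f1 t)"
    "?L (\<lambda>t. of_real (\<phi>' t) * g t) = - ?L (\<lambda>t. of_real (\<phi> t) * g1 t)"
    using assms(1,2) t unfolding weak_derivative_on_def by blast+
  ultimately show "?L (\<lambda>t. of_real (\<phi>' t) * (f t + g t)) = - ?L (\<lambda>t. of_real (\<phi> t) * (f1 t + g1 t))"
    by simp
qed

lemma weak_derivative_on_scale:
  assumes "weak_derivative_on U f f1"
  shows "weak_derivative_on U (\<lambda>t. c * f t) (\<lambda>t. c * f1 t)"
  unfolding weak_derivative_on_def
proof (intro allI impI)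
  fix \<phi> \<phi>' assume "C1_test_function U \<phi> \<phi>'"
  then have "c * integral\<^sup>L (lebesgue_on U) (\<lambda>t. of_real (\<phi>' t) * f t) =
      c * - integral\<^sup>L (lebesgue_on U) (\<lambda>t. of_real (\<phi> t) * f1 t)"
    using assms unfolding weak_derivative_on_def by metis
  then show "integral\<^sup>L (lebesgue_on U) (\<lambda>t. of_real (\<phi>' t) * (c * f t)) =
      - integral\<^sup>L (lebesgue_on U) (\<lambda>t. of_real (\<phi> t) * (c * f1 t))"
    by (simp add: mult.left_commute)
qed

lemma W22_on_subset:
  assumes "W22_on U f f1 f2" "open U" "open V" "V \<subseteq> U"
  shows "W22_on V f f1 f2"
proof -
  have "V \<in> sets lebesgue" "U \<in> sets lebesgue"
    using assms by auto
  then show ?thesis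
    using assms square_integrable_on_mono[OF _ \<open>V \<subseteq> U\<close>] weak_derivative_on_subset[OF _ assms(2-4)]
      continuous_on_subset[OF _ \<open>V \<subseteq> U\<close>]
    unfolding W22_on_def by blast
qed

lemma W22_on_classical:
  assumes "open U" "\<And>t. t \<in> U \<Longrightarrow> (f has_vector_derivative f1 t) (at t)"
    "\<And>t. t \<in> U \<Longrightarrow> (f1 has_vector_derivative f2 t) (at t)" "continuous_on U f2"
    "square_integrable_on U f" "square_integrable_on U f1" "square_integrable_on U f2"
  shows "W22_on U f f1 f2"
proof -
  have "continuous_on U f" "continuous_on U f1"
    using assms by (meson continuous_at_imp_continuous_on has_vector_derivative_continuous)+
  then show ?thesis
    using assms by (auto simp: W22_on_def intro!: weak_derivative_on_classical)
qed

section \<open>Cutoff functions\<close>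

text \<open>Powers of the positive part are differentiable across the kink at \<open>0\<close>; both kinds of cutoff
  functions are built from them.\<close>

lemma max_power_has_real_derivative:
  "((\<lambda>s::real. (max 0 s) ^ Suc (Suc n)) has_real_derivative real (n + 2) * (max 0 s) ^ Suc n) (at s)"
proof -
  consider "s > 0" | "s < 0" | "s = 0" by linarith
  then show ?thesis
  proof cases
    case 1
    have "((\<lambda>s. s ^ Suc (Suc n)) has_real_derivative real (n + 2) * s ^ Suc n) (at s)"
      using DERIV_pow[of "Suc (Suc n)" s] by simp
    then have "((\<lambda>s. (max 0 s) ^ Suc (Suc n)) has_real_derivative real (n + 2) * s ^ Suc n) (at s)"
      by (rule has_field_derivative_transform_within_open[where S = "{0<..}"]) (use 1 in auto)
    with 1 show ?thesis by (simp add: max_def)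
  next
    case 2
    have "((\<lambda>s::real. 0::real) has_real_derivative 0) (at s)" by simp
    then have "((\<lambda>s. (max 0 s) ^ Suc (Suc n)) has_real_derivative 0) (at s)"
      by (rule has_field_derivative_transform_within_open[where S = "{..<0}"]) (use 2 in auto)
    with 2 show ?thesis by (simp add: max_def)
  next
    case 3
    have "((\<lambda>h::real. ((max 0 h) ^ Suc (Suc n)) / h) \<longlongrightarrow> 0) (at 0)"
    proof (rule Lim_null_comparison)
      show "\<forall>\<^sub>F h::real in at 0. norm ((max 0 h) ^ Suc (Suc n) / h) \<le> \<bar>h\<bar> ^ Suc n"
      proof (rule always_eventually, rule allI)
        fix h :: real
        show "norm ((max 0 h) ^ Suc (Suc n) / h) \<le> \<bar>h\<bar> ^ Suc n"
        proof (cases "h > 0")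
          case True
          then show ?thesis by simp
        next
          case False
          then have "max 0 h = 0" by simp
          then show ?thesis
            using zero_le_power_abs[of h "Suc n"] by (simp only: zero_power[OF zero_less_Suc] div_0 norm_zero)
        qed
      qed
      have "((\<lambda>h::real. \<bar>h\<bar> ^ Suc n) \<longlongrightarrow> \<bar>0\<bar> ^ Suc n) (at 0)"
        by (intro tendsto_intros)
      then show "((\<lambda>h::real. \<bar>h\<bar> ^ Suc n) \<longlongrightarrow> 0) (at 0)" by simp
    qed
    then show ?thesis
      using 3 by (simp add: DERIV_def)
  qed
qed

definition smooth_step :: "real \<Rightarrow> real" where
  "smooth_step s = (max 0 s)\<^sup>2 / ((max 0 s)\<^sup>2 + (max 0 (1 - s))\<^sup>2)"

text \<open>The derivative of \<open>smooth_step\<close>, in a form that is visibly nonnegative.\<close>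

definition smooth_step' :: "real \<Rightarrow> real" where
  "smooth_step' s = 2 * max 0 s * max 0 (1 - s) * (max 0 s + max 0 (1 - s)) /
     ((max 0 s)\<^sup>2 + (max 0 (1 - s))\<^sup>2)\<^sup>2"

lemma smooth_step_denominator: "(max 0 s)\<^sup>2 + (max 0 (1 - s))\<^sup>2 > (0::real)"
proof (cases "s > 0")
  case True
  then have "(max 0 s)\<^sup>2 > 0" by (simp add: max_def)
  then show ?thesis by (simp add: add_pos_nonneg)
next
  case False
  then have "(max 0 (1 - s))\<^sup>2 > 0" by (simp add: max_def)
  then show ?thesis by (simp add: add_nonneg_pos)
qed

lemma smooth_step_derivative: "(smooth_step has_real_derivative smooth_step' s) (at s)"
proof -
  have 1: "((\<lambda>s. (max 0 s)\<^sup>2) has_real_derivative 2 * max 0 s) (at s)" for s :: real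
    using max_power_has_real_derivative[of 0 s] by (simp add: numeral_2_eq_2)
  have "((\<lambda>s. 1 - s) has_real_derivative (-1)) (at s)"
    by (auto intro!: derivative_eq_intros)
  from DERIV_chain2[OF 1 this] have 2: "((\<lambda>s. (max 0 (1 - s))\<^sup>2) has_real_derivative - (2 * max 0 (1 - s))) (at s)"
    by simp
  have alg: "(2 * p * (p\<^sup>2 + q\<^sup>2) - p\<^sup>2 * (2 * p + - (2 * q))) / ((p\<^sup>2 + q\<^sup>2) * (p\<^sup>2 + q\<^sup>2)) =
      2 * p * q * (p + q) / (p\<^sup>2 + q\<^sup>2)\<^sup>2" for p q :: real
    unfolding power2_eq_square by (simp add: algebra_simps)
  have "((\<lambda>s. (max 0 s)\<^sup>2 / ((max 0 s)\<^sup>2 + (max 0 (1 - s))\<^sup>2)) has_real_derivative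
      (2 * max 0 s * ((max 0 s)\<^sup>2 + (max 0 (1 - s))\<^sup>2)
        - (max 0 s)\<^sup>2 * (2 * max 0 s + - (2 * max 0 (1 - s)))) /
      (((max 0 s)\<^sup>2 + (max 0 (1 - s))\<^sup>2) * ((max 0 s)\<^sup>2 + (max 0 (1 - s))\<^sup>2))) (at s)"
    by (rule DERIV_divide[OF 1 DERIV_add[OF 1 2]]) (use smooth_step_denominator[of s] in linarith)
  then show ?thesis
    unfolding alg smooth_step_def[abs_def] smooth_step'_def .
qed

lemma smooth_step_continuous: "continuous_on UNIV smooth_step'"
proof -
  have "((max 0 s)\<^sup>2 + (max 0 (1 - s))\<^sup>2)\<^sup>2 \<noteq> 0" for s :: real
    using smooth_step_denominator[of s] by (metis less_irrefl zero_eq_power2)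
  then show ?thesis
    unfolding smooth_step'_def[abs_def] by (intro continuous_on_divide continuous_intros ballI)
qed

lemma smooth_step_simps:
  "s \<le> 0 \<Longrightarrow> smooth_step s = 0" "s \<ge> 1 \<Longrightarrow> smooth_step s = 1"
  "s \<le> 0 \<Longrightarrow> smooth_step' s = 0" "s \<ge> 1 \<Longrightarrow> smooth_step' s = 0"
  by (auto simp: smooth_step_def smooth_step'_def max_def)

lemma smooth_step_bounds: "0 \<le> smooth_step s" "smooth_step s \<le> 1" "0 \<le> smooth_step' s"
proof -
  note smooth_step_denominator[of s]
  then show "0 \<le> smooth_step s" "smooth_step s \<le> 1"
    unfolding smooth_step_def by (simp_all only: zero_le_divide_iff divide_le_eq_1_pos) simp_all
  show "0 \<le> smooth_step' s"
    unfolding smooth_step'_def by (intro divide_nonneg_nonneg mult_nonneg_nonneg add_nonneg_nonneg) auto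
qed

lemma weighted_average_near:
  fixes w :: "real \<Rightarrow> complex"
  assumes \<kappa>: "continuous_on {p..q} \<kappa>" "(\<kappa> has_integral 1) {p..q}" "\<And>t. t \<in> {p..q} \<Longrightarrow> 0 \<le> \<kappa> t"
    and w: "continuous_on {p..q} w" "\<And>t. t \<in> {p..q} \<Longrightarrow> cmod (w t - A) \<le> e"
  shows "cmod (integral {p..q} (\<lambda>t. of_real (\<kappa> t) * w t) - A) \<le> e"
proof -
  have i1: "((\<lambda>t. of_real (\<kappa> t) * A) has_integral A) {p..q}"
    using has_integral_mult_left[OF has_integral_of_real[OF \<kappa>(2)], of A] by simp
  have i2: "(\<lambda>t. of_real (\<kappa> t) * w t) integrable_on {p..q}"
    by (intro integrable_continuous_interval continuous_intros \<kappa> w)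
  have "integral {p..q} (\<lambda>t. of_real (\<kappa> t) * w t) - A
      = integral {p..q} (\<lambda>t. of_real (\<kappa> t) * w t) - integral {p..q} (\<lambda>t. of_real (\<kappa> t) * A)"
    unfolding integral_unique[OF i1] ..
  also have "\<dots> = integral {p..q} (\<lambda>t. of_real (\<kappa> t) * w t - of_real (\<kappa> t) * A)"
    by (rule Henstock_Kurzweil_Integration.integral_diff[OF i2 has_integral_integrable[OF i1], symmetric])
  also have "\<dots> = integral {p..q} (\<lambda>t. of_real (\<kappa> t) * (w t - A))"
    by (simp only: right_diff_distrib)
  also have "cmod \<dots> \<le> integral {p..q} (\<lambda>t. \<kappa> t * e)"
  proof (rule integral_norm_bound_integral)
    show "(\<lambda>t. of_real (\<kappa> t) * (w t - A)) integrable_on {p..q}"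
      by (intro integrable_continuous_interval continuous_intros \<kappa> w)
    show "(\<lambda>t. \<kappa> t * e) integrable_on {p..q}"
      by (intro integrable_continuous_interval continuous_intros \<kappa>)
    show "cmod (of_real (\<kappa> t) * (w t - A)) \<le> \<kappa> t * e" if "t \<in> {p..q}" for t
      using \<kappa>(3)[OF that] w(2)[OF that] by (simp add: norm_mult mult_left_mono)
  qed
  also have "\<dots> = e"
    using integral_unique[OF has_integral_mult_left[OF \<kappa>(2), of e]] by (simp only: mult_1)
  finally show ?thesis .
qed

section \<open>Integration by parts\<close>

text \<open>The real and the imaginary part of a complex test function are admissible real ones. Square
  integrability makes all the products integrable, so that the two identities can be added.\<close>

lemma weak_derivative_on_complex_test:
  fixes \<phi> :: "real \<Rightarrow> complex"
  assumes weak: "weak_derivative_on U f f1"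
    and U: "U \<in> sets lebesgue"
    and sq: "square_integrable_on U f" "square_integrable_on U f1"
    and K: "compact K" "K \<subseteq> U"
    and \<phi>: "\<And>t. (\<phi> has_vector_derivative \<phi>' t) (at t)" "continuous_on UNIV \<phi>'"
    and supp: "\<And>t. t \<notin> K \<Longrightarrow> \<phi> t = 0" "\<And>t. t \<notin> K \<Longrightarrow> \<phi>' t = 0"
  shows "integral\<^sup>L (lebesgue_on U) (\<lambda>t. \<phi>' t * f t) = - integral\<^sup>L (lebesgue_on U) (\<lambda>t. \<phi> t * f1 t)"
    and "integrable (lebesgue_on U) (\<lambda>t. \<phi>' t * f t)"
    and "integrable (lebesgue_on U) (\<lambda>t. \<phi> t * f1 t)"
proof -
  have cont: "continuous_on UNIV \<phi>"
    using \<phi>(1) by (meson continuous_at_imp_continuous_on has_vector_derivative_continuous)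
  have sqi: "square_integrable_on U c"
    if "continuous_on UNIV c" "\<And>t. t \<notin> K \<Longrightarrow> c t = 0" for c :: "real \<Rightarrow> complex"
    by (rule square_integrable_on_continuous_compact_support[OF U that(1) K(1)]) (fact that(2))
  have int: "integrable (lebesgue_on U) (\<lambda>t. \<phi>' t * f t)" "integrable (lebesgue_on U) (\<lambda>t. \<phi> t * f1 t)"
    by (intro square_integrable_on_integrable_mult sq sqi cont \<phi>(2) supp; assumption)+
  have test: "C1_test_function U (\<lambda>t. P (\<phi> t)) (\<lambda>t. P (\<phi>' t))"
    if P: "bounded_linear P" for P :: "complex \<Rightarrow> real"
    unfolding C1_test_function_def
  proof (intro conjI allI)
    show "((\<lambda>t. P (\<phi> t)) has_real_derivative P (\<phi>' t)) (at t)" for t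
      using bounded_linear.has_vector_derivative[OF P \<phi>(1)]
      by (simp add: has_real_derivative_iff_has_vector_derivative)
    show "continuous_on UNIV (\<lambda>t. P (\<phi>' t))"
      by (intro bounded_linear.continuous_on[OF P] \<phi>)
    have "P (\<phi> t) = 0" if "t \<notin> K" for t
      using supp(1)[OF that] linear_0[OF bounded_linear.linear[OF P]] by simp
    then have "{t. P (\<phi> t) \<noteq> 0} \<subseteq> K"
      by blast
    then have sub: "closure {t. P (\<phi> t) \<noteq> 0} \<subseteq> K"
      by (rule closure_minimal[OF _ compact_imp_closed[OF K(1)]])
    show "compact (closure {t. P (\<phi> t) \<noteq> 0})"
      using compact_Int_closed[OF K(1) closed_closure, of "{t. P (\<phi> t) \<noteq> 0}"] sub
      by (simp add: Int_absorb1)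
    show "closure {t. P (\<phi> t) \<noteq> 0} \<subseteq> U"
      using sub K(2) by (rule order_trans)
  qed
  have split: "integral\<^sup>L (lebesgue_on U) (\<lambda>t. c t * e t) =
      integral\<^sup>L (lebesgue_on U) (\<lambda>t. of_real (Re (c t)) * e t) + \<i> * integral\<^sup>L (lebesgue_on U) (\<lambda>t. of_real (Im (c t)) * e t)"
    if "continuous_on UNIV c" "\<And>t. t \<notin> K \<Longrightarrow> c t = 0" "square_integrable_on U e" for c e :: "real \<Rightarrow> complex"
  proof -
    have i: "integrable (lebesgue_on U) (\<lambda>t. of_real (Re (c t)) * e t)"
      "integrable (lebesgue_on U) (\<lambda>t. of_real (Im (c t)) * e t)"
      by (intro square_integrable_on_integrable_mult that sqi continuous_intros; use that in simp)+
    have "(\<lambda>t. c t * e t) = (\<lambda>t. of_real (Re (c t)) * e t + \<i> * (of_real (Im (c t)) * e t))"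
      by (auto simp: fun_eq_iff complex_eq_iff)
    then show ?thesis
      using i by simp
  qed
  have "integral\<^sup>L (lebesgue_on U) (\<lambda>t. of_real (Re (\<phi>' t)) * f t) = - integral\<^sup>L (lebesgue_on U) (\<lambda>t. of_real (Re (\<phi> t)) * f1 t)"
    "integral\<^sup>L (lebesgue_on U) (\<lambda>t. of_real (Im (\<phi>' t)) * f t) = - integral\<^sup>L (lebesgue_on U) (\<lambda>t. of_real (Im (\<phi> t)) * f1 t)"
    using weak test[OF bounded_linear_Re] test[OF bounded_linear_Im] unfolding weak_derivative_on_def by blast+
  then show "integral\<^sup>L (lebesgue_on U) (\<lambda>t. \<phi>' t * f t) = - integral\<^sup>L (lebesgue_on U) (\<lambda>t. \<phi> t * f1 t)"
    using split[OF \<phi>(2) supp(2) sq(1)] split[OF cont supp(1) sq(2)] by (simp add: algebra_simps)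
  show "integrable (lebesgue_on U) (\<lambda>t. \<phi>' t * f t)" "integrable (lebesgue_on U) (\<lambda>t. \<phi> t * f1 t)"
    by (fact int)+
qed

lemma
  fixes w :: "real \<Rightarrow> complex"
  assumes J: "{p..q} \<subseteq> I" "I \<in> sets lebesgue" and cont: "continuous_on {p..q} k" "continuous_on {p..q} w"
    and zero: "\<And>t. t \<in> I - {p..q} \<Longrightarrow> k t = 0"
  shows integrable_on_interval_support: "integrable (lebesgue_on I) (\<lambda>t. of_real (k t) * w t)"
    and integral_on_interval_support:
      "integral\<^sup>L (lebesgue_on I) (\<lambda>t. of_real (k t) * w t) = integral {p..q} (\<lambda>t. of_real (k t) * w t)"
proof -
  have c: "continuous_on {p..q} (\<lambda>t. of_real (k t) * w t)"
    by (intro continuous_intros cont)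
  have 1: "integrable (lebesgue_on {p..q}) (\<lambda>t. of_real (k t) * w t)"
    using c by (rule continuous_imp_integrable_real)
  have z: "of_real (k t) * w t = 0" if "t \<in> I - {p..q}" for t
    using zero[OF that] by simp
  have p: "{p..q} \<in> sets lebesgue" by simp
  show "integrable (lebesgue_on I) (\<lambda>t. of_real (k t) * w t)"
    using 1 integrable_lebesgue_on_subset_eq[where f = "\<lambda>t. of_real (k t) * w t", OF p J z] by blast
  have "integral\<^sup>L (lebesgue_on {p..q}) (\<lambda>t. of_real (k t) * w t) = integral {p..q} (\<lambda>t. of_real (k t) * w t)"
    by (rule lebesgue_integral_eq_integral[OF 1 p])
  then show "integral\<^sup>L (lebesgue_on I) (\<lambda>t. of_real (k t) * w t) = integral {p..q} (\<lambda>t. of_real (k t) * w t)"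
    using integral_lebesgue_on_subset_eq[where f = "\<lambda>t. of_real (k t) * w t", OF p J z] by simp
qed

text \<open>An approximate identity: nonnegative weights of total mass \<open>1\<close> whose supports move to a point
  average a function to its limit there.\<close>

lemma concentrating_averages_tendsto:
  fixes w :: "real \<Rightarrow> complex"
  assumes k: "\<And>n. continuous_on {p n..q n} (k n)" "\<And>n. n \<ge> N \<Longrightarrow> (k n has_integral 1) {p n..q n}"
      "\<And>n t. 0 \<le> k n t"
    and w: "continuous_on I w" "\<And>n. n \<ge> N \<Longrightarrow> {p n..q n} \<subseteq> I" "(w \<longlongrightarrow> A) F"
    and F: "\<And>P. eventually P F \<Longrightarrow> \<forall>\<^sub>F n in sequentially. \<forall>t\<in>{p n..q n}. P t"
  shows "(\<lambda>n. integral {p n..q n} (\<lambda>t. of_real (k n t) * w t)) \<longlonglongrightarrow> A"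
proof (rule tendstoI)
  fix e :: real assume e: "e > 0"
  have "\<forall>\<^sub>F t in F. dist (w t) A < e / 2"
    using w(3) e by (intro tendstoD) auto
  from F[OF this] show "\<forall>\<^sub>F n in sequentially. dist (integral {p n..q n} (\<lambda>t. of_real (k n t) * w t)) A < e"
    using eventually_ge_at_top[of N]
  proof eventually_elim
    case (elim n)
    have "cmod (integral {p n..q n} (\<lambda>t. of_real (k n t) * w t) - A) \<le> e / 2"
      by (rule weighted_average_near[OF k(1) k(2)[OF elim(2)] k(3) continuous_on_subset[OF w(1) w(2)[OF elim(2)]]])
        (use elim(1) in \<open>auto simp: dist_norm less_imp_le\<close>)
    then show ?case using e by (simp add: dist_norm)
  qed
qed

text \<open>Test with \<open>g\<close> cut off near the end points. The derivative of the cutoff has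
  integral \<open>\<plusminus>1\<close> and concentrates at the end points, where it reproduces the boundary values
  of \<open>g * f\<close>.\<close>

lemma weak_derivative_integration_by_parts:
  assumes weak: "weak_derivative_on {l<..<u} f f1" and lu: "l < u"
    and sq: "square_integrable_on {l<..<u} f" "square_integrable_on {l<..<u} f1"
    and f: "continuous_on {l<..<u} f"
    and g: "\<forall>t\<in>{l<..<u}. (g has_vector_derivative g1 t) (at t)" "continuous_on {l<..<u} g1"
    and int: "integrable (lebesgue_on {l<..<u}) (\<lambda>t. g t * f1 t + g1 t * f t)"
    and lim: "((\<lambda>t. g t * f t) \<longlongrightarrow> A) (at_right l)" "((\<lambda>t. g t * f t) \<longlongrightarrow> B) (at_left u)"
  shows "integral\<^sup>L (lebesgue_on {l<..<u}) (\<lambda>t. g t * f1 t + g1 t * f t) = B - A"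
proof -
  let ?I = "{l<..<u}"
  let ?G = "\<lambda>t. g t * f1 t + g1 t * f t"
  let ?w = "\<lambda>t. g t * f t"
  have I: "?I \<in> sets lebesgue" "open ?I" by simp_all
  have contg: "continuous_on ?I g"
    using g(1) by (meson continuous_at_imp_continuous_on has_vector_derivative_continuous)
  have contw: "continuous_on ?I ?w"
    by (intro continuous_intros contg f)
  define L where "L n t = real n * smooth_step' (real n * (t - l) - 1)" for n t
  define R where "R n t = real n * smooth_step' (real n * (u - t) - 1)" for n t
  \<comment> \<open>Equal to \<open>1\<close> on \<open>{l + 2 / n..u - 2 / n}\<close> and supported in \<open>{l + 1 / n..u - 1 / n}\<close> once \<open>n\<close> is large.\<close>
  define c where "c n t = smooth_step (real n * (t - l) - 1) + smooth_step (real n * (u - t) - 1) - 1" for n t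
  have dL: "((\<lambda>t. smooth_step (real n * (t - l) - 1)) has_real_derivative L n t) (at t)" for n t
    unfolding L_def
    by (rule DERIV_cong[OF DERIV_chain2[OF smooth_step_derivative]])
      (auto intro!: derivative_eq_intros)
  have dR: "((\<lambda>t. smooth_step (real n * (u - t) - 1)) has_real_derivative - R n t) (at t)" for n t
    unfolding R_def
    by (rule DERIV_cong[OF DERIV_chain2[OF smooth_step_derivative]])
      (auto intro!: derivative_eq_intros)
  have dc: "(c n has_real_derivative L n t - R n t) (at t)" for n t
    using DERIV_diff[OF DERIV_add[OF dL[of n t] dR[of n t]] DERIV_const[of 1]]
    unfolding c_def[abs_def] by simp
  have contL: "continuous_on S (L n)" and contR: "continuous_on S (R n)" for n S
    unfolding L_def[abs_def] R_def[abs_def]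
    by (intro continuous_intros continuous_on_compose2[OF smooth_step_continuous]; simp)+
  have cb: "\<bar>c n t\<bar> \<le> 1" for n t
    using smooth_step_bounds[of "real n * (t - l) - 1"] smooth_step_bounds[of "real n * (u - t) - 1"]
    unfolding c_def by linarith
  have cG: "integrable (lebesgue_on ?I) (\<lambda>t. of_real (c n t) * ?G t)" for n
  proof (rule Bochner_Integration.integrable_bound[OF int])
    have "c n \<in> borel_measurable (lebesgue_on ?I)"
      by (intro continuous_imp_measurable_on_sets_lebesgue I DERIV_continuous_on)
        (rule DERIV_subset[OF dc], simp)
    then have "(\<lambda>t. complex_of_real (c n t)) \<in> borel_measurable (lebesgue_on ?I)"
      by (rule borel_measurable_continuous_on[rotated]) (intro continuous_intros)
    then show "(\<lambda>t. of_real (c n t) * ?G t) \<in> borel_measurable (lebesgue_on ?I)"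
      using borel_measurable_integrable[OF int] by (rule borel_measurable_times)
    show "AE t in lebesgue_on ?I. norm (of_real (c n t) * ?G t) \<le> norm (?G t)"
    proof (rule AE_I2)
      fix t
      show "norm (of_real (c n t) * ?G t) \<le> norm (?G t)"
        using mult_right_mono[OF cb[of n t] norm_ge_zero[of "?G t"]] by (simp add: norm_mult)
    qed
  qed
  have limG: "(\<lambda>n. integral\<^sup>L (lebesgue_on ?I) (\<lambda>t. of_real (c n t) * ?G t)) \<longlonglongrightarrow> integral\<^sup>L (lebesgue_on ?I) ?G"
  proof (rule integral_dominated_convergence[where w = "\<lambda>t. norm (?G t)"])
    show "?G \<in> borel_measurable (lebesgue_on ?I)" "integrable (lebesgue_on ?I) (\<lambda>t. norm (?G t))"
      using int by (simp_all add: borel_measurable_integrable)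
    show "(\<lambda>t. of_real (c n t) * ?G t) \<in> borel_measurable (lebesgue_on ?I)" for n
      using cG by (rule borel_measurable_integrable)
    show "AE t in lebesgue_on ?I. norm (of_real (c n t) * ?G t) \<le> norm (?G t)" for n
    proof (rule AE_I2)
      fix t
      show "norm (of_real (c n t) * ?G t) \<le> norm (?G t)"
        using mult_right_mono[OF cb[of n t] norm_ge_zero[of "?G t"]] by (simp add: norm_mult)
    qed
    show "AE t in lebesgue_on ?I. (\<lambda>n. of_real (c n t) * ?G t) \<longlonglongrightarrow> ?G t"
    proof (rule AE_I2)
      fix t assume "t \<in> space (lebesgue_on ?I)"
      then have t: "l < t" "t < u" by simp_all
      have "\<forall>\<^sub>F n in sequentially. real n \<ge> 2 / (t - l) \<and> real n \<ge> 2 / (u - t)"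
        by (intro eventually_conj) real_asymp+
      then have "\<forall>\<^sub>F n in sequentially. of_real (c n t) * ?G t = ?G t"
      proof eventually_elim
        case (elim n)
        then have "real n * (t - l) - 1 \<ge> 1" "real n * (u - t) - 1 \<ge> 1"
          using t by (simp_all add: pos_divide_le_eq)
        then show ?case by (simp add: c_def smooth_step_simps)
      qed
      then show "(\<lambda>n. of_real (c n t) * ?G t) \<longlonglongrightarrow> ?G t"
        by (rule tendsto_eventually)
    qed
  qed
  \<comment> \<open>From here on the two transition zones of the cutoff are disjoint.\<close>
  obtain N0 :: nat where N0: "real N0 > 4 / (u - l)"
    using reals_Archimedean2 by blast
  have big: "real n > 0" "4 / real n < u - l" if "n \<ge> N0" for n
  proof -
    have "4 / (u - l) < real n" using N0 that by linarith
    moreover have "4 / (u - l) > 0" using lu by simp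
    ultimately show n: "real n > 0" by linarith
    have "4 < real n * (u - l)"
      using \<open>4 / (u - l) < real n\<close> lu by (simp add: pos_divide_less_eq)
    then show "4 / real n < u - l"
      using n by (simp add: pos_divide_less_eq mult.commute)
  qed
  have suppL: "L n t = 0" if "t \<notin> {l + 1 / real n..l + 2 / real n}" "n \<ge> N0" for n t
  proof -
    have "real n * (t - l) - 1 \<le> 0 \<or> real n * (t - l) - 1 \<ge> 1"
      using that(1) big(1)[OF that(2)] by (simp add: field_simps) linarith
    then show ?thesis by (auto simp: L_def smooth_step_simps)
  qed
  have suppR: "R n t = 0" if "t \<notin> {u - 2 / real n..u - 1 / real n}" "n \<ge> N0" for n t
  proof -
    have "real n * (u - t) - 1 \<le> 0 \<or> real n * (u - t) - 1 \<ge> 1"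
      using that(1) big(1)[OF that(2)] by (simp add: field_simps) linarith
    then show ?thesis by (auto simp: R_def smooth_step_simps)
  qed
  have suppc: "c n t = 0" if "t \<notin> {l + 1 / real n..u - 1 / real n}" "n \<ge> N0" for n t
  proof -
    have "(real n * (t - l) - 1 \<le> 0 \<and> real n * (u - t) - 1 \<ge> 1) \<or>
        (real n * (u - t) - 1 \<le> 0 \<and> real n * (t - l) - 1 \<ge> 1)"
      using that(1) big[OF that(2)] by (simp add: field_simps) linarith
    then show ?thesis by (auto simp: c_def smooth_step_simps)
  qed
  have JL: "{l + 1 / real n..l + 2 / real n} \<subseteq> ?I" and JR: "{u - 2 / real n..u - 1 / real n} \<subseteq> ?I"
    and JK: "{l + 1 / real n..u - 1 / real n} \<subseteq> ?I" if "n \<ge> N0" for n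
  proof -
    have "0 < 1 / real n" "2 / real n < u - l" "1 / real n < u - l"
      using big[OF that] by (auto simp: field_simps)
    then show "{l + 1 / real n..l + 2 / real n} \<subseteq> ?I" "{u - 2 / real n..u - 1 / real n} \<subseteq> ?I"
      "{l + 1 / real n..u - 1 / real n} \<subseteq> ?I"
      unfolding subset_iff atLeastAtMost_iff greaterThanLessThan_iff by (intro allI impI; linarith)+
  qed
  have parts: "integral\<^sup>L (lebesgue_on ?I) (\<lambda>t. of_real (c n t) * ?G t) =
      integral {u - 2 / real n..u - 1 / real n} (\<lambda>t. of_real (R n t) * ?w t)
      - integral {l + 1 / real n..l + 2 / real n} (\<lambda>t. of_real (L n t) * ?w t)" if n: "n \<ge> N0" for n
  proof -
    define \<eta> where "\<eta> t = complex_of_real (c n t)" for t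
    define \<eta>' where "\<eta>' t = complex_of_real (L n t - R n t)" for t
    let ?K = "{l + 1 / real n..u - 1 / real n}"
    have \<eta>: "(\<eta> has_vector_derivative \<eta>' t) (at t)" for t
      unfolding \<eta>_def[abs_def] \<eta>'_def by (rule has_vector_derivative_of_real[OF dc])
    have \<eta>': "continuous_on UNIV \<eta>'"
      unfolding \<eta>'_def[abs_def] by (intro continuous_intros contL contR)
    have supp: "\<forall>t. t \<notin> ?K \<longrightarrow> \<eta> t = 0"
      using suppc n by (simp add: \<eta>_def)
    note pre = I(2) compact_Icc JK[OF n] \<eta> \<eta>' supp g
    define \<phi> where "\<phi> t = (if t \<in> ?I then \<eta> t * g t else 0)" for t
    define \<phi>' where "\<phi>' t = (if t \<in> ?I then \<eta>' t * g t + \<eta> t * g1 t else 0)" for t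
    have d\<phi>: "(\<phi> has_vector_derivative \<phi>' t) (at t)" for t
      unfolding \<phi>_def[abs_def] \<phi>'_def by (rule extend_by_zero_derivative[OF pre])
    have "continuous_on UNIV (\<lambda>t. (if t \<in> ?I then \<eta>' t * g t else 0) + (if t \<in> ?I then \<eta> t * g1 t else 0))"
      by (intro continuous_on_add extend_by_zero_continuous(2)[OF pre] extend_by_zero_continuous(3)[OF pre])
    moreover have "(\<lambda>t. (if t \<in> ?I then \<eta>' t * g t else 0) + (if t \<in> ?I then \<eta> t * g1 t else 0)) = \<phi>'"
      by (auto simp: \<phi>'_def fun_eq_iff)
    ultimately have c\<phi>: "continuous_on UNIV \<phi>'" by (simp only:)
    have z: "\<phi> t = 0" "\<phi>' t = 0" if "t \<notin> ?K" for t
      using extend_by_zero_support[OF pre that] supp that unfolding \<phi>_def \<phi>'_def by simp_all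
    have test: "integral\<^sup>L (lebesgue_on ?I) (\<lambda>t. \<phi>' t * f t) = - integral\<^sup>L (lebesgue_on ?I) (\<lambda>t. \<phi> t * f1 t)"
      "integrable (lebesgue_on ?I) (\<lambda>t. \<phi>' t * f t)" "integrable (lebesgue_on ?I) (\<lambda>t. \<phi> t * f1 t)"
      by (rule weak_derivative_on_complex_test[OF weak I(1) sq compact_Icc JK[OF n] d\<phi> c\<phi>]; rule z; assumption)+
    have iL: "integrable (lebesgue_on ?I) (\<lambda>t. of_real (L n t) * ?w t)"
      and eL: "integral\<^sup>L (lebesgue_on ?I) (\<lambda>t. of_real (L n t) * ?w t) =
          integral {l + 1 / real n..l + 2 / real n} (\<lambda>t. of_real (L n t) * ?w t)"
      by (rule integrable_on_interval_support[OF JL[OF n] I(1) contL continuous_on_subset[OF contw JL[OF n]]],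
          rule suppL[OF _ n], simp,
          rule integral_on_interval_support[OF JL[OF n] I(1) contL continuous_on_subset[OF contw JL[OF n]]],
          rule suppL[OF _ n], simp)
    have iR: "integrable (lebesgue_on ?I) (\<lambda>t. of_real (R n t) * ?w t)"
      and eR: "integral\<^sup>L (lebesgue_on ?I) (\<lambda>t. of_real (R n t) * ?w t) =
          integral {u - 2 / real n..u - 1 / real n} (\<lambda>t. of_real (R n t) * ?w t)"
      by (rule integrable_on_interval_support[OF JR[OF n] I(1) contR continuous_on_subset[OF contw JR[OF n]]],
          rule suppR[OF _ n], simp,
          rule integral_on_interval_support[OF JR[OF n] I(1) contR continuous_on_subset[OF contw JR[OF n]]],
          rule suppR[OF _ n], simp)
    have "0 = integral\<^sup>L (lebesgue_on ?I) (\<lambda>t. \<phi>' t * f t + \<phi> t * f1 t)"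
      using test by simp
    also have "\<dots> = integral\<^sup>L (lebesgue_on ?I)
        (\<lambda>t. of_real (L n t) * ?w t - of_real (R n t) * ?w t + of_real (c n t) * ?G t)"
      by (rule Bochner_Integration.integral_cong)
        (simp_all add: \<phi>_def \<phi>'_def \<eta>_def \<eta>'_def algebra_simps)
    also have "\<dots> = integral\<^sup>L (lebesgue_on ?I) (\<lambda>t. of_real (L n t) * ?w t)
        - integral\<^sup>L (lebesgue_on ?I) (\<lambda>t. of_real (R n t) * ?w t)
        + integral\<^sup>L (lebesgue_on ?I) (\<lambda>t. of_real (c n t) * ?G t)"
      by (subst Bochner_Integration.integral_add[OF Bochner_Integration.integrable_diff[OF iL iR] cG],
          subst Bochner_Integration.integral_diff[OF iL iR]) (rule refl)
    finally show ?thesis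
      unfolding eL eR by (simp add: algebra_simps)
  qed
  have nn: "0 \<le> L n t" "0 \<le> R n t" for n t
    unfolding L_def R_def by (intro mult_nonneg_nonneg smooth_step_bounds; simp)+
  have half: "l + 1 / real n \<le> l + 2 / real n" "u - 2 / real n \<le> u - 1 / real n" for n
    by (simp_all add: divide_right_mono)
  have inf: "(\<lambda>n. 2 / real n) \<longlonglongrightarrow> 0"
    by real_asymp
  have limL: "(\<lambda>n. integral {l + 1 / real n..l + 2 / real n} (\<lambda>t. of_real (L n t) * ?w t)) \<longlonglongrightarrow> A"
  proof (rule concentrating_averages_tendsto[OF contL _ nn(1) contw JL lim(1)])
    show "(L n has_integral 1) {l + 1 / real n..l + 2 / real n}" if n: "n \<ge> N0" for n
    proof -
      have "(L n has_integral (smooth_step (real n * (l + 2 / real n - l) - 1) - smooth_step (real n * (l + 1 / real n - l) - 1)))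
          {l + 1 / real n..l + 2 / real n}"
        using dL by (intro fundamental_theorem_of_calculus half)
          (simp add: has_real_derivative_iff_has_vector_derivative has_vector_derivative_at_within)
      then show ?thesis
        using big(1)[OF n] by (simp add: smooth_step_simps)
    qed
    fix P assume "eventually P (at_right l)"
    then obtain b where b: "b > l" "\<And>t. l < t \<Longrightarrow> t < b \<Longrightarrow> P t"
      unfolding eventually_at_right_field by blast
    have "\<forall>\<^sub>F n in sequentially. 2 / real n < b - l"
      using inf b(1) by (intro order_tendstoD(2)) auto
    then show "\<forall>\<^sub>F n in sequentially. \<forall>t\<in>{l + 1 / real n..l + 2 / real n}. P t"
      using eventually_ge_at_top[of N0]
    proof eventually_elim
      case (elim n)
      show ?case
      proof
        fix t assume t: "t \<in> {l + 1 / real n..l + 2 / real n}"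
        then have "l < t" using JL[OF elim(2)] by auto
        moreover have "t < b" using t elim(1) by simp
        ultimately show "P t" by (rule b(2))
      qed
    qed
  qed
  have limR: "(\<lambda>n. integral {u - 2 / real n..u - 1 / real n} (\<lambda>t. of_real (R n t) * ?w t)) \<longlonglongrightarrow> B"
  proof (rule concentrating_averages_tendsto[OF contR _ nn(2) contw JR lim(2)])
    show "(R n has_integral 1) {u - 2 / real n..u - 1 / real n}" if n: "n \<ge> N0" for n
    proof -
      have "(R n has_integral (- smooth_step (real n * (u - (u - 1 / real n)) - 1) - (- smooth_step (real n * (u - (u - 2 / real n)) - 1))))
          {u - 2 / real n..u - 1 / real n}"
        using DERIV_minus[OF dR] by (intro fundamental_theorem_of_calculus half)
          (simp add: has_real_derivative_iff_has_vector_derivative has_vector_derivative_at_within)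
      then show ?thesis
        using big(1)[OF n] by (simp add: smooth_step_simps)
    qed
    fix P assume "eventually P (at_left u)"
    then obtain b where b: "b < u" "\<And>t. b < t \<Longrightarrow> t < u \<Longrightarrow> P t"
      unfolding eventually_at_left_field by blast
    have "\<forall>\<^sub>F n in sequentially. 2 / real n < u - b"
      using inf b(1) by (intro order_tendstoD(2)) auto
    then show "\<forall>\<^sub>F n in sequentially. \<forall>t\<in>{u - 2 / real n..u - 1 / real n}. P t"
      using eventually_ge_at_top[of N0]
    proof eventually_elim
      case (elim n)
      show ?case
      proof
        fix t assume t: "t \<in> {u - 2 / real n..u - 1 / real n}"
        then have "t < u" using JR[OF elim(2)] by auto
        moreover have "b < t" using t elim(1) by simp
        ultimately show "P t" by (intro b(2))
      qed
    qed
  qed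
  have "(\<lambda>n. integral\<^sup>L (lebesgue_on ?I) (\<lambda>t. of_real (c n t) * ?G t)) \<longlonglongrightarrow> B - A"
  proof (rule Lim_transform_eventually[OF tendsto_diff[OF limR limL]])
    show "\<forall>\<^sub>F n in sequentially. integral {u - 2 / real n..u - 1 / real n} (\<lambda>t. of_real (R n t) * ?w t)
        - integral {l + 1 / real n..l + 2 / real n} (\<lambda>t. of_real (L n t) * ?w t)
        = integral\<^sup>L (lebesgue_on ?I) (\<lambda>t. of_real (c n t) * ?G t)"
      unfolding eventually_sequentially by (intro exI allI impI) (rule parts[symmetric])
  qed
  then show ?thesis
    by (rule LIMSEQ_unique[OF limG])
qed

text \<open>Integration by parts against the constant \<open>1\<close> on \<open>{a..s}\<close> exhibits \<open>f\<close> as an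
  indefinite integral of the continuous function \<open>f1\<close>.\<close>

lemma weak_derivative_imp_derivative:
  assumes U: "open U" and weak: "weak_derivative_on U f f1"
    and sq: "square_integrable_on U f" "square_integrable_on U f1"
    and cont: "continuous_on U f" "continuous_on U f1" and t: "t \<in> U"
  shows "(f has_vector_derivative f1 t) (at t)"
proof -
  obtain e where e: "e > 0" "cball t e \<subseteq> U"
    using U t open_contains_cball by blast
  define a b where "a = t - e" and "b = t + e"
  have ab: "{a..b} \<subseteq> U" "a < t" "t < b"
    using e by (auto simp: a_def b_def cball_eq_atLeastAtMost)
  have eq: "f s = f a + integral {a..s} f1" if s: "s \<in> {a..b}" for s
  proof (cases "s = a")
    case False
    then have as: "a < s" using s by simp
    have sub: "{a..s} \<subseteq> U" "{a<..<s} \<subseteq> U" using ab s by auto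
    have sets: "{a<..<s} \<in> sets lebesgue" "{a..s} \<in> sets lebesgue" "U \<in> sets lebesgue"
      using U by auto
    have "integrable (lebesgue_on {a..s}) f1"
      by (intro continuous_imp_integrable_real continuous_on_subset[OF cont(2)] sub)
    then have i: "integrable (lebesgue_on {a<..<s}) f1"
      by (rule integrable_lebesgue_on_mono[OF _ _ sets(1,2)]) auto
    have c: "continuous_on {a..s} f"
      using cont(1) sub(1) by (rule continuous_on_subset)
    have "integral\<^sup>L (lebesgue_on {a<..<s}) (\<lambda>t. 1 * f1 t + 0 * f t) = f s - f a"
    proof (rule weak_derivative_integration_by_parts)
      show "weak_derivative_on {a<..<s} f f1"
        using weak U sub by (intro weak_derivative_on_subset[OF weak U]) auto
      show "square_integrable_on {a<..<s} f" "square_integrable_on {a<..<s} f1"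
        by (rule square_integrable_on_mono[OF _ sub(2) sets(1) sets(3)], rule sq)+
      show "continuous_on {a<..<s} f"
        using cont(1) sub(2) by (rule continuous_on_subset)
      show "((\<lambda>t. 1 * f t) \<longlongrightarrow> f a) (at_right a)" "((\<lambda>t. 1 * f t) \<longlongrightarrow> f s) (at_left s)"
        using c as by (simp_all add: continuous_on_Icc_at_rightD continuous_on_Icc_at_leftD)
    qed (use as i in \<open>auto intro: continuous_intros\<close>)
    then have "integral\<^sup>L (lebesgue_on {a<..<s}) f1 = f s - f a" by simp
    then have "integral {a<..<s} f1 = f s - f a"
      using lebesgue_integral_eq_integral[OF i sets(1)] by simp
    then show ?thesis
      by (simp add: integral_open_interval_real)
  qed simp
  have "((\<lambda>s. integral {a..s} f1) has_vector_derivative f1 t) (at t within {a..b})"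
    using ab by (intro integral_has_vector_derivative continuous_on_subset[OF cont(2)]) auto
  then have "((\<lambda>s. integral {a..s} f1) has_vector_derivative f1 t) (at t)"
    using ab by (simp add: at_within_Icc_at)
  then have "((\<lambda>s. f a + integral {a..s} f1) has_vector_derivative 0 + f1 t) (at t)"
    by (intro has_vector_derivative_add has_vector_derivative_const)
  then have "((\<lambda>s. f a + integral {a..s} f1) has_vector_derivative f1 t) (at t)"
    by simp
  then show ?thesis
  proof (rule has_vector_derivative_transform_within_open[where S = "{a<..<b}"])
    show "f a + integral {a..s} f1 = f s" if "s \<in> {a<..<b}" for s
      using that by (intro eq[symmetric]) simp
  qed (use ab in auto)
qed

lemma W22_on_derivatives:
  assumes "W22_on U f f1 f2" "open U" "t \<in> U"
  shows "(f has_vector_derivative f1 t) (at t)"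
  using assms unfolding W22_on_def by (intro weak_derivative_imp_derivative) auto

lemma W22_on_cnj:
  assumes "W22_on U f f1 f2"
  shows "W22_on U (\<lambda>t. cnj (f t)) (\<lambda>t. cnj (f1 t)) (\<lambda>t. cnj (f2 t))"
  using assms unfolding W22_on_def
  by (simp add: square_integrable_on_cnj weak_derivative_on_cnj continuous_on_cnj)

text \<open>Lagrange's identity: the boundary form is the Wronskian of \<open>f\<close> and \<open>g\<close>. Its two products
  are given separate limits because at the origin only the products, not the factors, are known
  to converge.\<close>

lemma Lagrange_identity:
  assumes lu: "l < u" and f: "W22_on {l<..<u} f f1 f2" and g: "W22_on {l<..<u} g g1 g2"
    and l: "((\<lambda>t. g t * f1 t) \<longlongrightarrow> A) (at_right l)" "((\<lambda>t. f t * g1 t) \<longlongrightarrow> A') (at_right l)"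
    and u: "((\<lambda>t. g t * f1 t) \<longlongrightarrow> B) (at_left u)" "((\<lambda>t. f t * g1 t) \<longlongrightarrow> B') (at_left u)"
  shows "integral\<^sup>L (lebesgue_on {l<..<u}) (\<lambda>t. g t * f2 t - f t * g2 t) = (B - B') - (A - A')"
proof -
  let ?M = "lebesgue_on {l<..<u}"
  have W: "square_integrable_on {l<..<u} f" "square_integrable_on {l<..<u} f1" "square_integrable_on {l<..<u} f2"
    "square_integrable_on {l<..<u} g" "square_integrable_on {l<..<u} g1" "square_integrable_on {l<..<u} g2"
    "weak_derivative_on {l<..<u} f1 f2" "weak_derivative_on {l<..<u} g1 g2"
    "continuous_on {l<..<u} f1" "continuous_on {l<..<u} g1"
    using f g by (simp_all add: W22_on_def)
  have i: "integrable ?M (\<lambda>t. g t * f2 t)" "integrable ?M (\<lambda>t. g1 t * f1 t)"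
    "integrable ?M (\<lambda>t. f t * g2 t)" "integrable ?M (\<lambda>t. f1 t * g1 t)"
    by (rule square_integrable_on_integrable_mult; rule W)+
  have d: "\<forall>t\<in>{l<..<u}. (f has_vector_derivative f1 t) (at t)"
    "\<forall>t\<in>{l<..<u}. (g has_vector_derivative g1 t) (at t)"
    using W22_on_derivatives[OF f] W22_on_derivatives[OF g] by auto
  have "integral\<^sup>L ?M (\<lambda>t. g t * f2 t + g1 t * f1 t) = B - A"
    by (rule weak_derivative_integration_by_parts[OF W(7) lu W(2,3,9) d(2) W(10) _ l(1) u(1)])
      (rule Bochner_Integration.integrable_add[OF i(1,2)])
  moreover have "integral\<^sup>L ?M (\<lambda>t. f t * g2 t + f1 t * g1 t) = B' - A'"
    by (rule weak_derivative_integration_by_parts[OF W(8) lu W(5,6,10) d(1) W(9) _ l(2) u(2)])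
      (rule Bochner_Integration.integrable_add[OF i(3,4)])
  moreover have "integral\<^sup>L ?M (\<lambda>t. g1 t * f1 t) = integral\<^sup>L ?M (\<lambda>t. f1 t * g1 t)"
    by (simp add: mult.commute)
  ultimately have "integral\<^sup>L ?M (\<lambda>t. g t * f2 t) = B - A - integral\<^sup>L ?M (\<lambda>t. f1 t * g1 t)"
    "integral\<^sup>L ?M (\<lambda>t. f t * g2 t) = B' - A' - integral\<^sup>L ?M (\<lambda>t. f1 t * g1 t)"
    unfolding Bochner_Integration.integral_add[OF i(1,2)] Bochner_Integration.integral_add[OF i(3,4)]
    by (simp_all only: eq_diff_eq)
  then show ?thesis
    unfolding Bochner_Integration.integral_diff[OF i(1,3)] by simp
qed

section \<open>The punctured half-line\<close>

locale interaction_points =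
  fixes x :: "nat \<Rightarrow> real"
  assumes x_0: "x 0 = 0" and x_mono: "strict_mono x" and x_lim: "filterlim x at_top sequentially"
begin

definition U :: "real set" where "U = {0<..} - range x"

text \<open>For \<open>t \<ge> 0\<close> the index of the interval \<open>{x n..<x (Suc n)}\<close> that contains \<open>t\<close>.\<close>

definition piece :: "real \<Rightarrow> nat" where "piece t = (LEAST n. t < x (Suc n))"

lemma x_nonneg: "0 \<le> x n"
  using x_0 strict_mono_less_eq[OF x_mono, of 0 n] by simp

lemma x_less: "x n < x (Suc n)"
  using x_mono by (simp add: strict_mono_Suc_iff)

lemma piece_bounds:
  assumes "0 \<le> t"
  shows "x (piece t) \<le> t" "t < x (Suc (piece t))"
proof -
  have "\<forall>\<^sub>F n in sequentially. t < x n"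
    using x_lim by (simp add: filterlim_at_top_dense)
  then obtain N where "\<And>n. n \<ge> N \<Longrightarrow> t < x n"
    by (auto simp: eventually_sequentially)
  then have ex: "t < x (Suc N)" by simp
  then show "t < x (Suc (piece t))"
    unfolding piece_def by (rule LeastI)
  show "x (piece t) \<le> t"
  proof (cases "piece t")
    case 0
    then show ?thesis using assms x_0 by simp
  next
    case (Suc k)
    then have "\<not> t < x (Suc k)"
      using not_less_Least[of k "\<lambda>n. t < x (Suc n)"] by (simp add: piece_def)
    then show ?thesis using Suc by simp
  qed
qed

lemma piece_eqI:
  assumes "x n \<le> t" "t < x (Suc n)"
  shows "piece t = n"
proof -
  have "0 \<le> t" using x_nonneg[of n] assms by linarith
  note b = piece_bounds[OF this]
  have "x n < x (Suc (piece t))" "x (piece t) < x (Suc n)"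
    using assms b by linarith+
  then have "n < Suc (piece t)" "piece t < Suc n"
    using strict_mono_less[OF x_mono] by auto
  then show ?thesis by simp
qed

lemma U_eq: "U = (\<Union>n. {x n<..<x (Suc n)})"
proof
  show "U \<subseteq> (\<Union>n. {x n<..<x (Suc n)})"
  proof
    fix t assume t: "t \<in> U"
    then have "0 \<le> t" "t \<noteq> x (piece t)" by (auto simp: U_def)
    then have "x (piece t) < t" "t < x (Suc (piece t))"
      using piece_bounds[of t] by auto
    then show "t \<in> (\<Union>n. {x n<..<x (Suc n)})" by auto
  qed
  show "(\<Union>n. {x n<..<x (Suc n)}) \<subseteq> U"
  proof
    fix t assume "t \<in> (\<Union>n. {x n<..<x (Suc n)})"
    then obtain n where n: "x n < t" "t < x (Suc n)" by auto
    have "t \<noteq> x k" for k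
    proof
      assume "t = x k"
      then have "n < k" "k < Suc n"
        using n strict_mono_less[OF x_mono] by auto
      then show False by simp
    qed
    then show "t \<in> U"
      using n x_nonneg[of n] by (auto simp: U_def)
  qed
qed

lemma interval_subset_U: "{x n<..<x (Suc n)} \<subseteq> U"
  by (auto simp: U_eq)

lemma open_U: "open U"
  unfolding U_eq by auto

lemma U_sets: "U \<in> sets lebesgue"
  using open_U by simp

lemma U_subset: "U \<subseteq> {0<..}"
  by (auto simp: U_def)

lemma square_integrable_on_U: "square_integrable_on U f \<longleftrightarrow> square_integrable_on {0<..} f"
  unfolding U_def by (rule square_integrable_on_diff_countable) simp_all

lemma integral_U:
  fixes f :: "real \<Rightarrow> 'b::euclidean_space"
  shows "integral\<^sup>L (lebesgue_on U) f = integral\<^sup>L (lebesgue_on {0<..}) f"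
  unfolding U_def by (rule integral_lebesgue_on_diff_countable) simp_all

lemma AE_in_U: "AE t in lebesgue_on {0<..}. t \<in> U"
proof -
  have "range x \<in> null_sets lebesgue"
    by (rule null_sets_completionI, rule countable_imp_null_set_lborel) simp
  then have "AE t in lebesgue. t \<notin> range x"
    by (rule AE_not_in)
  then have "AE t in lebesgue. t \<in> {0<..} \<longrightarrow> t \<in> U"
    by eventually_elim (auto simp: U_def)
  then show ?thesis
    by (subst AE_restrict_space_iff) simp_all
qed

end

section \<open>Density of the compactly supported functions\<close>

definition C2_compact_support ::
  "real set \<Rightarrow> (real \<Rightarrow> complex) \<Rightarrow> (real \<Rightarrow> complex) \<Rightarrow> (real \<Rightarrow> complex) \<Rightarrow> bool" where
  "C2_compact_support S h h1 h2 \<longleftrightarrow>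
     (\<forall>t. (h has_vector_derivative h1 t) (at t)) \<and> (\<forall>t. (h1 has_vector_derivative h2 t) (at t)) \<and>
     continuous_on UNIV h2 \<and> (\<exists>K. compact K \<and> K \<subseteq> S \<and> (\<forall>t. t \<notin> K \<longrightarrow> h t = 0))"

lemma derivative_eq_0_off_closed:
  assumes "closed K" "\<And>t. t \<notin> K \<Longrightarrow> h t = 0" "(h has_vector_derivative h1) (at t)" "t \<notin> K"
  shows "h1 = (0 :: 'b::real_normed_vector)"
proof -
  have "(h has_vector_derivative 0) (at t)"
  proof (rule has_vector_derivative_transform_within_open[where f = "\<lambda>t. 0" and S = "- K"])
    show "open (- K)" using assms(1) by (simp add: open_Compl)
    show "0 = h s" if "s \<in> - K" for s using assms(2)[of s] that by simp
  qed (use assms(4) in simp_all)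
  then show ?thesis
    using assms(3) vector_derivative_unique_at by blast
qed

lemma C2_compact_support_zero:
  assumes "C2_compact_support S h h1 h2"
  obtains K where "compact K" "K \<subseteq> S" "\<And>t. t \<notin> K \<Longrightarrow> h t = 0 \<and> h1 t = 0 \<and> h2 t = 0"
proof -
  from assms obtain K where K: "compact K" "K \<subseteq> S" "\<And>t. t \<notin> K \<Longrightarrow> h t = 0"
    and d: "\<And>t. (h has_vector_derivative h1 t) (at t)" "\<And>t. (h1 has_vector_derivative h2 t) (at t)"
    unfolding C2_compact_support_def by blast
  note c = compact_imp_closed[OF K(1)]
  have 1: "h1 t = 0" if "t \<notin> K" for t
    by (rule derivative_eq_0_off_closed[OF c K(3) d(1) that])
  have "h2 t = 0" if "t \<notin> K" for t
    by (rule derivative_eq_0_off_closed[OF c 1 d(2) that])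
  with 1 K that show thesis by blast
qed

lemma C2_compact_support_linear:
  assumes g: "C2_compact_support S g g1 g2" and h: "C2_compact_support S h h1 h2"
  shows "C2_compact_support S (\<lambda>t. g t - c * h t) (\<lambda>t. g1 t - c * h1 t) (\<lambda>t. g2 t - c * h2 t)"
proof -
  obtain K where K: "compact K" "K \<subseteq> S" "\<And>t. t \<notin> K \<Longrightarrow> g t = 0 \<and> g1 t = 0 \<and> g2 t = 0"
    using C2_compact_support_zero[OF g] by metis
  obtain L where L: "compact L" "L \<subseteq> S" "\<And>t. t \<notin> L \<Longrightarrow> h t = 0 \<and> h1 t = 0 \<and> h2 t = 0"
    using C2_compact_support_zero[OF h] by metis
  have d: "\<And>t. (g has_vector_derivative g1 t) (at t)" "\<And>t. (g1 has_vector_derivative g2 t) (at t)" "continuous_on UNIV g2"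
    "\<And>t. (h has_vector_derivative h1 t) (at t)" "\<And>t. (h1 has_vector_derivative h2 t) (at t)" "continuous_on UNIV h2"
    using g h by (simp_all add: C2_compact_support_def)
  show ?thesis
    unfolding C2_compact_support_def
  proof (intro conjI allI)
    show "((\<lambda>t. g t - c * h t) has_vector_derivative g1 t - c * h1 t) (at t)"
      "((\<lambda>t. g1 t - c * h1 t) has_vector_derivative g2 t - c * h2 t) (at t)" for t
      by (intro has_vector_derivative_diff has_vector_derivative_mult_right d)+
    show "continuous_on UNIV (\<lambda>t. g2 t - c * h2 t)"
      by (intro continuous_intros d)
    show "\<exists>K. compact K \<and> K \<subseteq> S \<and> (\<forall>t. t \<notin> K \<longrightarrow> g t - c * h t = 0)"
      using K L by (intro exI[of _ "K \<union> L"]) (auto intro: compact_Un)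
  qed
qed

lemma C2_compact_support_cnj:
  assumes h: "C2_compact_support S h h1 h2"
  shows "C2_compact_support S (\<lambda>t. cnj (h t)) (\<lambda>t. cnj (h1 t)) (\<lambda>t. cnj (h2 t))"
  using assms unfolding C2_compact_support_def
  by (simp add: has_vector_derivative_cnj continuous_on_cnj)

text \<open>The cubes make the function twice continuously differentiable.\<close>

definition bump :: "real \<Rightarrow> real \<Rightarrow> real \<Rightarrow> real" where
  "bump p q t = (max 0 (t - p)) ^ 3 * (max 0 (q - t)) ^ 3"

lemma bump_C2:
  obtains b1 b2 where "\<And>t. (bump p q has_real_derivative b1 t) (at t)"
    "\<And>t. (b1 has_real_derivative b2 t) (at t)" "continuous_on UNIV b2"
proof -
  define m where "m k s = (max 0 s :: real) ^ k" for k s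
  have dm: "(m (Suc (Suc k)) has_real_derivative real (k + 2) * m (Suc k) s) (at s)" for k s
    unfolding m_def[abs_def] by (rule max_power_has_real_derivative)
  have L: "((\<lambda>t. m (Suc (Suc k)) (t - p)) has_real_derivative real (k + 2) * m (Suc k) (t - p)) (at t)" for k t
    by (rule DERIV_cong[OF DERIV_chain2[OF dm]]) (auto intro!: derivative_eq_intros)
  have R: "((\<lambda>t. m (Suc (Suc k)) (q - t)) has_real_derivative - (real (k + 2) * m (Suc k) (q - t))) (at t)" for k t
    by (rule DERIV_cong[OF DERIV_chain2[OF dm]]) (auto intro!: derivative_eq_intros)
  have L3: "((\<lambda>t. m 3 (t - p)) has_real_derivative 3 * m 2 (t - p)) (at t)"
    and L2: "((\<lambda>t. m 2 (t - p)) has_real_derivative 2 * m 1 (t - p)) (at t)"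
    and R3: "((\<lambda>t. m 3 (q - t)) has_real_derivative - (3 * m 2 (q - t))) (at t)"
    and R2: "((\<lambda>t. m 2 (q - t)) has_real_derivative - (2 * m 1 (q - t))) (at t)" for t
    using L[of 1 t] L[of 0 t] R[of 1 t] R[of 0 t] by (simp_all add: numeral_2_eq_2 numeral_3_eq_3)
  define b1 where "b1 t = 3 * m 2 (t - p) * m 3 (q - t) - 3 * m 3 (t - p) * m 2 (q - t)" for t
  define b2 where "b2 t = 6 * m 1 (t - p) * m 3 (q - t) - 18 * m 2 (t - p) * m 2 (q - t) + 6 * m 3 (t - p) * m 1 (q - t)" for t
  have "(bump p q has_real_derivative b1 t) (at t)" for t
  proof -
    have "((\<lambda>t. m 3 (t - p) * m 3 (q - t)) has_real_derivative b1 t) (at t)"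
      by (rule DERIV_cong[OF DERIV_mult[OF L3 R3]]) (simp add: b1_def algebra_simps)
    then show ?thesis by (simp add: bump_def[abs_def] m_def)
  qed
  moreover have "(b1 has_real_derivative b2 t) (at t)" for t
    unfolding b1_def[abs_def]
    by (rule DERIV_cong[OF DERIV_diff[OF DERIV_mult[OF DERIV_cmult[OF L2] R3]
          DERIV_mult[OF DERIV_cmult[OF L3] R2]]])
      (simp add: b2_def algebra_simps)
  moreover have "continuous_on UNIV b2"
    unfolding b2_def[abs_def] m_def by (intro continuous_intros)
  ultimately show thesis by (rule that)
qed

lemma bump_nonneg: "0 \<le> bump p q t"
  by (simp add: bump_def)

lemma bump_eq_0: "t \<notin> {p..q} \<Longrightarrow> bump p q t = 0"
  by (auto simp: bump_def)

lemma bump_pos: "p < t \<Longrightarrow> t < q \<Longrightarrow> 0 < bump p q t"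
  by (simp add: bump_def)

context interaction_points
begin

text \<open>The margins \<open>1 / m\<close> keep the support compact in \<open>U\<close>; they shrink and more intervals are
  included as \<open>m\<close> grows, so that the sets where the cutoff is at least \<open>1 / m\<close> exhaust \<open>U\<close>.\<close>

definition cutoff :: "nat \<Rightarrow> real \<Rightarrow> real" where
  "cutoff m t = (\<Sum>n<m. bump (x n + 1 / real m) (x (Suc n) - 1 / real m) t)"

lemma cutoff_nonneg: "0 \<le> cutoff m t"
  unfolding cutoff_def by (intro sum_nonneg bump_nonneg)

lemma cutoff_support:
  assumes "m > 0"
  obtains K where "compact K" "K \<subseteq> U" "K \<subseteq> {0..x m}" "\<And>t. t \<notin> K \<Longrightarrow> cutoff m t = 0"
proof -
  let ?K = "\<Union>n\<in>{..<m}. {x n + 1 / real m..x (Suc n) - 1 / real m}"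
  show thesis
  proof
    show "compact ?K" by (intro compact_UN) auto
    have pos: "0 < 1 / real m" using assms by simp
    have sub: "{x n + 1 / real m..x (Suc n) - 1 / real m} \<subseteq> {x n<..<x (Suc n)}" for n
    proof
      fix t assume "t \<in> {x n + 1 / real m..x (Suc n) - 1 / real m}"
      then have "x n + 1 / real m \<le> t" "t \<le> x (Suc n) - 1 / real m" by simp_all
      then show "t \<in> {x n<..<x (Suc n)}"
        unfolding greaterThanLessThan_iff using pos by linarith
    qed
    then show "?K \<subseteq> U"
      unfolding U_eq by blast
    have "{x n<..<x (Suc n)} \<subseteq> {0..x m}" if "n < m" for n
    proof
      fix t assume "t \<in> {x n<..<x (Suc n)}"
      moreover have "x (Suc n) \<le> x m"
        using that strict_mono_less_eq[OF x_mono] by simp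
      ultimately show "t \<in> {0..x m}" using x_nonneg[of n] by simp
    qed
    then show "?K \<subseteq> {0..x m}"
      using sub by (meson UN_least lessThan_iff order_trans)
    show "cutoff m t = 0" if "t \<notin> ?K" for t
      unfolding cutoff_def by (intro sum.neutral ballI bump_eq_0) (use that in blast)
  qed
qed

lemma cutoff_eventually_pos:
  assumes "t \<in> U"
  shows "\<forall>\<^sub>F m in sequentially. 1 / real (Suc m) \<le> cutoff (Suc m) t"
proof -
  obtain k where k: "x k < t" "t < x (Suc k)"
    using assms unfolding U_eq by auto
  define e where "e = min (t - x k) (x (Suc k) - t) / 2"
  have e: "e > 0" "x k + e < t" "t < x (Suc k) - e"
    using k by (auto simp: e_def min_def field_simps)
  define v where "v = bump (x k + e) (x (Suc k) - e) t"
  have v: "v > 0" unfolding v_def by (rule bump_pos) (rule e)+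
  obtain N :: nat where N: "real N > max (1 / e) (1 / v)"
    using reals_Archimedean2 by blast
  show ?thesis
    unfolding eventually_sequentially
  proof (intro exI allI impI)
    fix m assume m: "max N k \<le> m"
    have big: "real (Suc m) > 1 / e" "real (Suc m) > 1 / v" using N m by auto
    then have me: "1 / real (Suc m) < e" "1 / real (Suc m) < v"
      using e v by (simp_all add: pos_divide_less_eq mult.commute)
    have "v \<le> bump (x k + 1 / real (Suc m)) (x (Suc k) - 1 / real (Suc m)) t"
      unfolding v_def bump_def using me(1)
      by (intro mult_mono power_mono max.mono diff_mono zero_le_power) auto
    also have "\<dots> \<le> cutoff (Suc m) t"
      unfolding cutoff_def using m
      by (intro member_le_sum bump_nonneg) auto
    finally show "1 / real (Suc m) \<le> cutoff (Suc m) t" using me(2) by linarith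
  qed
qed

lemma cutoff_polynomial_C2:
  assumes m: "m > 0" and p: "polynomial_function (p :: real \<Rightarrow> complex)"
  shows "\<exists>h1 h2. C2_compact_support U (\<lambda>t. of_real (cutoff m t) * p t) h1 h2"
proof -
  have "\<forall>n. \<exists>b1 b2. (\<forall>t. (bump (x n + 1 / real m) (x (Suc n) - 1 / real m) has_real_derivative b1 t) (at t)) \<and>
      (\<forall>t. (b1 has_real_derivative b2 t) (at t)) \<and> continuous_on UNIV b2"
    by (meson bump_C2)
  then obtain b1 b2 where b: "\<And>n t. (bump (x n + 1 / real m) (x (Suc n) - 1 / real m) has_real_derivative b1 n t) (at t)"
    "\<And>n t. (b1 n has_real_derivative b2 n t) (at t)" "\<And>n. continuous_on UNIV (b2 n)"
    by metis
  define c1 where "c1 t = (\<Sum>n<m. b1 n t)" for t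
  define c2 where "c2 t = (\<Sum>n<m. b2 n t)" for t
  have d1: "(cutoff m has_real_derivative c1 t) (at t)" for t
    unfolding cutoff_def[abs_def] c1_def by (intro DERIV_sum b)
  have d2: "(c1 has_real_derivative c2 t) (at t)" for t
    unfolding c1_def[abs_def] c2_def by (intro DERIV_sum b)
  have c2: "continuous_on UNIV c2"
    unfolding c2_def[abs_def] by (intro continuous_on_sum b)
  have c1: "continuous_on UNIV c1" and c0: "continuous_on UNIV (cutoff m)"
    by (rule DERIV_continuous_on, rule d2, rule DERIV_continuous_on, rule d1)
  obtain p1 where p1: "polynomial_function p1" "\<And>t. (p has_vector_derivative p1 t) (at t)"
    using has_vector_derivative_polynomial_function[OF p] by blast
  obtain p2 where p2: "polynomial_function p2" "\<And>t. (p1 has_vector_derivative p2 t) (at t)"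
    using has_vector_derivative_polynomial_function[OF p1(1)] by blast
  note cd = has_vector_derivative_of_real[OF d1] has_vector_derivative_of_real[OF d2]
  define h1 where "h1 t = of_real (cutoff m t) * p1 t + of_real (c1 t) * p t" for t
  define h2 where "h2 t = (of_real (cutoff m t) * p2 t + of_real (c1 t) * p1 t) + (of_real (c1 t) * p1 t + of_real (c2 t) * p t)" for t
  have "((\<lambda>t. of_real (cutoff m t) * p t) has_vector_derivative h1 t) (at t)" for t
    unfolding h1_def by (intro has_vector_derivative_mult cd p1)
  moreover have "(h1 has_vector_derivative h2 t) (at t)" for t
    unfolding h1_def[abs_def] h2_def
    by (intro has_vector_derivative_add has_vector_derivative_mult cd p1 p2)
  moreover have "continuous_on UNIV h2"
    unfolding h2_def[abs_def]
    by (intro continuous_intros c0 c1 c2 continuous_on_polymonial_function p p1 p2)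
  moreover obtain K where "compact K" "K \<subseteq> U" "\<And>t. t \<notin> K \<Longrightarrow> cutoff m t = 0"
    using cutoff_support[OF m] by metis
  ultimately show ?thesis
    unfolding C2_compact_support_def by (intro exI[of _ h1] exI[of _ h2]) auto
qed

lemma continuous_on_cutoff: "continuous_on S (cutoff m)"
  unfolding cutoff_def[abs_def] bump_def by (intro continuous_intros)

text \<open>On the set where the cutoff is bounded below, a bounded function divided by the cutoff
  is still bounded, so it is a bounded almost-everywhere limit of continuous functions and hence of
  polynomials; multiplying back by the cutoff gives smooth compactly supported approximants.\<close>

lemma cutoff_multiple_in_closure:
  assumes m: "m > 0" and H: "H \<in> borel_measurable (lebesgue_on {0<..})" "\<And>t. cmod (H t) \<le> B"
  shows "abs_l2_halfline (\<lambda>t. of_real (cutoff m t) * H t) \<in>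
    closure (abs_l2_halfline ` {h. \<exists>h1 h2. C2_compact_support U h h1 h2})"
proof -
  let ?M = "lebesgue_on {0<..} :: real measure"
  have B: "0 \<le> B" using H(2)[of 0] norm_ge_zero order_trans by blast
  have "H measurable_on {0<..}"
    using H(1) by (subst measurable_on_iff_borel_measurable) simp_all
  then obtain N g where N: "negligible N" and g: "\<And>n. continuous_on UNIV (g n)"
    "\<And>t. t \<notin> N \<Longrightarrow> (\<lambda>n. g n t) \<longlonglongrightarrow> (if t \<in> {0<..} then H t else 0)"
    unfolding measurable_on_def by blast
  let ?c = "closest_point (cball (0 :: complex) B)"
  have cc: "continuous_on S ?c" for S
    by (rule continuous_on_closest_point) (use B in auto)
  have cb: "cmod (?c z) \<le> B" for z
    using closest_point_in_set[of "cball (0 :: complex) B" z] B by simp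
  have cs: "?c z = z" if "cmod z \<le> B" for z
    using that by (intro closest_point_self) simp
  have "\<exists>p. polynomial_function p \<and> (\<forall>t\<in>{0..x m}. norm (?c (g n t) - p t) < 1 / real (Suc n))" for n
  proof (rule Stone_Weierstrass_polynomial_function)
    show "continuous_on {0..x m} (\<lambda>t. ?c (g n t))"
      by (rule continuous_on_compose2[OF cc[of UNIV]]) (auto intro: continuous_on_subset[OF g(1)])
  qed simp_all
  then obtain p where p: "\<And>n. polynomial_function (p n)"
    "\<And>n t. t \<in> {0..x m} \<Longrightarrow> norm (?c (g n t) - p n t) < 1 / real (Suc n)"
    by metis
  obtain K where K: "compact K" "K \<subseteq> U" "K \<subseteq> {0..x m}" "\<And>t. t \<notin> K \<Longrightarrow> cutoff m t = 0"
    using cutoff_support[OF m] by metis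
  have mc: "(\<lambda>t. complex_of_real (cutoff m t)) \<in> borel_measurable ?M"
    by (intro continuous_imp_measurable_on_sets_lebesgue continuous_intros continuous_on_cutoff) simp
  define G where "G t = cutoff m t * (B + 1)" for t
  have G: "integrable ?M (\<lambda>t. (G t)\<^sup>2)"
  proof -
    have "integrable lebesgue (\<lambda>t. (G t)\<^sup>2)"
      by (rule integrable_continuous_compact_support[OF _ K(1)])
        (auto simp: G_def K(4) intro!: continuous_intros continuous_on_cutoff)
    then show ?thesis
      using integrable_lebesgue_on_mono[of UNIV "\<lambda>t. (G t)\<^sup>2" "{0<..}"]
      by (simp add: lebesgue_on_UNIV_eq)
  qed
  have bd: "cmod (of_real (cutoff m t) * z) \<le> G t" if "cmod z \<le> B + 1" for t z
    unfolding G_def norm_mult using that cutoff_nonneg[of m t] by (simp add: mult_left_mono)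
  have bdp: "cmod (of_real (cutoff m t) * p n t) \<le> G t" for n t
  proof (cases "t \<in> {0..x m}")
    case True
    have "cmod (p n t) \<le> cmod (?c (g n t)) + cmod (?c (g n t) - p n t)"
      using norm_triangle_ineq4[of "?c (g n t)" "?c (g n t) - p n t"] by simp
    also have "\<dots> \<le> B + 1"
    proof -
      have "1 / real (Suc n) \<le> 1" by simp
      then show ?thesis using cb[of "g n t"] p(2)[OF True, of n] by linarith
    qed
    finally show ?thesis by (rule bd)
  next
    case False
    then have "cutoff m t = 0" using K by blast
    then show ?thesis by (simp add: G_def)
  qed
  have sq: "square_integrable_on {0<..} (\<lambda>t. of_real (cutoff m t) * H t)"
    unfolding square_integrable_on_def
  proof
    show mH: "(\<lambda>t. of_real (cutoff m t) * H t) \<in> borel_measurable ?M"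
      using mc H(1) by (rule borel_measurable_times)
    show "integrable ?M (\<lambda>t. (cmod (of_real (cutoff m t) * H t))\<^sup>2)"
    proof (rule Bochner_Integration.integrable_bound[OF G])
      show "(\<lambda>t. (cmod (of_real (cutoff m t) * H t))\<^sup>2) \<in> borel_measurable ?M"
        using mH by measurable
      show "AE t in ?M. norm ((cmod (of_real (cutoff m t) * H t))\<^sup>2) \<le> norm ((G t)\<^sup>2)"
      proof (rule AE_I2)
        fix t
        have "cmod (H t) \<le> B + 1" using H(2)[of t] by simp
        from power_mono[OF bd[OF this, of t] norm_ge_zero, of 2]
        show "norm ((cmod (of_real (cutoff m t) * H t))\<^sup>2) \<le> norm ((G t)\<^sup>2)" by simp
      qed
    qed
  qed
  have lim: "(\<lambda>n. abs_l2_halfline (\<lambda>t. of_real (cutoff m t) * p n t)) \<longlonglongrightarrow>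
      abs_l2_halfline (\<lambda>t. of_real (cutoff m t) * H t)"
  proof (rule dominated_convergence_l2(2)[OF sq _ _ G bdp])
    show "(\<lambda>t. of_real (cutoff m t) * p n t) \<in> borel_measurable ?M" for n
      by (intro borel_measurable_times mc continuous_imp_measurable_on_sets_lebesgue
          continuous_on_polymonial_function p) simp
    have "AE t in lebesgue. t \<notin> N"
      using N by (intro AE_not_in) (simp add: negligible_iff_null_sets)
    then have "AE t in lebesgue. t \<in> {0<..} \<longrightarrow> t \<notin> N"
      by eventually_elim simp
    then have "AE t in ?M. t \<in> {0<..} \<and> t \<notin> N"
      by (subst AE_restrict_space_iff) simp_all
    then show "AE t in ?M. (\<lambda>n. of_real (cutoff m t) * p n t) \<longlonglongrightarrow> of_real (cutoff m t) * H t"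
    proof eventually_elim
      case (elim t)
      show ?case
      proof (cases "t \<in> {0..x m}")
        case True
        have "(\<lambda>n. g n t) \<longlonglongrightarrow> H t" using g(2)[of t] elim by simp
        then have "(\<lambda>n. ?c (g n t)) \<longlonglongrightarrow> ?c (H t)"
          using cc[of UNIV] by (intro isCont_tendsto_compose[of _ ?c]) (auto simp: continuous_on_eq_continuous_at)
        then have 1: "(\<lambda>n. ?c (g n t)) \<longlonglongrightarrow> H t" by (simp add: cs H(2))
        have "(\<lambda>n. ?c (g n t) - p n t) \<longlonglongrightarrow> 0"
        proof (rule Lim_null_comparison)
          show "\<forall>\<^sub>F n in sequentially. norm (?c (g n t) - p n t) \<le> 1 / real (Suc n)"
            using p(2)[OF True] by (intro always_eventually allI less_imp_le) auto
          show "(\<lambda>n. 1 / real (Suc n)) \<longlonglongrightarrow> 0"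
            using LIMSEQ_inverse_real_of_nat by (simp add: inverse_eq_divide)
        qed
        from tendsto_diff[OF 1 this] have "(\<lambda>n. p n t) \<longlonglongrightarrow> H t" by simp
        then show ?thesis by (intro tendsto_intros)
      next
        case False
        then have "cutoff m t = 0" using K by blast
        then show ?thesis by simp
      qed
    qed
  qed
  show ?thesis
    unfolding closure_sequential
    by (rule exI, rule conjI[OF _ lim]) (use cutoff_polynomial_C2[OF m p(1)] in blast)
qed

text \<open>A square integrable function is the limit of its restrictions to the sets where the cutoff is at least
  \<open>1 / m\<close> and the function is at most \<open>m\<close>, and each of these is a multiple of the cutoff by a
  bounded function.\<close>

theorem C2_compact_support_dense:
  "closure (abs_l2_halfline ` {h. \<exists>h1 h2. C2_compact_support U h h1 h2}) = UNIV"
proof -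
  let ?D = "abs_l2_halfline ` {h. \<exists>h1 h2. C2_compact_support U h h1 h2}"
  let ?M = "lebesgue_on {0<..} :: real measure"
  have "F \<in> closure ?D" for F
  proof -
    obtain f where f: "square_integrable_on {0<..} f" and F: "F = abs_l2_halfline f"
      by (rule abs_l2_cases)
    have mf [measurable]: "f \<in> borel_measurable ?M"
      using f by (simp add: square_integrable_on_def)
    have mc [measurable]: "cutoff k \<in> borel_measurable ?M" for k
      by (intro continuous_imp_measurable_on_sets_lebesgue continuous_on_cutoff) simp
    define fs where "fs k t = (if 1 / real (Suc k) \<le> cutoff (Suc k) t \<and> cmod (f t) \<le> real (Suc k) then f t else 0)" for k t
    have mfs: "fs k \<in> borel_measurable ?M" for k
      unfolding fs_def[abs_def] by measurable
    have lim: "(\<lambda>k. abs_l2_halfline (fs k)) \<longlonglongrightarrow> abs_l2_halfline f"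
    proof (rule dominated_convergence_l2(2)[OF f mfs])
      show "integrable ?M (\<lambda>t. (cmod (f t))\<^sup>2)"
        using f by (simp add: square_integrable_on_def)
      show "cmod (fs k t) \<le> cmod (f t)" for k t
        by (simp add: fs_def)
      show "AE t in ?M. (\<lambda>k. fs k t) \<longlonglongrightarrow> f t"
        using AE_in_U
      proof eventually_elim
        case (elim t)
        obtain N where N: "cmod (f t) \<le> real N" using real_arch_simple by blast
        have "\<forall>\<^sub>F k in sequentially. fs k t = f t"
          using cutoff_eventually_pos[OF elim] eventually_ge_at_top[of N]
        proof eventually_elim
          case (elim k)
          have "cmod (f t) \<le> real (Suc k)" using N elim(2) by linarith
          then show ?case using elim(1) by (simp add: fs_def)
        qed
        then show ?case by (rule tendsto_eventually)
      qed
    qed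
    have "abs_l2_halfline (fs k) \<in> closure ?D" for k
    proof -
      define H where "H t = fs k t / of_real (cutoff (Suc k) t)" for t
      have "cmod (H t) \<le> real (Suc k) * real (Suc k)" for t
      proof (cases "1 / real (Suc k) \<le> cutoff (Suc k) t \<and> cmod (f t) \<le> real (Suc k)")
        case True
        have pos: "0 < 1 / real (Suc k)" by simp
        then have pc: "0 < cutoff (Suc k) t" using True by linarith
        have "cmod (H t) = cmod (f t) * (1 / cutoff (Suc k) t)"
          using True pc by (simp add: H_def fs_def norm_divide)
        also have "\<dots> \<le> real (Suc k) * real (Suc k)"
        proof (rule mult_mono)
          have "1 / cutoff (Suc k) t \<le> 1 / (1 / real (Suc k))"
            using True pos by (intro divide_left_mono mult_pos_pos pc) auto
          then show "1 / cutoff (Suc k) t \<le> real (Suc k)" by simp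
        qed (use True pc in auto)
        finally show ?thesis .
      next
        case False
        then have "H t = 0" by (auto simp: H_def fs_def)
        then show ?thesis by simp
      qed
      moreover have "H \<in> borel_measurable ?M"
      proof -
        have "(\<lambda>t. complex_of_real (cutoff (Suc k) t)) \<in> borel_measurable ?M"
          by (intro continuous_imp_measurable_on_sets_lebesgue continuous_intros continuous_on_cutoff) simp
        then show ?thesis
          unfolding H_def[abs_def] using mfs[of k] by (intro borel_measurable_divide)
      qed
      ultimately have "abs_l2_halfline (\<lambda>t. of_real (cutoff (Suc k) t) * H t) \<in> closure ?D"
        by (intro cutoff_multiple_in_closure[where B = "real (Suc k) * real (Suc k)"]) auto
      moreover have "of_real (cutoff (Suc k) t) * H t = fs k t" for t
      proof (cases "cutoff (Suc k) t = 0")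
        case True
        moreover have "\<not> 1 / real (Suc k) \<le> 0" by (simp add: not_le)
        ultimately have "fs k t = 0" unfolding fs_def by metis
        then show ?thesis using True by simp
      qed (simp add: H_def)
      ultimately show ?thesis by simp
    qed
    then have "F \<in> closure (closure ?D)"
      unfolding F closure_sequential[of "abs_l2_halfline f" "closure ?D"]
      by (intro exI[of _ "\<lambda>k. abs_l2_halfline (fs k)"] conjI allI lim)
    then show ?thesis by simp
  qed
  then show ?thesis by blast
qed

end

section \<open>Green's formula for the Hamiltonian\<close>

locale point_interactions = interaction_points x for x :: "nat \<Rightarrow> real" +
  fixes \<alpha> :: "nat \<Rightarrow> real"
begin

definition interface_conditions :: "(real \<Rightarrow> complex) \<Rightarrow> (real \<Rightarrow> complex) \<Rightarrow> bool" where
  "interface_conditions f f1 \<longleftrightarrow> (f1 \<longlongrightarrow> 0) (at_right 0) \<and>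
     (\<forall>n\<ge>1. \<exists>v p m.
        (f \<longlongrightarrow> v) (at_right (x n)) \<and> (f \<longlongrightarrow> v) (at_left (x n)) \<and>
        (f1 \<longlongrightarrow> p) (at_right (x n)) \<and> (f1 \<longlongrightarrow> m) (at_left (x n)) \<and>
        p - m = of_real (\<alpha> n) * v)"

text \<open>The domain of \<open>hamiltonian0\<close> on the level of functions rather than of equivalence classes.\<close>

definition hamiltonian0_data :: "(real \<Rightarrow> complex) \<Rightarrow> (real \<Rightarrow> complex) \<Rightarrow> (real \<Rightarrow> complex) \<Rightarrow> bool" where
  "hamiltonian0_data f f1 f2 \<longleftrightarrow> W22_on U f f1 f2 \<and>
     (\<exists>K. compact K \<and> K \<subseteq> {0..} \<and> (\<forall>t\<in>U - K. f t = 0)) \<and> interface_conditions f f1"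

lemma interface_conditions_limits:
  assumes "interface_conditions f f1" "n \<ge> 1"
  obtains v p m where "(f \<longlongrightarrow> v) (at_right (x n))" "(f \<longlongrightarrow> v) (at_left (x n))"
    "(f1 \<longlongrightarrow> p) (at_right (x n))" "(f1 \<longlongrightarrow> m) (at_left (x n))" "p - m = of_real (\<alpha> n) * v"
  using assms unfolding interface_conditions_def by blast

lemma hamiltonian0_eq:
  "hamiltonian0 x \<alpha> = {(abs_l2_halfline f, - abs_l2_halfline f2) | f f1 f2. hamiltonian0_data f f1 f2}"
  unfolding hamiltonian0_def hamiltonian0_data_def interface_conditions_def U_def by blast

lemma W22_on_U_square_integrable:
  assumes "W22_on U f f1 f2"
  shows "square_integrable_on {0<..} f" "square_integrable_on {0<..} f2"
  using assms by (simp_all add: W22_on_def square_integrable_on_U)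

lemma interface_conditions_cnj:
  assumes "interface_conditions f f1"
  shows "interface_conditions (\<lambda>t. cnj (f t)) (\<lambda>t. cnj (f1 t))"
  unfolding interface_conditions_def
proof (intro conjI allI impI)
  show "((\<lambda>t. cnj (f1 t)) \<longlongrightarrow> 0) (at_right 0)"
    using tendsto_cnj[of f1 0] assms by (simp add: interface_conditions_def)
  fix n :: nat assume "n \<ge> 1"
  then obtain v p m where l:
    "(f \<longlongrightarrow> v) (at_right (x n))" "(f \<longlongrightarrow> v) (at_left (x n))"
    "(f1 \<longlongrightarrow> p) (at_right (x n))" "(f1 \<longlongrightarrow> m) (at_left (x n))" "p - m = of_real (\<alpha> n) * v"
    using assms unfolding interface_conditions_def by blast
  have "cnj p - cnj m = of_real (\<alpha> n) * cnj v"
    using arg_cong[OF l(5), of cnj] by simp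
  with l(1-4)[THEN tendsto_cnj] show "\<exists>v p m.
        ((\<lambda>t. cnj (f t)) \<longlongrightarrow> v) (at_right (x n)) \<and> ((\<lambda>t. cnj (f t)) \<longlongrightarrow> v) (at_left (x n)) \<and>
        ((\<lambda>t. cnj (f1 t)) \<longlongrightarrow> p) (at_right (x n)) \<and> ((\<lambda>t. cnj (f1 t)) \<longlongrightarrow> m) (at_left (x n)) \<and>
        p - m = of_real (\<alpha> n) * v" by blast
qed

lemma hamiltonian0_data_cnj:
  assumes "hamiltonian0_data f f1 f2"
  shows "hamiltonian0_data (\<lambda>t. cnj (f t)) (\<lambda>t. cnj (f1 t)) (\<lambda>t. cnj (f2 t))"
  using assms by (simp add: hamiltonian0_data_def W22_on_cnj interface_conditions_cnj)

text \<open>The domain conditions at the origin concern \<open>f'\<close> only; near the origin \<open>f\<close> is Lipschitz, which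
  is enough to control the boundary terms there.\<close>

lemma bounded_at_right_0:
  assumes f: "W22_on {0<..<u} f f1 f2" and u: "0 < u" and lim: "(f1 \<longlongrightarrow> 0) (at_right 0)"
  obtains B where "\<forall>\<^sub>F t in at_right 0. cmod (f t) \<le> B"
proof -
  have "\<forall>\<^sub>F t in at_right 0. dist (f1 t) 0 < 1"
    using lim by (rule tendstoD) simp
  then obtain c where c: "c > 0" "\<And>t. 0 < t \<Longrightarrow> t < c \<Longrightarrow> cmod (f1 t) < 1"
    unfolding eventually_at_right_field by auto
  define b where "b = min c u / 2"
  have b: "0 < b" "b < c" "b < u" using c u by (auto simp: b_def)
  have "cmod (f t) \<le> cmod (f b) + b" if t: "0 < t" "t < b" for t
  proof -
    have d: "(f has_vector_derivative f1 s) (at s)" if "s \<in> {t..b}" for s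
      by (rule W22_on_derivatives[OF f]) (use that t b in auto)
    have "\<exists>s\<in>{t<..<b}. norm (f b - f t) \<le> norm ((b - t) *\<^sub>R f1 s)"
    proof (rule mvt_general[OF t(2)])
      show "continuous_on {t..b} f"
        using d by (meson continuous_at_imp_continuous_on has_vector_derivative_continuous)
      show "(f has_derivative (\<lambda>h. h *\<^sub>R f1 s)) (at s)" if "t < s" "s < b" for s
        using d[of s] that by (simp add: has_vector_derivative_def)
    qed
    then obtain s where s: "t < s" "s < b" "norm (f b - f t) \<le> (b - t) * norm (f1 s)"
      using t by auto
    have "(b - t) * norm (f1 s) \<le> (b - t) * 1"
      using c(2)[of s] s t b by (intro mult_left_mono) auto
    then have "norm (f b - f t) \<le> b - t" using s(3) by simp
    then have "cmod (f b - f t) \<le> b" using t by simp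
    then show ?thesis using norm_triangle_ineq3[of "f b" "f t"] by linarith
  qed
  then have "\<forall>\<^sub>F t in at_right 0. cmod (f t) \<le> cmod (f b) + b"
    unfolding eventually_at_right_field using b by blast
  then show thesis by (rule that)
qed

text \<open>The one-sided Wronskians agree at every interaction point, because both functions satisfy the
  same jump condition, and vanish at the origin and beyond the support of \<open>f\<close>; so
  Lagrange's identities on the intervals telescope to zero.\<close>

lemma Green_formula:
  assumes f: "\<And>n. W22_on {x n<..<x (Suc n)} f f1 f2" "interface_conditions f f1"
    and g: "\<And>n. W22_on {x n<..<x (Suc n)} g g1 g2" "interface_conditions g g1"
    and sq: "square_integrable_on {0<..} f" "square_integrable_on {0<..} f2"
      "square_integrable_on {0<..} g" "square_integrable_on {0<..} g2"
    and supp: "\<And>t. t \<in> U \<Longrightarrow> R < t \<Longrightarrow> f t = 0"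
  shows "integral\<^sup>L (lebesgue_on {0<..}) (\<lambda>t. f2 t * g t) = integral\<^sup>L (lebesgue_on {0<..}) (\<lambda>t. f t * g2 t)"
proof -
  let ?M = "lebesgue_on {0<..} :: real measure"
  let ?I = "\<lambda>n. {x n<..<x (Suc n)}"
  let ?P = "\<lambda>t. g t * f2 t - f t * g2 t"
  \<comment> \<open>Only the left-hand limits at the right end point survive the telescoping.\<close>
  have partial: "\<exists>A A'. ((\<lambda>t. g t * f1 t) \<longlongrightarrow> A) (at_left (x (Suc n))) \<and>
      ((\<lambda>t. f t * g1 t) \<longlongrightarrow> A') (at_left (x (Suc n))) \<and>
      (\<Sum>k<Suc n. integral\<^sup>L (lebesgue_on (?I k)) ?P) = A - A'" for n
  proof (induction n)
    case 0
    have I0: "?I 0 = {0<..<x (Suc 0)}" "0 < x (Suc 0)"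
      using x_0 x_less[of 0] by simp_all
    obtain Bf where Bf: "\<forall>\<^sub>F t in at_right 0. cmod (f t) \<le> Bf"
      using bounded_at_right_0[OF f(1)[of 0, unfolded I0(1)] I0(2)] f(2) unfolding interface_conditions_def by metis
    obtain Bg where Bg: "\<forall>\<^sub>F t in at_right 0. cmod (g t) \<le> Bg"
      using bounded_at_right_0[OF g(1)[of 0, unfolded I0(1)] I0(2)] g(2) unfolding interface_conditions_def by metis
    have null: "((\<lambda>t. c t * e t) \<longlongrightarrow> 0) (at_right 0)"
      if "\<forall>\<^sub>F t in at_right 0. cmod (c t) \<le> B" "(e \<longlongrightarrow> 0) (at_right 0)" for c e :: "real \<Rightarrow> complex" and B
    proof (rule Lim_null_comparison)
      show "\<forall>\<^sub>F t in at_right 0. norm (c t * e t) \<le> B * norm (e t)"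
        using that(1) by eventually_elim (simp add: norm_mult mult_right_mono)
      have "((\<lambda>t. B * norm (e t)) \<longlongrightarrow> B * norm (0 :: complex)) (at_right 0)"
        by (intro tendsto_intros that(2))
      then show "((\<lambda>t. B * norm (e t)) \<longlongrightarrow> 0) (at_right 0)" by simp
    qed
    have l: "((\<lambda>t. g t * f1 t) \<longlongrightarrow> 0) (at_right (x 0))" "((\<lambda>t. f t * g1 t) \<longlongrightarrow> 0) (at_right (x 0))"
      using null[OF Bg, of f1] null[OF Bf, of g1] f(2) g(2) x_0 by (simp_all add: interface_conditions_def)
    have n1: "Suc 0 \<ge> 1" by simp
    obtain v m where fl: "(f \<longlongrightarrow> v) (at_left (x (Suc 0)))" "(f1 \<longlongrightarrow> m) (at_left (x (Suc 0)))"
      by (rule interface_conditions_limits[OF f(2) n1])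
    obtain v' m' where gl: "(g \<longlongrightarrow> v') (at_left (x (Suc 0)))" "(g1 \<longlongrightarrow> m') (at_left (x (Suc 0)))"
      by (rule interface_conditions_limits[OF g(2) n1])
    have r: "((\<lambda>t. g t * f1 t) \<longlongrightarrow> v' * m) (at_left (x (Suc 0)))"
      "((\<lambda>t. f t * g1 t) \<longlongrightarrow> v * m') (at_left (x (Suc 0)))"
      by (intro tendsto_mult fl gl)+
    have "integral\<^sup>L (lebesgue_on (?I 0)) ?P = v' * m - v * m' - (0 - 0)"
      by (rule Lagrange_identity[OF x_less f(1) g(1) l r])
    with r show ?case by auto
  next
    case (Suc n)
    then obtain A A' where A: "((\<lambda>t. g t * f1 t) \<longlongrightarrow> A) (at_left (x (Suc n)))"
      "((\<lambda>t. f t * g1 t) \<longlongrightarrow> A') (at_left (x (Suc n)))"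
      "(\<Sum>k<Suc n. integral\<^sup>L (lebesgue_on (?I k)) ?P) = A - A'" by blast
    have n1: "Suc n \<ge> 1" "Suc (Suc n) \<ge> 1" by simp_all
    obtain v p m where v: "(f \<longlongrightarrow> v) (at_right (x (Suc n)))" "(f \<longlongrightarrow> v) (at_left (x (Suc n)))"
        "(f1 \<longlongrightarrow> p) (at_right (x (Suc n)))" "(f1 \<longlongrightarrow> m) (at_left (x (Suc n)))" "p - m = of_real (\<alpha> (Suc n)) * v"
      using f(2) n1 unfolding interface_conditions_def by blast
    obtain v' p' m' where v': "(g \<longlongrightarrow> v') (at_right (x (Suc n)))" "(g \<longlongrightarrow> v') (at_left (x (Suc n)))"
        "(g1 \<longlongrightarrow> p') (at_right (x (Suc n)))" "(g1 \<longlongrightarrow> m') (at_left (x (Suc n)))" "p' - m' = of_real (\<alpha> (Suc n)) * v'"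
      using g(2) n1 unfolding interface_conditions_def by blast
    have ne: "at_left (x (Suc n)) \<noteq> bot" by simp
    have "A = v' * m" "A' = v * m'"
      using tendsto_unique[OF ne A(1) tendsto_mult[OF v'(2) v(4)]]
        tendsto_unique[OF ne A(2) tendsto_mult[OF v(2) v'(4)]] by simp_all
    moreover have "v' * (p - m) - v * (p' - m') = 0"
      unfolding v(5) v'(5) by simp
    ultimately have AA: "A - A' = v' * p - v * p'" by (simp add: algebra_simps)
    obtain v2 m2 where fl: "(f \<longlongrightarrow> v2) (at_left (x (Suc (Suc n))))" "(f1 \<longlongrightarrow> m2) (at_left (x (Suc (Suc n))))"
      by (rule interface_conditions_limits[OF f(2) n1(2)])
    obtain v2' m2' where gl: "(g \<longlongrightarrow> v2') (at_left (x (Suc (Suc n))))" "(g1 \<longlongrightarrow> m2') (at_left (x (Suc (Suc n))))"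
      by (rule interface_conditions_limits[OF g(2) n1(2)])
    have r: "((\<lambda>t. g t * f1 t) \<longlongrightarrow> v2' * m2) (at_left (x (Suc (Suc n))))"
      "((\<lambda>t. f t * g1 t) \<longlongrightarrow> v2 * m2') (at_left (x (Suc (Suc n))))"
      by (intro tendsto_mult fl gl)+
    have "integral\<^sup>L (lebesgue_on (?I (Suc n))) ?P = v2' * m2 - v2 * m2' - (v' * p - v * p')"
      by (rule Lagrange_identity[OF x_less f(1) g(1) tendsto_mult[OF v'(1) v(3)] tendsto_mult[OF v(1) v'(3)] r])
    then have "(\<Sum>k<Suc (Suc n). integral\<^sup>L (lebesgue_on (?I k)) ?P) = v2' * m2 - v2 * m2'"
      using A(3) AA by simp
    with r show ?case by blast
  qed
  have "\<forall>\<^sub>F n in sequentially. R < x n"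
    using x_lim by (simp add: filterlim_at_top_dense)
  then obtain N where N: "R < x N"
    by (auto simp: eventually_sequentially)
  have z: "f t = 0" if "t \<in> {x n<..<x (Suc n)}" "n \<ge> N" for t n
  proof -
    have "x N \<le> x n" using that strict_mono_less_eq[OF x_mono] by simp
    then show ?thesis
      using that N interval_subset_U[of n] by (intro supp) auto
  qed
  have dz: "c1 t = 0" if "\<And>t. t \<in> ?I n \<Longrightarrow> c t = 0" "(c has_vector_derivative c1 t) (at t)" "t \<in> ?I n"
    for c c1 :: "real \<Rightarrow> complex" and t n
    by (rule derivative_eq_0_off_closed[of "- ?I n" c, OF _ _ that(2)]) (use that in \<open>auto simp: closed_Compl\<close>)
  have sum0: "(\<Sum>k<Suc n. integral\<^sup>L (lebesgue_on (?I k)) ?P) = 0" if n: "n \<ge> N" for n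
  proof -
    have z1: "f1 t = 0" if "t \<in> ?I n" for t
      by (rule dz[OF z W22_on_derivatives[OF f(1)]]) (use that n in auto)
    obtain A A' where A: "((\<lambda>t. g t * f1 t) \<longlongrightarrow> A) (at_left (x (Suc n)))"
      "((\<lambda>t. f t * g1 t) \<longlongrightarrow> A') (at_left (x (Suc n)))"
      "(\<Sum>k<Suc n. integral\<^sup>L (lebesgue_on (?I k)) ?P) = A - A'" using partial by blast
    have near: "\<forall>\<^sub>F t in at_left (x (Suc n)). t \<in> ?I n"
      unfolding eventually_at_left_field using x_less[of n] by auto
    have "((\<lambda>t. g t * f1 t) \<longlongrightarrow> 0) (at_left (x (Suc n)))"
      by (rule tendsto_eventually, rule eventually_mono[OF near]) (simp only: z1 mult_zero_right)
    moreover have "((\<lambda>t. f t * g1 t) \<longlongrightarrow> 0) (at_left (x (Suc n)))"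
      by (rule tendsto_eventually, rule eventually_mono[OF near]) (simp only: z[OF _ n] mult_zero_left)
    ultimately have "A = 0" "A' = 0"
      using tendsto_unique[OF _ A(1)] tendsto_unique[OF _ A(2)] by auto
    then show ?thesis using A(3) by simp
  qed
  have i: "integrable ?M (\<lambda>t. g t * f2 t)" "integrable ?M (\<lambda>t. f t * g2 t)"
    by (rule square_integrable_on_integrable_mult; rule sq)+
  then have iP: "integrable ?M ?P"
    by (rule Bochner_Integration.integrable_diff)
  have iP': "integrable lebesgue (\<lambda>t. indicator {0<..} t *\<^sub>R ?P t)"
    using iP by (simp only: integrable_lebesgue_on_iff[of "{0<..}"] lessThan_borel greaterThan_borel sets_completionI_sets sets_lborel)
  have iPk: "integrable (lebesgue_on (?I k)) ?P" for k
    by (rule integrable_lebesgue_on_mono[OF iP]) (use x_nonneg[of k] in auto)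
  have sets: "?I k \<in> sets lebesgue" for k by simp
  have "(\<lambda>n. integral\<^sup>L lebesgue (\<lambda>t. \<Sum>k<n. indicator (?I k) t *\<^sub>R ?P t)) \<longlonglongrightarrow>
      integral\<^sup>L lebesgue (\<lambda>t. indicator {0<..} t *\<^sub>R ?P t)"
  proof (rule integral_dominated_convergence[where w = "\<lambda>t. norm (indicator {0<..} t *\<^sub>R ?P t)"])
    show "(\<lambda>t. indicator {0<..} t *\<^sub>R ?P t) \<in> borel_measurable lebesgue"
      using iP' by (rule borel_measurable_integrable)
    show "integrable lebesgue (\<lambda>t. norm (indicator {0<..} t *\<^sub>R ?P t))"
      using iP' by (rule integrable_norm)
    show "(\<lambda>t. \<Sum>k<n. indicator (?I k) t *\<^sub>R ?P t) \<in> borel_measurable lebesgue" for n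
      using iPk by (intro borel_measurable_sum borel_measurable_integrable) (simp only: integrable_lebesgue_on_iff[OF sets, symmetric])
    have val: "(\<Sum>k<n. indicator (?I k) t *\<^sub>R ?P t) = (if piece t < n \<and> t \<in> U then ?P t else 0)" for n t
    proof (cases "t \<in> U")
      case True
      have "t \<in> ?I k \<longleftrightarrow> k = piece t" for k
      proof
        assume "t \<in> ?I k"
        then show "k = piece t" by (intro piece_eqI[symmetric]) auto
      next
        assume k: "k = piece t"
        have "0 \<le> t" "t \<noteq> x k" using True by (auto simp: U_def)
        then show "t \<in> ?I k" using piece_bounds[of t] k by auto
      qed
      then have "(\<Sum>k<n. indicator (?I k) t *\<^sub>R ?P t) = (\<Sum>k<n. if k = piece t then ?P t else 0)"
        by (intro sum.cong) (auto simp: indicator_def)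
      also have "\<dots> = (if piece t < n \<and> t \<in> U then ?P t else 0)"
        using True by simp
      finally show ?thesis .
    next
      case False
      then have "t \<notin> ?I k" for k using interval_subset_U by blast
      then have "indicator (?I k) t *\<^sub>R ?P t = 0" for k
        by (subst indicator_simps(2)) simp_all
      then show ?thesis using False by (simp only: sum.neutral_const simp_thms if_False)
    qed
    show "AE t in lebesgue. norm (\<Sum>k<n. indicator (?I k) t *\<^sub>R ?P t) \<le> norm (indicator {0<..} t *\<^sub>R ?P t)" for n
      unfolding val by (rule AE_I2) (auto simp: U_def)
    have "AE t in lebesgue. t \<in> {0<..} \<longrightarrow> t \<in> U"
      using AE_in_U by (subst (asm) AE_restrict_space_iff) simp_all
    then show "AE t in lebesgue. (\<lambda>n. \<Sum>k<n. indicator (?I k) t *\<^sub>R ?P t) \<longlonglongrightarrow> indicator {0<..} t *\<^sub>R ?P t"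
    proof eventually_elim
      case (elim t)
      have "\<forall>\<^sub>F n in sequentially. (if piece t < n \<and> t \<in> U then ?P t else 0) = indicator {0<..} t *\<^sub>R ?P t"
        using eventually_gt_at_top[of "piece t"]
        by eventually_elim (use elim U_subset in \<open>auto simp: indicator_def\<close>)
      then show ?case unfolding val by (rule tendsto_eventually)
    qed
  qed
  moreover have "integral\<^sup>L lebesgue (\<lambda>t. \<Sum>k<n. indicator (?I k) t *\<^sub>R ?P t) =
      (\<Sum>k<n. integral\<^sup>L (lebesgue_on (?I k)) ?P)" for n
  proof -
    have "integral\<^sup>L lebesgue (\<lambda>t. \<Sum>k<n. indicator (?I k) t *\<^sub>R ?P t) =
        (\<Sum>k<n. integral\<^sup>L lebesgue (\<lambda>t. indicator (?I k) t *\<^sub>R ?P t))"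
      using iPk by (intro Bochner_Integration.integral_sum) (simp only: integrable_lebesgue_on_iff[OF sets, symmetric])
    also have "\<dots> = (\<Sum>k<n. integral\<^sup>L (lebesgue_on (?I k)) ?P)"
      by (intro sum.cong integral_restrict_space[symmetric] refl) simp
    finally show ?thesis .
  qed
  ultimately have "(\<lambda>n. \<Sum>k<n. integral\<^sup>L (lebesgue_on (?I k)) ?P) \<longlonglongrightarrow>
      integral\<^sup>L lebesgue (\<lambda>t. indicator {0<..} t *\<^sub>R ?P t)"
    by (simp only:)
  moreover have "(\<lambda>n. \<Sum>k<n. integral\<^sup>L (lebesgue_on (?I k)) ?P) \<longlonglongrightarrow> 0"
  proof (rule tendsto_eventually)
    show "\<forall>\<^sub>F n in sequentially. (\<Sum>k<n. integral\<^sup>L (lebesgue_on (?I k)) ?P) = 0"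
      unfolding eventually_sequentially
    proof (intro exI allI impI)
      fix n assume "Suc N \<le> n"
      then obtain j where "n = Suc j" "N \<le> j" by (cases n) auto
      then show "(\<Sum>k<n. integral\<^sup>L (lebesgue_on (?I k)) ?P) = 0" using sum0 by simp
    qed
  qed
  ultimately have "integral\<^sup>L lebesgue (\<lambda>t. indicator {0<..} t *\<^sub>R ?P t) = 0"
    by (rule LIMSEQ_unique)
  then have "integral\<^sup>L ?M ?P = 0"
    by (subst integral_restrict_space) simp_all
  then have "integral\<^sup>L ?M (\<lambda>t. g t * f2 t) = integral\<^sup>L ?M (\<lambda>t. f t * g2 t)"
    unfolding Bochner_Integration.integral_diff[OF i] by simp
  then show ?thesis
    by (simp add: mult.commute)
qed

end

section \<open>Symmetry of the Hamiltonian\<close>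

context point_interactions
begin

lemma interface_conditions_add:
  assumes f: "interface_conditions f f1" and g: "interface_conditions g g1"
  shows "interface_conditions (\<lambda>t. f t + g t) (\<lambda>t. f1 t + g1 t)"
  unfolding interface_conditions_def
proof (intro conjI allI impI)
  show "((\<lambda>t. f1 t + g1 t) \<longlongrightarrow> 0) (at_right 0)"
    using tendsto_add[of f1 0 "at_right 0" g1 0] f g by (simp add: interface_conditions_def)
  fix n :: nat assume n: "n \<ge> 1"
  obtain v p m where F: "(f \<longlongrightarrow> v) (at_right (x n))" "(f \<longlongrightarrow> v) (at_left (x n))"
    "(f1 \<longlongrightarrow> p) (at_right (x n))" "(f1 \<longlongrightarrow> m) (at_left (x n))" "p - m = of_real (\<alpha> n) * v"
    by (rule interface_conditions_limits[OF f n])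
  obtain v' p' m' where G: "(g \<longlongrightarrow> v') (at_right (x n))" "(g \<longlongrightarrow> v') (at_left (x n))"
    "(g1 \<longlongrightarrow> p') (at_right (x n))" "(g1 \<longlongrightarrow> m') (at_left (x n))" "p' - m' = of_real (\<alpha> n) * v'"
    by (rule interface_conditions_limits[OF g n])
  have "(p + p') - (m + m') = of_real (\<alpha> n) * (v + v')"
    using F(5) G(5) by (simp add: algebra_simps)
  with tendsto_add[OF F(1) G(1)] tendsto_add[OF F(2) G(2)] tendsto_add[OF F(3) G(3)] tendsto_add[OF F(4) G(4)]
  show "\<exists>v p m. ((\<lambda>t. f t + g t) \<longlongrightarrow> v) (at_right (x n)) \<and> ((\<lambda>t. f t + g t) \<longlongrightarrow> v) (at_left (x n)) \<and>
        ((\<lambda>t. f1 t + g1 t) \<longlongrightarrow> p) (at_right (x n)) \<and> ((\<lambda>t. f1 t + g1 t) \<longlongrightarrow> m) (at_left (x n)) \<and>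
        p - m = of_real (\<alpha> n) * v" by blast
qed

lemma interface_conditions_scale:
  assumes f: "interface_conditions f f1"
  shows "interface_conditions (\<lambda>t. c * f t) (\<lambda>t. c * f1 t)"
  unfolding interface_conditions_def
proof (intro conjI allI impI)
  show "((\<lambda>t. c * f1 t) \<longlongrightarrow> 0) (at_right 0)"
    using tendsto_mult_left[of f1 0 "at_right 0" c] f by (simp add: interface_conditions_def)
  fix n :: nat assume n: "n \<ge> 1"
  obtain v p m where F: "(f \<longlongrightarrow> v) (at_right (x n))" "(f \<longlongrightarrow> v) (at_left (x n))"
    "(f1 \<longlongrightarrow> p) (at_right (x n))" "(f1 \<longlongrightarrow> m) (at_left (x n))" "p - m = of_real (\<alpha> n) * v"
    by (rule interface_conditions_limits[OF f n])
  have "c * p - c * m = of_real (\<alpha> n) * (c * v)"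
    unfolding right_diff_distrib[symmetric] F(5) by (rule mult.left_commute)
  with tendsto_mult_left[OF F(1), of c] tendsto_mult_left[OF F(2), of c]
    tendsto_mult_left[OF F(3), of c] tendsto_mult_left[OF F(4), of c]
  show "\<exists>v p m. ((\<lambda>t. c * f t) \<longlongrightarrow> v) (at_right (x n)) \<and> ((\<lambda>t. c * f t) \<longlongrightarrow> v) (at_left (x n)) \<and>
        ((\<lambda>t. c * f1 t) \<longlongrightarrow> p) (at_right (x n)) \<and> ((\<lambda>t. c * f1 t) \<longlongrightarrow> m) (at_left (x n)) \<and>
        p - m = of_real (\<alpha> n) * v" by blast
qed

lemma hamiltonian0_data_add:
  assumes f: "hamiltonian0_data f f1 f2" and g: "hamiltonian0_data g g1 g2"
  shows "hamiltonian0_data (\<lambda>t. f t + g t) (\<lambda>t. f1 t + g1 t) (\<lambda>t. f2 t + g2 t)"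
  unfolding hamiltonian0_data_def
proof (intro conjI)
  show "W22_on U (\<lambda>t. f t + g t) (\<lambda>t. f1 t + g1 t) (\<lambda>t. f2 t + g2 t)"
    using f g U_sets unfolding hamiltonian0_data_def W22_on_def
    by (simp add: square_integrable_on_add weak_derivative_on_add continuous_on_add)
  obtain K L where "compact K" "K \<subseteq> {0..}" "\<forall>t\<in>U - K. f t = 0" "compact L" "L \<subseteq> {0..}" "\<forall>t\<in>U - L. g t = 0"
    using f g unfolding hamiltonian0_data_def by blast
  then show "\<exists>K. compact K \<and> K \<subseteq> {0..} \<and> (\<forall>t\<in>U - K. f t + g t = 0)"
    by (intro exI[of _ "K \<union> L"]) auto
  show "interface_conditions (\<lambda>t. f t + g t) (\<lambda>t. f1 t + g1 t)"
    using f g by (simp add: hamiltonian0_data_def interface_conditions_add)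
qed

lemma hamiltonian0_data_scale:
  assumes f: "hamiltonian0_data f f1 f2"
  shows "hamiltonian0_data (\<lambda>t. c * f t) (\<lambda>t. c * f1 t) (\<lambda>t. c * f2 t)"
  unfolding hamiltonian0_data_def
proof (intro conjI)
  show "W22_on U (\<lambda>t. c * f t) (\<lambda>t. c * f1 t) (\<lambda>t. c * f2 t)"
    using f unfolding hamiltonian0_data_def W22_on_def
    by (simp add: square_integrable_on_scale weak_derivative_on_scale continuous_on_mult)
  show "\<exists>K. compact K \<and> K \<subseteq> {0..} \<and> (\<forall>t\<in>U - K. c * f t = 0)"
    using f unfolding hamiltonian0_data_def by auto
  show "interface_conditions (\<lambda>t. c * f t) (\<lambda>t. c * f1 t)"
    using f by (simp add: hamiltonian0_data_def interface_conditions_scale)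
qed

lemma hamiltonian0_data_compact_support:
  assumes h: "C2_compact_support U h h1 h2"
  shows "hamiltonian0_data h h1 h2"
proof -
  obtain K where K: "compact K" "K \<subseteq> U" "\<And>t. t \<notin> K \<Longrightarrow> h t = 0 \<and> h1 t = 0 \<and> h2 t = 0"
    using C2_compact_support_zero[OF h] by metis
  have d: "\<And>t. (h has_vector_derivative h1 t) (at t)" "\<And>t. (h1 has_vector_derivative h2 t) (at t)"
    and c: "continuous_on UNIV h2"
    using h by (simp_all add: C2_compact_support_def)
  have c0: "continuous_on UNIV h" "continuous_on UNIV h1"
    using d by (meson continuous_at_imp_continuous_on has_vector_derivative_continuous)+
  have "W22_on U h h1 h2"
    by (rule W22_on_classical[OF open_U])
      (use d c0 c K continuous_on_subset[OF c] in
        \<open>auto intro!: square_integrable_on_continuous_compact_support[OF U_sets _ K(1)]\<close>)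
  moreover have "interface_conditions h h1"
  proof -
    have "open (- K)" using compact_imp_closed[OF K(1)] by (simp add: open_Compl)
    moreover have "x n \<in> - K" for n using K(2) by (auto simp: U_def)
    ultimately have ev: "\<forall>\<^sub>F t in at (x n). t \<in> - K" for n
      by (intro eventually_at_topological[THEN iffD2]) blast
    have z: "(h \<longlongrightarrow> 0) (at (x n))" "(h1 \<longlongrightarrow> 0) (at (x n))" for n
      using ev[of n] by (auto intro!: tendsto_eventually elim!: eventually_mono dest: K(3))
    have lr: "(c \<longlongrightarrow> 0) (at_right (x n))" "(c \<longlongrightarrow> 0) (at_left (x n))" if "(c \<longlongrightarrow> 0) (at (x n))"
      for c :: "real \<Rightarrow> complex" and n
      using that by (simp_all add: filterlim_at_split)
    show ?thesis
      unfolding interface_conditions_def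
    proof (intro conjI allI impI)
      show "(h1 \<longlongrightarrow> 0) (at_right 0)"
        using lr(1)[OF z(2)[of 0]] x_0 by simp
      show "\<exists>v p m. (h \<longlongrightarrow> v) (at_right (x n)) \<and> (h \<longlongrightarrow> v) (at_left (x n)) \<and>
          (h1 \<longlongrightarrow> p) (at_right (x n)) \<and> (h1 \<longlongrightarrow> m) (at_left (x n)) \<and> p - m = of_real (\<alpha> n) * v" for n
        by (rule exI[of _ 0], rule exI[of _ 0], rule exI[of _ 0])
          (simp add: lr[OF z(1)[of n]] lr[OF z(2)[of n]])
    qed
  qed
  moreover have "K \<subseteq> {0..}" using K(2) U_subset by auto
  ultimately show ?thesis
    unfolding hamiltonian0_data_def using K by blast
qed

lemma interval_W22:
  assumes "W22_on U f f1 f2"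
  shows "W22_on {x n<..<x (Suc n)} f f1 f2"
  by (rule W22_on_subset[OF assms open_U _ interval_subset_U]) simp

lemma hamiltonian0_data_support:
  assumes "hamiltonian0_data f f1 f2"
  obtains R where "\<And>t. t \<in> U \<Longrightarrow> R < t \<Longrightarrow> f t = 0"
proof -
  obtain K where K: "compact K" "\<forall>t\<in>U - K. f t = 0"
    using assms unfolding hamiltonian0_data_def by blast
  obtain R where "\<And>t. t \<in> K \<Longrightarrow> \<bar>t\<bar> \<le> R"
    using compact_imp_bounded[OF K(1)] by (auto simp: bounded_iff)
  then show thesis using K(2) by (intro that[of R]) force
qed

theorem hamiltonian_symmetric: "symmetric_operator (hamiltonian x \<alpha>)"
  unfolding hamiltonian_def
proof (rule symmetric_operator_closure)
  show "linear_graph (hamiltonian0 x \<alpha>)"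
    unfolding linear_graph_def
  proof (intro conjI allI ballI; clarify?)
    have "hamiltonian0_data (\<lambda>t. 0) (\<lambda>t. 0) (\<lambda>t. 0)"
      by (rule hamiltonian0_data_compact_support) (auto simp: C2_compact_support_def)
    moreover have "abs_l2_halfline (\<lambda>t. 0) = 0"
      by (simp add: zero_l2_halfline_def)
    ultimately show "(0, 0) \<in> hamiltonian0 x \<alpha>"
      unfolding hamiltonian0_eq by force
  next
    fix F F' G G' assume "(F, F') \<in> hamiltonian0 x \<alpha>" "(G, G') \<in> hamiltonian0 x \<alpha>"
    then obtain f f1 f2 g g1 g2 where d: "hamiltonian0_data f f1 f2" "hamiltonian0_data g g1 g2"
      and e: "F = abs_l2_halfline f" "F' = - abs_l2_halfline f2" "G = abs_l2_halfline g" "G' = - abs_l2_halfline g2"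
      unfolding hamiltonian0_eq by blast
    have sq: "square_integrable_on {0<..} f" "square_integrable_on {0<..} f2"
      "square_integrable_on {0<..} g" "square_integrable_on {0<..} g2"
      using d W22_on_U_square_integrable unfolding hamiltonian0_data_def by blast+
    have "F + G = abs_l2_halfline (\<lambda>t. f t + g t)" "F' + G' = - abs_l2_halfline (\<lambda>t. f2 t + g2 t)"
      unfolding e plus_abs_l2[OF sq(1,3), symmetric] plus_abs_l2[OF sq(2,4), symmetric] by simp_all
    then show "(F + G, F' + G') \<in> hamiltonian0 x \<alpha>"
      unfolding hamiltonian0_eq using hamiltonian0_data_add[OF d] by blast
  next
    fix c F F' assume "(F, F') \<in> hamiltonian0 x \<alpha>"
    then obtain f f1 f2 where d: "hamiltonian0_data f f1 f2"
      and e: "F = abs_l2_halfline f" "F' = - abs_l2_halfline f2"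
      unfolding hamiltonian0_eq by blast
    have sq: "square_integrable_on {0<..} f" "square_integrable_on {0<..} f2"
      using d W22_on_U_square_integrable unfolding hamiltonian0_data_def by blast+
    have "scaleC_l2 c F = abs_l2_halfline (\<lambda>t. c * f t)" "scaleC_l2 c F' = - abs_l2_halfline (\<lambda>t. c * f2 t)"
      unfolding e scaleC_abs_l2[OF sq(1), symmetric] scaleC_abs_l2[OF sq(2), symmetric]
      by (simp_all add: l2.scale_minus_right)
    then show "(scaleC_l2 c F, scaleC_l2 c F') \<in> hamiltonian0 x \<alpha>"
      unfolding hamiltonian0_eq using hamiltonian0_data_scale[OF d] by blast
  qed
  have "abs_l2_halfline ` {h. \<exists>h1 h2. C2_compact_support U h h1 h2} \<subseteq> Domain (hamiltonian0 x \<alpha>)"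
    unfolding hamiltonian0_eq using hamiltonian0_data_compact_support by blast
  from closure_mono[OF this] show "closure (Domain (hamiltonian0 x \<alpha>)) = UNIV"
    unfolding C2_compact_support_dense by blast
next
  fix F F' G G' assume "(F, F') \<in> hamiltonian0 x \<alpha>" "(G, G') \<in> hamiltonian0 x \<alpha>"
  then obtain f f1 f2 g g1 g2 where d: "hamiltonian0_data f f1 f2" "hamiltonian0_data g g1 g2"
    and e: "F = abs_l2_halfline f" "F' = - abs_l2_halfline f2" "G = abs_l2_halfline g" "G' = - abs_l2_halfline g2"
    unfolding hamiltonian0_eq by blast
  have dg: "hamiltonian0_data (\<lambda>t. cnj (g t)) (\<lambda>t. cnj (g1 t)) (\<lambda>t. cnj (g2 t))"
    by (rule hamiltonian0_data_cnj[OF d(2)])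
  have w: "W22_on U f f1 f2" "W22_on U g g1 g2" "W22_on U (\<lambda>t. cnj (g t)) (\<lambda>t. cnj (g1 t)) (\<lambda>t. cnj (g2 t))"
    "interface_conditions f f1" "interface_conditions (\<lambda>t. cnj (g t)) (\<lambda>t. cnj (g1 t))"
    using d dg by (simp_all add: hamiltonian0_data_def)
  note sq = W22_on_U_square_integrable[OF w(1)] W22_on_U_square_integrable[OF w(2)]
  obtain R where R: "\<And>t. t \<in> U \<Longrightarrow> R < t \<Longrightarrow> f t = 0"
    using hamiltonian0_data_support[OF d(1)] by metis
  have "integral\<^sup>L (lebesgue_on {0<..}) (\<lambda>t. f2 t * cnj (g t)) = integral\<^sup>L (lebesgue_on {0<..}) (\<lambda>t. f t * cnj (g2 t))"
    by (rule Green_formula[OF interval_W22[OF w(1)] w(4) interval_W22[OF w(3)] w(5) sq(1,2)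
          W22_on_U_square_integrable[OF w(3)] R])
  then show "cinner_l2 F' G = cinner_l2 F G'"
    unfolding e cinner_l2_uminus_left cinner_l2_uminus_right
      cinner_abs_l2[OF sq(2) sq(3)] cinner_abs_l2[OF sq(1) sq(4)] by simp
qed

end

section \<open>Piecewise trigonometric solutions\<close>

text \<open>\<open>fcos z\<close> and \<open>fsin z\<close> are the solutions of \<open>- f'' = z f\<close> with initial values
  \<open>(1, 0)\<close> and \<open>(0, 1)\<close> at the origin.\<close>

definition fcos :: "complex \<Rightarrow> real \<Rightarrow> complex" where
  "fcos z t = cos (csqrt z * of_real t)"

definition fsin :: "complex \<Rightarrow> real \<Rightarrow> complex" where
  "fsin z t = sin (csqrt z * of_real t) / csqrt z"

lemma fcos_fsin_0: "fcos z 0 = 1" "fsin z 0 = 0"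
  by (simp_all add: fcos_def fsin_def)

lemma csqrt_square: "csqrt z * csqrt z = z"
  using power2_csqrt[of z] by (simp add: power2_eq_square)

lemma fcos_derivative: "(fcos z has_vector_derivative - z * fsin z t) (at t)"
proof -
  have "((\<lambda>w. cos (csqrt z * w)) has_field_derivative - sin (csqrt z * of_real t) * csqrt z) (at (of_real t))"
    by (auto intro!: derivative_eq_intros)
  from has_field_derivative_at_within[OF this] have "(fcos z has_vector_derivative - sin (csqrt z * of_real t) * csqrt z) (at t)"
    unfolding fcos_def[abs_def] by (rule has_vector_derivative_real_field)
  moreover have "- sin (csqrt z * of_real t) * csqrt z = - z * fsin z t"
  proof (cases "z = 0")
    case False
    have "z * fsin z t = csqrt z * csqrt z * (sin (csqrt z * of_real t) / csqrt z)"
      unfolding csqrt_square fsin_def ..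
    also have "\<dots> = sin (csqrt z * of_real t) * csqrt z"
      using False by simp
    finally show ?thesis by simp
  qed simp
  ultimately show ?thesis by simp
qed

lemma fsin_derivative:
  assumes "z \<noteq> 0"
  shows "(fsin z has_vector_derivative fcos z t) (at t)"
proof -
  have "((\<lambda>w. sin (csqrt z * w) / csqrt z) has_field_derivative cos (csqrt z * of_real t)) (at (of_real t))"
    using assms by (auto intro!: derivative_eq_intros)
  from has_field_derivative_at_within[OF this] show ?thesis
    unfolding fsin_def[abs_def] fcos_def by (rule has_vector_derivative_real_field)
qed

lemma fcos_fsin_pythagoras:
  assumes "z \<noteq> 0"
  shows "fcos z t * fcos z t + z * (fsin z t * fsin z t) = 1"
proof -
  have "z * (fsin z t * fsin z t) = (sin (csqrt z * of_real t))\<^sup>2"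
    using assms csqrt_square[of z] by (simp add: fsin_def power2_eq_square field_simps)
  then show ?thesis
    using sin_cos_squared_add[of "csqrt z * of_real t"] by (simp add: fcos_def power2_eq_square)
qed

text \<open>The interval lengths enter the recurrence through \<open>fsin\<close> and \<open>fcos\<close>; these errors are
  summable because the lengths are square summable.\<close>

lemma free_solution_estimates:
  assumes z: "z \<noteq> 0"
  obtains C where "C > 0" "\<And>t. 0 \<le> t \<Longrightarrow> t \<le> 1 \<Longrightarrow> cmod (fsin z t - of_real t) \<le> C * t ^ 3"
    "\<And>t. 0 \<le> t \<Longrightarrow> t \<le> 1 \<Longrightarrow> cmod (fcos z t - 1) \<le> C * t\<^sup>2"
proof -
  define k where "k = csqrt z"
  have k: "k \<noteq> 0" using z by (simp add: k_def)
  define C where "C = exp (cmod k) * (cmod k)\<^sup>2"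
  have C: "C > 0" using k by (simp add: C_def)
  have ex: "exp \<bar>Im (k * of_real t)\<bar> \<le> exp (cmod k)" if "0 \<le> t" "t \<le> 1" for t
  proof -
    have "\<bar>Im (k * of_real t)\<bar> \<le> cmod k * t"
      using abs_Im_le_cmod[of "k * of_real t"] that by (simp add: norm_mult)
    also have "\<dots> \<le> cmod k" using that by (simp add: mult_left_le)
    finally show ?thesis by simp
  qed
  show thesis
  proof
    show "C > 0" by (rule C)
    fix t :: real assume t: "0 \<le> t" "t \<le> 1"
    have s2: "(\<Sum>j\<le>2. complex_of_real (sin_coeff j) * (k * of_real t) ^ j) = k * of_real t"
      by (simp add: numeral_2_eq_2 sin_coeff_def)
    have s1: "(\<Sum>j\<le>1. complex_of_real (cos_coeff j) * (k * of_real t) ^ j) = 1"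
      by (simp add: cos_coeff_def)
    have "cmod (sin (k * of_real t) - k * of_real t) \<le> exp \<bar>Im (k * of_real t)\<bar> * cmod (k * of_real t) ^ 3 / fact 2"
      using Taylor_sin[of "k * of_real t" 2] unfolding s2 by (simp add: numeral_3_eq_3 numeral_2_eq_2)
    also have "\<dots> \<le> exp \<bar>Im (k * of_real t)\<bar> * cmod (k * of_real t) ^ 3"
      by (simp add: fact_2)
    also have "\<dots> \<le> exp (cmod k) * cmod (k * of_real t) ^ 3"
      using ex[OF t] by (intro mult_right_mono) auto
    also have "\<dots> = (C * t ^ 3) * cmod k"
      using t by (simp add: C_def norm_mult power_mult_distrib power2_eq_square power3_eq_cube)
    finally have *: "cmod (sin (k * of_real t) - k * of_real t) \<le> (C * t ^ 3) * cmod k" .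
    have "fsin z t - of_real t = (sin (k * of_real t) - k * of_real t) / k"
      using k by (simp add: fsin_def k_def[symmetric] diff_divide_distrib)
    then have "cmod (fsin z t - of_real t) = cmod (sin (k * of_real t) - k * of_real t) / cmod k"
      by (simp add: norm_divide)
    then show "cmod (fsin z t - of_real t) \<le> C * t ^ 3"
      using * k by (simp add: pos_divide_le_eq)
    have "cmod (cos (k * of_real t) - 1) \<le> exp \<bar>Im (k * of_real t)\<bar> * cmod (k * of_real t) ^ 2"
      using Taylor_cos[of "k * of_real t" 1] unfolding s1 by (simp add: numeral_2_eq_2)
    also have "\<dots> \<le> exp (cmod k) * cmod (k * of_real t) ^ 2"
      using ex[OF t] by (intro mult_right_mono) auto
    also have "\<dots> = C * t\<^sup>2"
      using t by (simp add: C_def norm_mult power_mult_distrib)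
    finally show "cmod (fcos z t - 1) \<le> C * t\<^sup>2"
      by (simp add: fcos_def k_def)
  qed
qed

context point_interactions
begin

text \<open>The pair \<open>(f (x n), f' (x n+))\<close> of a solution, transported from one interaction point to the
  next by the transfer matrix of the free equation followed by the jump of the derivative.\<close>

primrec state :: "complex \<Rightarrow> complex \<times> complex \<Rightarrow> nat \<Rightarrow> complex \<times> complex" where
  "state z s 0 = s"
| "state z s (Suc n) =
    (let d = x (Suc n) - x n; y = fcos z d * fst (state z s n) + fsin z d * snd (state z s n)
     in (y, - z * fsin z d * fst (state z s n) + fcos z d * snd (state z s n) + of_real (\<alpha> (Suc n)) * y))"

text \<open>The solution on the \<open>n\<close>-th interval, extended to the whole line.\<close>

definition arc :: "complex \<Rightarrow> complex \<times> complex \<Rightarrow> nat \<Rightarrow> real \<Rightarrow> complex" where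
  "arc z s n t = fcos z (t - x n) * fst (state z s n) + fsin z (t - x n) * snd (state z s n)"

definition arc' :: "complex \<Rightarrow> complex \<times> complex \<Rightarrow> nat \<Rightarrow> real \<Rightarrow> complex" where
  "arc' z s n t = - z * fsin z (t - x n) * fst (state z s n) + fcos z (t - x n) * snd (state z s n)"

definition sol :: "complex \<Rightarrow> complex \<times> complex \<Rightarrow> real \<Rightarrow> complex" where
  "sol z s t = arc z s (piece t) t"

definition sol' :: "complex \<Rightarrow> complex \<times> complex \<Rightarrow> real \<Rightarrow> complex" where
  "sol' z s t = arc' z s (piece t) t"

lemma state_Suc:
  "fst (state z s (Suc n)) = arc z s n (x (Suc n))"
  "snd (state z s (Suc n)) = arc' z s n (x (Suc n)) + of_real (\<alpha> (Suc n)) * fst (state z s (Suc n))"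
  by (simp_all add: arc_def arc'_def Let_def)

lemma arc_start: "arc z s n (x n) = fst (state z s n)" "arc' z s n (x n) = snd (state z s n)"
  by (simp_all add: arc_def arc'_def fcos_fsin_0)

lemma arc_derivative:
  assumes z: "z \<noteq> 0"
  shows "(arc z s n has_vector_derivative arc' z s n t) (at t)"
    and "(arc' z s n has_vector_derivative - z * arc z s n t) (at t)"
proof -
  have sh: "((\<lambda>t. f (t - x n)) has_vector_derivative f') (at t)"
    if "(f has_vector_derivative f') (at (t - x n))" for f :: "real \<Rightarrow> complex" and f'
  proof -
    have "((\<lambda>t. t - x n) has_vector_derivative 1) (at t)"
      by (auto intro!: derivative_eq_intros simp flip: has_real_derivative_iff_has_vector_derivative)
    from vector_diff_chain_at[OF this that] show ?thesis by (simp add: o_def)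
  qed
  note C = sh[OF fcos_derivative] and S = sh[OF fsin_derivative[OF z]]
  show "(arc z s n has_vector_derivative arc' z s n t) (at t)"
    unfolding arc_def[abs_def] arc'_def
    by (intro has_vector_derivative_add has_vector_derivative_mult_left C S)
  have "((\<lambda>t. - z * fsin z (t - x n) * fst (state z s n) + fcos z (t - x n) * snd (state z s n)) has_vector_derivative
      - z * fcos z (t - x n) * fst (state z s n) + (- z * fsin z (t - x n)) * snd (state z s n)) (at t)"
    by (intro has_vector_derivative_add has_vector_derivative_mult_left has_vector_derivative_mult_right C S)
  then show "(arc' z s n has_vector_derivative - z * arc z s n t) (at t)"
    unfolding arc_def arc'_def[abs_def] by (simp add: algebra_simps)
qed

lemma arc_continuous:
  assumes "z \<noteq> 0"
  shows "isCont (arc z s n) t" "isCont (arc' z s n) t"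
  using arc_derivative[OF assms] has_vector_derivative_continuous by blast+

lemma sol_eq_arc:
  assumes "x n \<le> t" "t < x (Suc n)"
  shows "sol z s t = arc z s n t" "sol' z s t = arc' z s n t"
  using piece_eqI[OF assms] by (simp_all add: sol_def sol'_def)

lemma sol_derivative:
  assumes z: "z \<noteq> 0" and t: "t \<in> U"
  shows "(sol z s has_vector_derivative sol' z s t) (at t)"
    and "(sol' z s has_vector_derivative - z * sol z s t) (at t)"
proof -
  obtain n where n: "t \<in> {x n<..<x (Suc n)}" using t by (auto simp: U_eq)
  then have e: "sol z s t = arc z s n t" "sol' z s t = arc' z s n t"
    using sol_eq_arc[of n t] by simp_all
  show "(sol z s has_vector_derivative sol' z s t) (at t)"
    unfolding e
    by (rule has_vector_derivative_transform_within_open[OF arc_derivative(1)[OF z] _ n])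
      (simp, rule sol_eq_arc(1)[symmetric], simp_all)
  show "(sol' z s has_vector_derivative - z * sol z s t) (at t)"
    unfolding e
    by (rule has_vector_derivative_transform_within_open[OF arc_derivative(2)[OF z] _ n])
      (simp, rule sol_eq_arc(2)[symmetric], simp_all)
qed

lemma sol_limits:
  assumes z: "z \<noteq> 0"
  shows "(sol z s \<longlongrightarrow> fst (state z s n)) (at_right (x n))"
    and "(sol' z s \<longlongrightarrow> snd (state z s n)) (at_right (x n))"
    and "n \<ge> 1 \<Longrightarrow> (sol z s \<longlongrightarrow> fst (state z s n)) (at_left (x n))"
    and "n \<ge> 1 \<Longrightarrow> (sol' z s \<longlongrightarrow> snd (state z s n) - of_real (\<alpha> n) * fst (state z s n)) (at_left (x n))"
proof -
  have lim: "(arc z s k \<longlongrightarrow> arc z s k t) (at t within S)" "(arc' z s k \<longlongrightarrow> arc' z s k t) (at t within S)" for k t S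
    using arc_continuous[OF z] by (simp_all add: isCont_def tendsto_within_subset[OF _ subset_UNIV])
  have r: "\<forall>\<^sub>F t in at_right (x n). x n < t \<and> t < x (Suc n)"
    unfolding eventually_at_right_field using x_less[of n] by auto
  show "(sol z s \<longlongrightarrow> fst (state z s n)) (at_right (x n))"
    using lim(1)[of n "x n" "{x n<..}"] unfolding arc_start
    by (rule Lim_transform_eventually) (rule eventually_mono[OF r], rule sol_eq_arc(1)[symmetric], simp_all)
  show "(sol' z s \<longlongrightarrow> snd (state z s n)) (at_right (x n))"
    using lim(2)[of n "x n" "{x n<..}"] unfolding arc_start
    by (rule Lim_transform_eventually) (rule eventually_mono[OF r], rule sol_eq_arc(2)[symmetric], simp_all)
  assume "n \<ge> 1"
  then obtain k where k: "n = Suc k" by (cases n) auto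
  have l: "\<forall>\<^sub>F t in at_left (x n). x k < t \<and> t < x (Suc k)"
    unfolding eventually_at_left_field k using x_less[of k] by auto
  have st: "fst (state z s n) = arc z s k (x n)" "snd (state z s n) - of_real (\<alpha> n) * fst (state z s n) = arc' z s k (x n)"
    unfolding k state_Suc by simp_all
  show "(sol z s \<longlongrightarrow> fst (state z s n)) (at_left (x n))"
    unfolding st(1) using lim(1)[of k "x n" "{..<x n}"]
    by (rule Lim_transform_eventually) (rule eventually_mono[OF l], rule sol_eq_arc(1)[symmetric], simp_all)
  show "(sol' z s \<longlongrightarrow> snd (state z s n) - of_real (\<alpha> n) * fst (state z s n)) (at_left (x n))"
    unfolding st(2) using lim(2)[of k "x n" "{..<x n}"]
    by (rule Lim_transform_eventually) (rule eventually_mono[OF l], rule sol_eq_arc(2)[symmetric], simp_all)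
qed

lemma sol_interface_conditions:
  assumes z: "z \<noteq> 0" and s: "snd s = 0"
  shows "interface_conditions (sol z s) (sol' z s)"
  unfolding interface_conditions_def
proof (intro conjI allI impI)
  show "(sol' z s \<longlongrightarrow> 0) (at_right 0)"
    using sol_limits(2)[OF z, of s 0] x_0 s by simp
  fix n :: nat assume n: "n \<ge> 1"
  have "snd (state z s n) - (snd (state z s n) - of_real (\<alpha> n) * fst (state z s n)) = of_real (\<alpha> n) * fst (state z s n)"
    by simp
  with sol_limits(1,2)[OF z, of s n] sol_limits(3,4)[OF z n, of s]
  show "\<exists>v p m. (sol z s \<longlongrightarrow> v) (at_right (x n)) \<and> (sol z s \<longlongrightarrow> v) (at_left (x n)) \<and>
      (sol' z s \<longlongrightarrow> p) (at_right (x n)) \<and> (sol' z s \<longlongrightarrow> m) (at_left (x n)) \<and> p - m = of_real (\<alpha> n) * v"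
    by blast
qed

lemma sol_bounded:
  assumes z: "z \<noteq> 0"
  obtains B where "\<And>t. 0 \<le> t \<Longrightarrow> t \<le> T \<Longrightarrow> cmod (sol z s t) \<le> B \<and> cmod (sol' z s t) \<le> B"
proof -
  have "\<exists>B. \<forall>t\<in>{x n..x (Suc n)}. cmod (arc z s n t) \<le> B \<and> cmod (arc' z s n t) \<le> B" for n
  proof -
    have c: "compact (arc z s n ` {x n..x (Suc n)})" "compact (arc' z s n ` {x n..x (Suc n)})"
      by (intro compact_continuous_image continuous_at_imp_continuous_on ballI arc_continuous z compact_Icc)+
    obtain B1 B2 where "\<forall>w\<in>arc z s n ` {x n..x (Suc n)}. cmod w \<le> B1" "\<forall>w\<in>arc' z s n ` {x n..x (Suc n)}. cmod w \<le> B2"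
      using compact_imp_bounded[OF c(1)] compact_imp_bounded[OF c(2)] unfolding bounded_iff by blast
    then show ?thesis by (intro exI[of _ "max B1 B2"]) (auto simp: le_max_iff_disj)
  qed
  then obtain B where B: "\<And>n t. t \<in> {x n..x (Suc n)} \<Longrightarrow> cmod (arc z s n t) \<le> B n \<and> cmod (arc' z s n t) \<le> B n"
    by metis
  show thesis
  proof
    fix t assume t: "0 \<le> t" "t \<le> T"
    note b = piece_bounds[OF t(1)] piece_bounds[of T]
    have "x (piece t) < x (Suc (piece T))" using b t by linarith
    then have "piece t \<in> {..piece T}" using strict_mono_less[OF x_mono] by simp
    then have "\<bar>B (piece t)\<bar> \<le> (\<Sum>n\<le>piece T. \<bar>B n\<bar>)"
      by (intro member_le_sum[of _ _ "\<lambda>n. \<bar>B n\<bar>"]) auto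
    moreover have "t \<in> {x (piece t)..x (Suc (piece t))}" using b by simp
    ultimately show "cmod (sol z s t) \<le> (\<Sum>n\<le>piece T. \<bar>B n\<bar>) \<and> cmod (sol' z s t) \<le> (\<Sum>n\<le>piece T. \<bar>B n\<bar>)"
      using B[of t "piece t"] unfolding sol_def sol'_def by linarith
  qed
qed

text \<open>The transfer matrix of the free equation has determinant \<open>1\<close> by Pythagoras, and the jump of the
  derivative is a shear.\<close>

lemma Wronskian:
  assumes z: "z \<noteq> 0" and t: "0 \<le> t"
  shows "sol z (1, 0) t * sol' z (0, 1) t - sol' z (1, 0) t * sol z (0, 1) t = 1"
proof -
  have arcs: "arc z s n t * arc' z s' n t - arc' z s n t * arc z s' n t =
      fst (state z s n) * snd (state z s' n) - snd (state z s n) * fst (state z s' n)" for s s' n t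
  proof -
    have "arc z s n t * arc' z s' n t - arc' z s n t * arc z s' n t =
      (fst (state z s n) * snd (state z s' n) - snd (state z s n) * fst (state z s' n)) *
      (fcos z (t - x n) * fcos z (t - x n) + z * (fsin z (t - x n) * fsin z (t - x n)))"
      unfolding arc_def arc'_def by (simp add: algebra_simps)
    then show ?thesis by (simp only: fcos_fsin_pythagoras[OF z] mult_1_right)
  qed
  have states: "fst (state z s n) * snd (state z s' n) - snd (state z s n) * fst (state z s' n) =
      fst s * snd s' - snd s * fst s'" for s s' n
  proof (induction n)
    case (Suc n)
    have "fst (state z s (Suc n)) * snd (state z s' (Suc n)) - snd (state z s (Suc n)) * fst (state z s' (Suc n)) =
        arc z s n (x (Suc n)) * arc' z s' n (x (Suc n)) - arc' z s n (x (Suc n)) * arc z s' n (x (Suc n))"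
      unfolding state_Suc by (simp add: algebra_simps)
    then show ?case using arcs Suc by simp
  qed simp
  show ?thesis
    unfolding sol_def sol'_def arcs states by simp
qed

lemma sol_W22_interval:
  assumes z: "z \<noteq> 0"
  shows "W22_on {x n<..<x (Suc n)} (sol z s) (sol' z s) (\<lambda>t. - z * sol z s t)"
proof (rule W22_on_classical)
  let ?I = "{x n<..<x (Suc n)}"
  have U: "t \<in> U" if "t \<in> ?I" for t using that interval_subset_U by blast
  show d: "(sol z s has_vector_derivative sol' z s t) (at t)"
    "(sol' z s has_vector_derivative - z * sol z s t) (at t)" if "t \<in> ?I" for t
    by (rule sol_derivative[OF z U[OF that]])+
  have c: "continuous_on ?I (sol z s)" "continuous_on ?I (sol' z s)"
    using d by (meson continuous_at_imp_continuous_on has_vector_derivative_continuous)+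
  then show "continuous_on ?I (\<lambda>t. - z * sol z s t)"
    by (intro continuous_intros)
  obtain B where B: "\<And>t. 0 \<le> t \<Longrightarrow> t \<le> x (Suc n) \<Longrightarrow> cmod (sol z s t) \<le> B \<and> cmod (sol' z s t) \<le> B"
    using sol_bounded[OF z, of "x (Suc n)" s] by metis
  have b: "cmod (sol z s t) \<le> B" "cmod (sol' z s t) \<le> B" if "t \<in> ?I" for t
    using B[of t] that x_nonneg[of n] by simp_all
  have e: False if "t \<in> ?I" "x (Suc n) < \<bar>t\<bar>" for t
    using that x_nonneg[of n] by simp
  have m: "sol z s \<in> borel_measurable (lebesgue_on ?I)" "sol' z s \<in> borel_measurable (lebesgue_on ?I)"
    by (rule continuous_imp_measurable_on_sets_lebesgue, rule c, simp)+
  show sq: "square_integrable_on ?I (sol z s)"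
    by (rule square_integrable_on_bounded_support[OF _ m(1) b(1), of "x (Suc n)"]) (use e in auto)
  show "square_integrable_on ?I (sol' z s)"
    by (rule square_integrable_on_bounded_support[OF _ m(2) b(2), of "x (Suc n)"]) (use e in auto)
  show "square_integrable_on ?I (\<lambda>t. - z * sol z s t)"
    using sq by (rule square_integrable_on_scale)
qed simp


section \<open>The deficiency spaces\<close>

lemma eigenspace_hamiltonian:
  "eigenspace_graph (adjoint_graph (hamiltonian x \<alpha>)) z =
    {g. \<forall>f f1 f2. hamiltonian0_data f f1 f2 \<longrightarrow>
        - cinner_l2 (abs_l2_halfline f2) g = cnj z * cinner_l2 (abs_l2_halfline f) g}"
  unfolding eigenspace_graph_def hamiltonian_def adjoint_graph_closure
  unfolding adjoint_graph_def hamiltonian0_eq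
  by (fastforce simp: cinner_l2_uminus_left cinner_l2_scaleC_right)

text \<open>Green's formula with the conjugate of the solution as second function; the bounded support of \<open>f\<close>
  disposes of the boundary term at infinity.\<close>

lemma sol_in_eigenspace:
  assumes z: "z \<noteq> 0" and s: "snd s = 0" and sq: "square_integrable_on {0<..} (sol z s)"
  shows "abs_l2_halfline (sol z s) \<in> eigenspace_graph (adjoint_graph (hamiltonian x \<alpha>)) z"
  unfolding eigenspace_hamiltonian
proof (intro CollectI allI impI)
  fix f f1 f2 assume d: "hamiltonian0_data f f1 f2"
  then have w: "W22_on U f f1 f2" "interface_conditions f f1"
    by (simp_all add: hamiltonian0_data_def)
  note sqf = W22_on_U_square_integrable[OF w(1)]
  obtain R where R: "\<And>t. t \<in> U \<Longrightarrow> R < t \<Longrightarrow> f t = 0"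
    using hamiltonian0_data_support[OF d] by metis
  have sq2: "square_integrable_on {0<..} (\<lambda>t. - z * sol z s t)"
    using sq by (rule square_integrable_on_scale)
  have "integral\<^sup>L (lebesgue_on {0<..}) (\<lambda>t. f2 t * cnj (sol z s t)) =
      integral\<^sup>L (lebesgue_on {0<..}) (\<lambda>t. f t * cnj (- z * sol z s t))"
    by (rule Green_formula[OF interval_W22[OF w(1)] w(2) W22_on_cnj[OF sol_W22_interval[OF z]]
          interface_conditions_cnj[OF sol_interface_conditions[OF z s]] sqf
          square_integrable_on_cnj[OF sq] square_integrable_on_cnj[OF sq2] R])
  also have "\<dots> = integral\<^sup>L (lebesgue_on {0<..}) (\<lambda>t. - cnj z * (f t * cnj (sol z s t)))"
    by (rule Bochner_Integration.integral_cong) simp_all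
  also have "\<dots> = - cnj z * integral\<^sup>L (lebesgue_on {0<..}) (\<lambda>t. f t * cnj (sol z s t))"
    by (rule Bochner_Integration.integral_mult_right_zero)
  finally show "- cinner_l2 (abs_l2_halfline f2) (abs_l2_halfline (sol z s)) =
      cnj z * cinner_l2 (abs_l2_halfline f) (abs_l2_halfline (sol z s))"
    unfolding cinner_abs_l2[OF sqf(1) sq] cinner_abs_l2[OF sqf(2) sq] by simp
qed

text \<open>Variation of parameters, started from \<open>0\<close> at the origin. The choice of the constant in
  the coefficient of the first solution and the orthogonality of \<open>k\<close> to it make the result vanish
  beyond the support of \<open>k\<close>. Near the interaction points both coefficients are constant, so the
  interface conditions are inherited.\<close>

lemma inhomogeneous_equation_solvable:
  assumes z: "z \<noteq> 0" and k: "C2_compact_support U k k1 k2"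
    and orth: "integral\<^sup>L (lebesgue_on {0<..}) (\<lambda>t. k t * sol z (1, 0) t) = 0"
  obtains f f1 where "hamiltonian0_data f f1 (\<lambda>t. k t - z * f t)"
proof -
  define \<phi> where "\<phi> = sol z (1, 0)"
  define \<phi>' where "\<phi>' = sol' z (1, 0)"
  define \<theta> where "\<theta> = sol z (0, 1)"
  define \<theta>' where "\<theta>' = sol' z (0, 1)"
  have dk: "(k has_vector_derivative k1 t) (at t)" for t
    using k by (simp add: C2_compact_support_def)
  have ck: "continuous_on UNIV k1"
    using k unfolding C2_compact_support_def
    by (meson continuous_at_imp_continuous_on has_vector_derivative_continuous)
  have ck0: "continuous_on UNIV k"
    using dk by (meson continuous_at_imp_continuous_on has_vector_derivative_continuous)
  obtain K where K: "compact K" "K \<subseteq> U" "\<And>t. t \<notin> K \<Longrightarrow> k t = 0"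
    using C2_compact_support_zero[OF k] by metis
  have supp: "\<forall>t. t \<notin> K \<longrightarrow> k t = 0" using K(3) by blast
  obtain T0 where T0: "\<And>t. t \<in> K \<Longrightarrow> \<bar>t\<bar> \<le> T0"
    using compact_imp_bounded[OF K(1)] by (auto simp: bounded_iff)
  define T where "T = max T0 0"
  have T: "0 \<le> T" "\<And>t. t \<in> K \<Longrightarrow> t \<le> T" using T0 by (force simp: T_def)+
  define e where "e s t = (if t \<in> U then k t * sol z s t else 0)" for s t
  have ce: "continuous_on UNIV (e s)" for s
  proof -
    have d: "\<forall>t\<in>U. (sol z s has_vector_derivative sol' z s t) (at t)"
      using sol_derivative(1)[OF z] by blast
    have "continuous_on U (sol' z s)"
      using sol_derivative(2)[OF z] by (meson continuous_at_imp_continuous_on has_vector_derivative_continuous)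
    then show ?thesis
      unfolding e_def[abs_def] by (rule extend_by_zero_continuous(1)[OF open_U K(1,2) dk ck supp d])
  qed
  have eK: "e s t = 0" if "t \<notin> K" for s t
    using K(3)[OF that] by (simp add: e_def)
  have eU: "e s t = k t * sol z s t" if "t \<in> U" for s t
    using that by (simp add: e_def)
  \<comment> \<open>The integrand vanishes on \<open>{-1..0}\<close>; starting at \<open>-1\<close> makes \<open>J\<close> differentiable at the origin too.\<close>
  define J where "J s t = integral {-1..t} (e s)" for s t
  have dJ: "(J s has_vector_derivative e s t) (at t)" if "- 1 < t" for s t
  proof -
    have "((\<lambda>u. integral {-1..u} (e s)) has_vector_derivative e s t) (at t within {-1..t + 1})"
      by (rule integral_has_vector_derivative) (use that continuous_on_subset[OF ce] in auto)
    then show ?thesis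
      unfolding J_def[abs_def] using that by (simp add: at_within_Icc_at)
  qed
  have J0: "J s 0 = 0" for s
  proof -
    have "e s t = 0" if "t \<in> {-1..0}" for t
      using that K(2) U_subset by (intro eK) auto
    then have "integral {-1..0} (e s) = integral {-1..0} (\<lambda>t :: real. 0)"
      by (rule Henstock_Kurzweil_Integration.integral_cong)
    then show ?thesis by (simp add: J_def)
  qed
  have JT: "J s t = J s T" if "T \<le> t" for s t
  proof -
    have "integral {-1..T} (e s) + integral {T..t} (e s) = integral {-1..t} (e s)"
      by (rule Henstock_Kurzweil_Integration.integral_combine)
        (use T that in \<open>auto intro!: integrable_continuous_interval continuous_on_subset[OF ce]\<close>)
    moreover have "integral {T..t} (e s) = integral {T..t} (\<lambda>t. 0)"
    proof (rule integral_spike[of "{T}"])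
      show "0 = e s u" if "u \<in> {T..t} - {T}" for u
        using that T(2)[of u] eK[of u s] by fastforce
    qed simp
    ultimately show ?thesis by (simp add: J_def)
  qed
  have JTint: "J s T = integral\<^sup>L (lebesgue_on {0<..}) (\<lambda>t. k t * sol z s t)" for s
  proof -
    have i: "integrable lebesgue (e s)"
      by (rule integrable_continuous_compact_support[OF ce K(1)]) (rule eK)
    have "(e s has_integral J s T) {-1..T}"
      unfolding J_def using continuous_on_subset[OF ce]
      by (intro integrable_integral integrable_continuous_interval) auto
    then have "(e s has_integral J s T) UNIV"
    proof (rule has_integral_on_superset)
      fix t assume "t \<notin> {-1..T}"
      then show "e s t = 0" using T(2)[of t] K(2) U_subset by (intro eK) force
    qed simp
    then have "J s T = integral\<^sup>L lebesgue (e s)"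
      using has_integral_integral_lebesgue[OF i] has_integral_unique by blast
    also have "\<dots> = integral\<^sup>L (lebesgue_on U) (e s)"
    proof -
      have "e s t = 0" if "t \<in> UNIV - U" for t
        using that K(2) by (intro eK) blast
      then show ?thesis
        using integral_lebesgue_on_subset_eq[of U UNIV "e s"] U_sets by (simp add: lebesgue_on_UNIV_eq)
    qed
    also have "\<dots> = integral\<^sup>L (lebesgue_on U) (\<lambda>t. k t * sol z s t)"
      by (rule Bochner_Integration.integral_cong) (simp_all add: eU)
    finally show ?thesis unfolding integral_U .
  qed
  define A where "A = J (1, 0)"
  define E where "E = J (0, 1)"
  define C where "C = E T"
  define f where "f t = \<theta> t * A t + \<phi> t * (C - E t)" for t
  define f1 where "f1 t = \<theta>' t * A t + \<phi>' t * (C - E t)" for t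
  have dA: "(A has_vector_derivative k t * \<phi> t) (at t)" and dE: "(E has_vector_derivative k t * \<theta> t) (at t)" if "t \<in> U" for t
    using dJ[of t] that U_subset eU[OF that] by (force simp: A_def E_def \<phi>_def \<theta>_def)+
  have dsol: "(\<phi> has_vector_derivative \<phi>' t) (at t)" "(\<phi>' has_vector_derivative - z * \<phi> t) (at t)"
    "(\<theta> has_vector_derivative \<theta>' t) (at t)" "(\<theta>' has_vector_derivative - z * \<theta> t) (at t)" if "t \<in> U" for t
    unfolding \<phi>_def \<phi>'_def \<theta>_def \<theta>'_def using sol_derivative[OF z that] by blast+
  have dCE: "((\<lambda>t. C - E t) has_vector_derivative 0 - k t * \<theta> t) (at t)" if "t \<in> U" for t
    by (rule has_vector_derivative_diff[OF has_vector_derivative_const dE[OF that]])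
  have df: "(f has_vector_derivative f1 t) (at t)" if "t \<in> U" for t
  proof -
    have "(f has_vector_derivative (\<theta> t * (k t * \<phi> t) + \<theta>' t * A t) + (\<phi> t * (0 - k t * \<theta> t) + \<phi>' t * (C - E t))) (at t)"
      unfolding f_def[abs_def]
      by (intro has_vector_derivative_add has_vector_derivative_mult dsol dA dCE that)
    moreover have "(\<theta> t * (k t * \<phi> t) + \<theta>' t * A t) + (\<phi> t * (0 - k t * \<theta> t) + \<phi>' t * (C - E t)) = f1 t"
      unfolding f1_def by (simp add: algebra_simps)
    ultimately show ?thesis by simp
  qed
  have df1: "(f1 has_vector_derivative k t - z * f t) (at t)" if "t \<in> U" for t
  proof -
    have "(f1 has_vector_derivative (\<theta>' t * (k t * \<phi> t) + - z * \<theta> t * A t) + (\<phi>' t * (0 - k t * \<theta> t) + - z * \<phi> t * (C - E t))) (at t)"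
      unfolding f1_def[abs_def]
      by (intro has_vector_derivative_add has_vector_derivative_mult dsol dA dCE that)
    moreover have "(\<theta>' t * (k t * \<phi> t) + - z * \<theta> t * A t) + (\<phi>' t * (0 - k t * \<theta> t) + - z * \<phi> t * (C - E t))
        = k t * (\<phi> t * \<theta>' t - \<phi>' t * \<theta> t) - z * f t"
      unfolding f_def by (simp add: algebra_simps)
    moreover have "\<phi> t * \<theta>' t - \<phi>' t * \<theta> t = 1"
      unfolding \<phi>_def \<phi>'_def \<theta>_def \<theta>'_def using Wronskian[OF z] that U_subset by force
    ultimately show ?thesis by simp
  qed
  have AT: "A t = 0" "E t = C" if "T \<le> t" for t
  proof -
    show "A t = 0" using JT[OF that] JTint[of "(1, 0)"] orth by (simp add: A_def)
    show "E t = C" unfolding C_def E_def by (rule JT[OF that])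
  qed
  have supp_f: "f t = 0" "f1 t = 0" if "T < t" for t
    using AT[of t] that by (simp_all add: f_def f1_def)
  have cf: "continuous_on U f" "continuous_on U f1"
    using df df1 by (meson continuous_at_imp_continuous_on has_vector_derivative_continuous)+
  have contAE: "isCont A t" "isCont E t" if "- 1 < t" for t
    unfolding A_def E_def using dJ[OF that] has_vector_derivative_continuous by blast+
  have sq: "square_integrable_on U f" "square_integrable_on U f1"
  proof -
    obtain B1 where B1: "\<And>t. 0 \<le> t \<Longrightarrow> t \<le> T \<Longrightarrow> cmod (\<phi> t) \<le> B1 \<and> cmod (\<phi>' t) \<le> B1"
      using sol_bounded[OF z, of T "(1, 0)"] unfolding \<phi>_def \<phi>'_def by metis
    obtain B2 where B2: "\<And>t. 0 \<le> t \<Longrightarrow> t \<le> T \<Longrightarrow> cmod (\<theta> t) \<le> B2 \<and> cmod (\<theta>' t) \<le> B2"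
      using sol_bounded[OF z, of T "(0, 1)"] unfolding \<theta>_def \<theta>'_def by metis
    have c: "compact (A ` {0..T})" "compact ((\<lambda>t. C - E t) ` {0..T})"
      by (intro compact_continuous_image continuous_at_imp_continuous_on ballI contAE compact_Icc continuous_intros; simp)+
    obtain B3 B4 where "\<forall>w\<in>A ` {0..T}. cmod w \<le> B3" "\<forall>w\<in>(\<lambda>t. C - E t) ` {0..T}. cmod w \<le> B4"
      using compact_imp_bounded[OF c(1)] compact_imp_bounded[OF c(2)] unfolding bounded_iff by blast
    then have B34: "cmod (A t) \<le> B3" "cmod (C - E t) \<le> B4" if "0 \<le> t" "t \<le> T" for t
      using that by auto
    have bd: "cmod (f t) \<le> \<bar>B2\<bar> * \<bar>B3\<bar> + \<bar>B1\<bar> * \<bar>B4\<bar> \<and> cmod (f1 t) \<le> \<bar>B2\<bar> * \<bar>B3\<bar> + \<bar>B1\<bar> * \<bar>B4\<bar>" if "t \<in> U" for t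
    proof (cases "t \<le> T")
      case True
      have t: "0 \<le> t" "t \<le> T" using that U_subset True by auto
      have m: "cmod (a * b + c * d) \<le> \<bar>B2\<bar> * \<bar>B3\<bar> + \<bar>B1\<bar> * \<bar>B4\<bar>"
        if "cmod a \<le> B2" "cmod b \<le> B3" "cmod c \<le> B1" "cmod d \<le> B4" for a b c d
      proof -
        have "cmod (a * b) \<le> \<bar>B2\<bar> * \<bar>B3\<bar>" "cmod (c * d) \<le> \<bar>B1\<bar> * \<bar>B4\<bar>"
          unfolding norm_mult using that by (intro mult_mono; linarith?; simp)+
        then show ?thesis using norm_triangle_ineq[of "a * b" "c * d"] by linarith
      qed
      show ?thesis
        unfolding f_def f1_def using B1[OF t] B2[OF t] B34[OF t] by (intro conjI m) simp_all
    next
      case False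
      then show ?thesis using supp_f[of t] by simp
    qed
    have far: "f t = 0" "f1 t = 0" if "t \<in> U" "T < \<bar>t\<bar>" for t
      using supp_f[of t] that U_subset by auto
    note m = continuous_imp_measurable_on_sets_lebesgue[OF _ U_sets]
    show "square_integrable_on U f"
      by (rule square_integrable_on_bounded_support[OF U_sets m[OF cf(1)]]) (use bd far in blast)+
    show "square_integrable_on U f1"
      by (rule square_integrable_on_bounded_support[OF U_sets m[OF cf(2)]]) (use bd far in blast)+
  qed
  have "square_integrable_on U k"
    by (rule square_integrable_on_continuous_compact_support[OF U_sets ck0 K(1)]) (rule K(3))
  then have sq2: "square_integrable_on U (\<lambda>t. k t - z * f t)"
    by (intro square_integrable_on_diff square_integrable_on_scale sq)
  have cf2: "continuous_on U (\<lambda>t. k t - z * f t)"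
    by (intro continuous_intros cf continuous_on_subset[OF ck0]) simp
  have W: "W22_on U f f1 (\<lambda>t. k t - z * f t)"
    by (rule W22_on_classical[OF open_U df df1 cf2 sq sq2])
  have limAE: "(A \<longlongrightarrow> A t) (at t within S)" "((\<lambda>t. C - E t) \<longlongrightarrow> C - E t) (at t within S)" if "0 \<le> t" for t S
    using contAE[of t] that unfolding isCont_def
    by (auto intro!: tendsto_intros intro: tendsto_within_subset[OF _ subset_UNIV])
  have "interface_conditions f f1"
    unfolding interface_conditions_def
  proof (intro conjI allI impI)
    have "(f1 \<longlongrightarrow> snd (state z (0, 1) 0) * A (x 0) + snd (state z (1, 0) 0) * (C - E (x 0))) (at_right (x 0))"
      unfolding f1_def[abs_def] \<theta>'_def \<phi>'_def
      by (intro tendsto_add tendsto_mult sol_limits(2)[OF z] limAE) (simp_all add: x_0)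
    then show "(f1 \<longlongrightarrow> 0) (at_right 0)"
      using J0 by (simp add: x_0 A_def)
    fix n :: nat assume n: "n \<ge> 1"
    let ?y = "fst (state z (0, 1) n)" and ?p = "snd (state z (0, 1) n)"
    let ?y' = "fst (state z (1, 0) n)" and ?p' = "snd (state z (1, 0) n)"
    let ?a = "A (x n)" and ?c = "C - E (x n)"
    have "(f \<longlongrightarrow> ?y * ?a + ?y' * ?c) (at_right (x n))"
      unfolding f_def[abs_def] \<theta>_def \<phi>_def
      by (intro tendsto_add tendsto_mult sol_limits(1)[OF z] limAE x_nonneg)
    moreover have "(f \<longlongrightarrow> ?y * ?a + ?y' * ?c) (at_left (x n))"
      unfolding f_def[abs_def] \<theta>_def \<phi>_def
      by (intro tendsto_add tendsto_mult sol_limits(3)[OF z n] limAE x_nonneg)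
    moreover have "(f1 \<longlongrightarrow> ?p * ?a + ?p' * ?c) (at_right (x n))"
      unfolding f1_def[abs_def] \<theta>'_def \<phi>'_def
      by (intro tendsto_add tendsto_mult sol_limits(2)[OF z] limAE x_nonneg)
    moreover have "(f1 \<longlongrightarrow> (?p - of_real (\<alpha> n) * ?y) * ?a + (?p' - of_real (\<alpha> n) * ?y') * ?c) (at_left (x n))"
      unfolding f1_def[abs_def] \<theta>'_def \<phi>'_def
      by (intro tendsto_add tendsto_mult sol_limits(4)[OF z n] limAE x_nonneg)
    moreover have "(?p * ?a + ?p' * ?c) - ((?p - of_real (\<alpha> n) * ?y) * ?a + (?p' - of_real (\<alpha> n) * ?y') * ?c)
        = of_real (\<alpha> n) * (?y * ?a + ?y' * ?c)"
      by (simp add: algebra_simps)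
    ultimately show "\<exists>v p m. (f \<longlongrightarrow> v) (at_right (x n)) \<and> (f \<longlongrightarrow> v) (at_left (x n)) \<and>
        (f1 \<longlongrightarrow> p) (at_right (x n)) \<and> (f1 \<longlongrightarrow> m) (at_left (x n)) \<and> p - m = of_real (\<alpha> n) * v"
      by blast
  qed
  moreover have "\<exists>K. compact K \<and> K \<subseteq> {0..} \<and> (\<forall>t\<in>U - K. f t = 0)"
  proof (intro exI[of _ "{0..T}"] conjI ballI)
    fix t assume "t \<in> U - {0..T}"
    then have "T < t" using U_subset by auto
    then show "f t = 0" by (rule supp_f)
  qed auto
  ultimately have "hamiltonian0_data f f1 (\<lambda>t. k t - z * f t)"
    using W by (simp add: hamiltonian0_data_def)
  then show thesis by (rule that)
qed


lemma C2_compact_support_square_integrable: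
  assumes "C2_compact_support U h h1 h2"
  shows "square_integrable_on {0<..} h"
  using hamiltonian0_data_compact_support[OF assms] W22_on_U_square_integrable
  unfolding hamiltonian0_data_def by blast

lemma sol_nonzero:
  assumes z: "z \<noteq> 0" and sq: "square_integrable_on {0<..} (sol z (1, 0))"
  shows "abs_l2_halfline (sol z (1, 0)) \<noteq> 0"
proof
  assume "abs_l2_halfline (sol z (1, 0)) = 0"
  then have "AE t in lebesgue_on {0<..}. sol z (1, 0) t = 0"
    by (rule abs_l2_eq_zeroD[OF sq])
  then have ae: "AE t in lebesgue. t \<in> {0<..} \<longrightarrow> sol z (1, 0) t = 0"
    by (subst (asm) AE_restrict_space_iff) simp_all
  have "\<forall>\<^sub>F t in at_right 0. dist (sol z (1, 0) t) 1 < 1"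
    using sol_limits(1)[OF z, of "(1, 0)" 0] x_0 by (intro tendstoD) simp_all
  then obtain b where b: "b > 0" "\<And>t. 0 < t \<Longrightarrow> t < b \<Longrightarrow> dist (sol z (1, 0) t) 1 < 1"
    unfolding eventually_at_right_field by auto
  have "AE t in lebesgue. t \<notin> {0<..<b}"
    using ae
  proof eventually_elim
    case (elim t)
    show ?case
    proof
      assume "t \<in> {0<..<b}"
      then have t: "0 < t" "t < b" by simp_all
      then have "sol z (1, 0) t = 0" using elim by simp
      then show False using b(2)[OF t] by (simp add: dist_norm)
    qed
  qed
  then have "emeasure lebesgue {0<..<b} = 0"
    by (subst (asm) AE_iff_measurable[where N = "{0<..<b}"]) auto
  then show False using b(1) by simp
qed

text \<open>Orthogonality to the range of the Hamiltonian minus \<open>cnj z\<close> determines an element up to a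
  factor: by variation of parameters that range contains every smooth compactly supported function
  orthogonal to the solution.\<close>

lemma eigenspace_orthogonal:
  assumes z: "z \<noteq> 0" and sq: "square_integrable_on {0<..} (sol z (1, 0))"
    and G: "G \<in> eigenspace_graph (adjoint_graph (hamiltonian x \<alpha>)) z"
    and h: "C2_compact_support U h h1 h2"
    and orth: "cinner_l2 (abs_l2_halfline h) (abs_l2_halfline (sol z (1, 0))) = 0"
  shows "cinner_l2 (abs_l2_halfline h) G = 0"
proof -
  note sqh = C2_compact_support_square_integrable[OF h]
  have "integral\<^sup>L (lebesgue_on {0<..}) (\<lambda>t. h t * cnj (sol z (1, 0) t)) = 0"
    using orth unfolding cinner_abs_l2[OF sqh sq] .
  then have "cnj (integral\<^sup>L (lebesgue_on {0<..}) (\<lambda>t. h t * cnj (sol z (1, 0) t))) = 0" by simp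
  then have "integral\<^sup>L (lebesgue_on {0<..}) (\<lambda>t. cnj (h t) * sol z (1, 0) t) = 0"
    by (simp flip: Bochner_Integration.integral_cnj)
  then obtain f f1 where "hamiltonian0_data f f1 (\<lambda>t. cnj (h t) - z * f t)"
    using inhomogeneous_equation_solvable[OF z C2_compact_support_cnj[OF h]] by blast
  from hamiltonian0_data_cnj[OF this]
  have d: "hamiltonian0_data (\<lambda>t. cnj (f t)) (\<lambda>t. cnj (f1 t)) (\<lambda>t. h t - cnj z * cnj (f t))"
    by simp
  then have sqf: "square_integrable_on {0<..} (\<lambda>t. cnj (f t))"
    using W22_on_U_square_integrable unfolding hamiltonian0_data_def by blast
  have sqzf: "square_integrable_on {0<..} (\<lambda>t. cnj z * cnj (f t))"
    using sqf by (rule square_integrable_on_scale)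
  have "- cinner_l2 (abs_l2_halfline (\<lambda>t. h t - cnj z * cnj (f t))) G = cnj z * cinner_l2 (abs_l2_halfline (\<lambda>t. cnj (f t))) G"
    using G d unfolding eigenspace_hamiltonian by blast
  moreover have "cinner_l2 (abs_l2_halfline (\<lambda>t. h t - cnj z * cnj (f t))) G =
      cinner_l2 (abs_l2_halfline h) G - cnj z * cinner_l2 (abs_l2_halfline (\<lambda>t. cnj (f t))) G"
    unfolding minus_abs_l2[OF sqh sqzf, symmetric] scaleC_abs_l2[OF sqf, symmetric]
      cinner_l2_diff_left cinner_l2_scaleC_left ..
  ultimately show ?thesis by simp
qed

text \<open>On the smooth compactly supported functions the functionals given by an element of the kernel and by
  the solution have comparable null spaces, so they are proportional; by density so are the elements.\<close>

theorem eigenspace_dim_eq_1: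
  assumes z: "z \<noteq> 0" and sq: "square_integrable_on {0<..} (sol z (1, 0))"
  shows "cdim_l2 (eigenspace_graph (adjoint_graph (hamiltonian x \<alpha>)) z) = 1"
proof -
  define \<Phi> where "\<Phi> = abs_l2_halfline (sol z (1, 0))"
  let ?E = "eigenspace_graph (adjoint_graph (hamiltonian x \<alpha>)) z"
  let ?D = "abs_l2_halfline ` {h. \<exists>h1 h2. C2_compact_support U h h1 h2}"
  have \<Phi>: "\<Phi> \<in> ?E" "\<Phi> \<noteq> 0"
    unfolding \<Phi>_def using sol_in_eigenspace[OF z _ sq] sol_nonzero[OF z sq] by simp_all
  have "?E = range (\<lambda>c. scaleC_l2 c \<Phi>)"
  proof
    show "range (\<lambda>c. scaleC_l2 c \<Phi>) \<subseteq> ?E"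
    proof
      fix F assume "F \<in> range (\<lambda>c. scaleC_l2 c \<Phi>)"
      then obtain c where F: "F = scaleC_l2 c \<Phi>" by blast
      have "- cinner_l2 (abs_l2_halfline f2) \<Phi> = cnj z * cinner_l2 (abs_l2_halfline f) \<Phi>"
        if "hamiltonian0_data f f1 f2" for f f1 f2
        using \<Phi>(1) that unfolding eigenspace_hamiltonian by blast
      then show "F \<in> ?E"
        unfolding eigenspace_hamiltonian F mem_Collect_eq cinner_l2_scaleC_right
        by (metis mult.left_commute mult_minus_right)
    qed
    obtain h0 h01 h02 where h0: "C2_compact_support U h0 h01 h02" "cinner_l2 (abs_l2_halfline h0) \<Phi> \<noteq> 0"
      using orthogonal_dense_eq_0[OF C2_compact_support_dense, of \<Phi>] \<Phi>(2) by blast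
    show "?E \<subseteq> range (\<lambda>c. scaleC_l2 c \<Phi>)"
    proof
      fix G assume G: "G \<in> ?E"
      define c where "c = cinner_l2 (abs_l2_halfline h0) G / cinner_l2 (abs_l2_halfline h0) \<Phi>"
      have "G - scaleC_l2 (cnj c) \<Phi> = 0"
      proof (rule orthogonal_dense_eq_0[OF C2_compact_support_dense])
        fix H assume "H \<in> ?D"
        then obtain h h1 h2 where h: "C2_compact_support U h h1 h2" and H: "H = abs_l2_halfline h" by blast
        define b where "b = cinner_l2 H \<Phi> / cinner_l2 (abs_l2_halfline h0) \<Phi>"
        note sqh = C2_compact_support_square_integrable[OF h]
          and sqh0 = C2_compact_support_square_integrable[OF h0(1)]
        have e: "abs_l2_halfline (\<lambda>t. h t - b * h0 t) = H - scaleC_l2 b (abs_l2_halfline h0)"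
          unfolding H scaleC_abs_l2[OF sqh0] by (rule minus_abs_l2[OF sqh square_integrable_on_scale[OF sqh0], symmetric])
        have "cinner_l2 (abs_l2_halfline (\<lambda>t. h t - b * h0 t)) \<Phi> = 0"
          unfolding e cinner_l2_diff_left cinner_l2_scaleC_left using h0(2) by (simp add: b_def)
        then have "cinner_l2 (abs_l2_halfline (\<lambda>t. h t - b * h0 t)) G = 0"
          unfolding \<Phi>_def by (rule eigenspace_orthogonal[OF z sq G C2_compact_support_linear[OF h h0(1)]])
        then have "cinner_l2 H G = b * cinner_l2 (abs_l2_halfline h0) G"
          unfolding e cinner_l2_diff_left cinner_l2_scaleC_left by simp
        then show "cinner_l2 H (G - scaleC_l2 (cnj c) \<Phi>) = 0"
          unfolding cinner_l2_diff_right cinner_l2_scaleC_right by (simp add: b_def c_def)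
      qed
      then show "G \<in> range (\<lambda>c. scaleC_l2 c \<Phi>)" by auto
    qed
  qed
  then show ?thesis
    using cdim_l2_span_singleton[OF \<Phi>(2)] by simp
qed

end

section \<open>The three-term recurrence\<close>

text \<open>The quadratic form \<open>cmod (w (n + 1))\<^sup>2 + cmod (w n)\<^sup>2 + 2 b Re (w (n + 1) * cnj (w n))\<close> is
  invariant under the unperturbed recurrence and, since \<open>\<bar>b\<bar> < 1\<close>, positive definite; a summable
  perturbation changes it by a convergent product of factors only.\<close>

lemma perturbed_oscillation_bounded:
  fixes w :: "nat \<Rightarrow> complex" and b :: real
  assumes b: "\<bar>b\<bar> < 1" and \<eta>: "summable \<eta>" "\<And>n. 0 \<le> \<eta> n"
    and rec: "\<And>n. n \<ge> N \<Longrightarrow>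
      cmod (w (n + 2) + w n + of_real (2 * b) * w (n + 1)) \<le> \<eta> n * (cmod (w n) + cmod (w (n + 1)))"
  obtains M where "\<And>n. n \<ge> N \<Longrightarrow> cmod (w n) \<le> M"
proof -
  define P where "P n = (cmod (w n))\<^sup>2 + (cmod (w (n + 1)))\<^sup>2" for n
  define Q where "Q n = P n + 2 * b * Re (w (n + 1) * cnj (w n))" for n
  have cross: "\<bar>2 * b * Re (w (n + 1) * cnj (w n))\<bar> \<le> \<bar>b\<bar> * P n" for n
  proof -
    have "\<bar>Re (w (n + 1) * cnj (w n))\<bar> \<le> cmod (w (n + 1)) * cmod (w n)"
      using abs_Re_le_cmod[of "w (n + 1) * cnj (w n)"] by (simp add: norm_mult)
    moreover have "2 * (cmod (w (n + 1)) * cmod (w n)) \<le> P n"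
      using zero_le_power2[of "cmod (w (n + 1)) - cmod (w n)"] unfolding P_def power2_diff by (simp add: algebra_simps)
    ultimately have "2 * \<bar>Re (w (n + 1) * cnj (w n))\<bar> \<le> P n" by linarith
    then have "\<bar>b\<bar> * (2 * \<bar>Re (w (n + 1) * cnj (w n))\<bar>) \<le> \<bar>b\<bar> * P n"
      by (rule mult_left_mono) simp
    then show ?thesis by (simp only: abs_mult abs_numeral mult_ac)
  qed
  have PQ: "(1 - \<bar>b\<bar>) * P n \<le> Q n" for n
    using cross[of n] unfolding Q_def by (simp add: algebra_simps abs_le_iff)
  have P0: "0 \<le> P n" for n by (simp add: P_def)
  have Q0: "0 \<le> Q n" for n
    using PQ[of n] P0[of n] b by (smt (verit) mult_nonneg_nonneg)
  \<comment> \<open>One step changes \<open>Q\<close> by at most \<open>7 * \<eta> n * (cmod (w n) + cmod (w (n + 1)))\<^sup>2\<close>, and this square is at most \<open>2 * P n\<close>.\<close>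
  define K where "K = 14 / (1 - \<bar>b\<bar>)"
  have K: "K > 0" using b by (simp add: K_def)
  have "\<eta> \<longlonglongrightarrow> 0" using \<eta>(1) by (rule summable_LIMSEQ_zero)
  then have "\<forall>\<^sub>F n in sequentially. \<eta> n < 1" by (rule order_tendstoD) simp
  then obtain N1 where N1: "\<And>n. n \<ge> N1 \<Longrightarrow> \<eta> n < 1" by (auto simp: eventually_sequentially)
  define N2 where "N2 = max N N1"
  have step: "Q (Suc n) \<le> (1 + K * \<eta> n) * Q n" if n: "n \<ge> N2" for n
  proof -
    define e where "e = w (n + 2) + w n + of_real (2 * b) * w (n + 1)"
    define v where "v = w n + of_real (2 * b) * w (n + 1)"
    define m where "m = cmod (w n) + cmod (w (n + 1))"
    have m0: "0 \<le> m" by (simp add: m_def)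
    have e: "cmod e \<le> \<eta> n * m" "\<eta> n \<le> 1"
      using rec[of n] N1[of n] n by (simp_all add: e_def m_def N2_def less_imp_le)
    have w2: "w (n + 2) = e - v" by (simp add: e_def v_def)
    \<comment> \<open>The unperturbed step \<open>w (n + 2) = - v\<close> preserves \<open>Q\<close>.\<close>
    have inv: "(cmod v)\<^sup>2 + (cmod (w (n + 1)))\<^sup>2 - 2 * b * Re (v * cnj (w (n + 1))) = Q n"
      unfolding Q_def P_def v_def cmod_power2 by (simp add: power2_eq_square algebra_simps)
    have "Q (Suc n) = (cmod (e - v))\<^sup>2 + (cmod (w (n + 1)))\<^sup>2 + 2 * b * Re ((e - v) * cnj (w (n + 1)))"
      unfolding Q_def P_def w2[symmetric] by simp
    also have "\<dots> = (cmod v)\<^sup>2 + (cmod (w (n + 1)))\<^sup>2 - 2 * b * Re (v * cnj (w (n + 1)))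
        + ((cmod e)\<^sup>2 - 2 * Re (e * cnj v) + 2 * b * Re (e * cnj (w (n + 1))))"
      unfolding cmod_power2 by (simp add: power2_eq_square algebra_simps)
    finally have Qs: "Q (Suc n) = Q n + ((cmod e)\<^sup>2 - 2 * Re (e * cnj v) + 2 * b * Re (e * cnj (w (n + 1))))"
      unfolding inv .
    have "cmod v \<le> cmod (w n) + 2 * \<bar>b\<bar> * cmod (w (n + 1))"
      unfolding v_def by (rule order_trans[OF norm_triangle_ineq]) (simp add: norm_mult)
    also have "\<dots> \<le> 2 * m"
    proof -
      have "\<bar>b\<bar> * cmod (w (n + 1)) \<le> 1 * cmod (w (n + 1))"
        using b by (intro mult_right_mono) auto
      then have "2 * \<bar>b\<bar> * cmod (w (n + 1)) \<le> 2 * cmod (w (n + 1))" by linarith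
      then show ?thesis unfolding m_def distrib_left by (intro add_mono) simp_all
    qed
    finally have v: "cmod v \<le> 2 * m" .
    have 1: "- Re (e * cnj v) \<le> cmod e * (2 * m)"
    proof -
      have "- Re (e * cnj v) \<le> cmod e * cmod v"
        using abs_Re_le_cmod[of "e * cnj v"] by (simp add: norm_mult)
      also have "\<dots> \<le> cmod e * (2 * m)" by (rule mult_left_mono[OF v]) simp
      finally show ?thesis .
    qed
    have 2: "b * Re (e * cnj (w (n + 1))) \<le> cmod e * m"
    proof -
      have "b * Re (e * cnj (w (n + 1))) \<le> \<bar>b\<bar> * \<bar>Re (e * cnj (w (n + 1)))\<bar>"
        by (metis abs_ge_self abs_mult)
      also have "\<dots> \<le> 1 * (cmod e * cmod (w (n + 1)))"
        using b abs_Re_le_cmod[of "e * cnj (w (n + 1))"]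
        by (intro mult_mono) (auto simp: norm_mult)
      also have "\<dots> \<le> cmod e * m" by (simp add: m_def mult_left_mono)
      finally show ?thesis .
    qed
    have 3: "(cmod e)\<^sup>2 \<le> \<eta> n * m\<^sup>2"
    proof -
      have "cmod e \<le> m"
        using e mult_right_mono[OF e(2) m0] by linarith
      then have "cmod e * cmod e \<le> (\<eta> n * m) * m"
        using e(1) m0 \<eta>(2)[of n] by (intro mult_mono) auto
      then show ?thesis by (simp add: power2_eq_square mult.assoc)
    qed
    have "cmod e * m \<le> \<eta> n * m\<^sup>2"
      using mult_right_mono[OF e(1) m0] by (simp add: power2_eq_square mult.assoc)
    then have "Q (Suc n) \<le> Q n + 7 * (\<eta> n * m\<^sup>2)"
      using Qs 1 2 3 by linarith
    also have "7 * (\<eta> n * m\<^sup>2) \<le> K * \<eta> n * Q n"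
    proof -
      have "m\<^sup>2 \<le> 2 * P n"
        using zero_le_power2[of "cmod (w (n + 1)) - cmod (w n)"]
        unfolding P_def m_def power2_diff power2_sum by (simp add: algebra_simps)
      moreover have "P n \<le> Q n / (1 - \<bar>b\<bar>)"
        using PQ[of n] b by (simp add: pos_le_divide_eq mult.commute)
      ultimately have "m\<^sup>2 \<le> 2 * (Q n / (1 - \<bar>b\<bar>))" by linarith
      then have "7 * (\<eta> n * m\<^sup>2) \<le> 7 * (\<eta> n * (2 * (Q n / (1 - \<bar>b\<bar>))))"
        using \<eta>(2)[of n] by (intro mult_left_mono) auto
      then show ?thesis by (simp add: K_def)
    qed
    finally show ?thesis by (simp add: algebra_simps)
  qed
  have sK: "summable (\<lambda>n. K * \<eta> n)" using \<eta>(1) by (rule summable_mult)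
  have grow: "Q (N2 + k) \<le> Q N2 * exp (\<Sum>j<k. K * \<eta> (N2 + j))" for k
  proof (induction k)
    case (Suc k)
    have "Q (N2 + Suc k) \<le> (1 + K * \<eta> (N2 + k)) * Q (N2 + k)"
      using step[of "N2 + k"] by simp
    also have "\<dots> \<le> exp (K * \<eta> (N2 + k)) * (Q N2 * exp (\<Sum>j<k. K * \<eta> (N2 + j)))"
      by (intro mult_mono exp_ge_add_one_self Suc) (auto simp: Q0)
    finally show ?case by (simp add: exp_add mult_ac)
  qed simp
  define B where "B = Q N2 * exp (suminf (\<lambda>n. K * \<eta> (n + N2)))"
  have bound: "Q n \<le> B" if n: "n \<ge> N2" for n
  proof -
    obtain k where k: "n = N2 + k" using le_Suc_ex[OF n] by blast
    have s: "summable (\<lambda>n. K * \<eta> (n + N2))"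
      using sK by (rule summable_ignore_initial_segment)
    have "(\<Sum>j<k. K * \<eta> (j + N2)) \<le> suminf (\<lambda>n. K * \<eta> (n + N2))"
    proof (rule sum_le_suminf[OF s])
      show "0 \<le> K * \<eta> (j + N2)" for j
        using K \<eta>(2)[of "j + N2"] by simp
    qed simp
    then have "exp (\<Sum>j<k. K * \<eta> (N2 + j)) \<le> exp (suminf (\<lambda>n. K * \<eta> (n + N2)))"
      by (simp add: add.commute)
    then have "Q N2 * exp (\<Sum>j<k. K * \<eta> (N2 + j)) \<le> B"
      unfolding B_def using Q0 by (intro mult_left_mono)
    then show ?thesis unfolding k by (rule order_trans[OF grow])
  qed
  have large: "cmod (w n) \<le> sqrt (B / (1 - \<bar>b\<bar>))" if "n \<ge> N2" for n
  proof (rule real_le_rsqrt)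
    have "(1 - \<bar>b\<bar>) * P n \<le> B" using PQ[of n] bound[OF that] by linarith
    then have "P n \<le> B / (1 - \<bar>b\<bar>)" using b by (simp add: pos_le_divide_eq mult.commute)
    then show "(cmod (w n))\<^sup>2 \<le> B / (1 - \<bar>b\<bar>)"
      unfolding P_def by (smt (verit) zero_le_power2)
  qed
  show thesis
  proof
    fix n
    show "cmod (w n) \<le> max (sqrt (B / (1 - \<bar>b\<bar>))) (\<Sum>j<N2. cmod (w j))"
    proof (cases "n \<ge> N2")
      case True
      then show ?thesis using large[of n] by simp
    next
      case False
      then have "cmod (w n) \<le> (\<Sum>j<N2. cmod (w j))"
        by (intro member_le_sum) auto
      then show ?thesis by simp
    qed
  qed
qed

context point_interactions
begin

text \<open>Elimination of the derivative from two consecutive transfer steps. The factors \<open>fsin\<close> are kept on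
  both sides instead of dividing by them, since they may vanish on long intervals.\<close>

lemma state_recurrence:
  fixes s :: "complex \<times> complex"
  assumes z: "z \<noteq> 0"
  defines "d \<equiv> \<lambda>n. x (Suc n) - x n" and "y \<equiv> \<lambda>n. fst (state z s n)"
  shows "fsin z (d n) * y (n + 2) + fsin z (d (n + 1)) * y n =
    (fsin z (d n) * fcos z (d (n + 1)) + fsin z (d (n + 1)) * fcos z (d n)
      + of_real (\<alpha> (n + 1)) * fsin z (d n) * fsin z (d (n + 1))) * y (n + 1)"
proof -
  define p where "p n = snd (state z s n)" for n
  have y: "y (Suc n) = fcos z (d n) * y n + fsin z (d n) * p n" for n
    unfolding d_def y_def p_def by (simp add: Let_def)
  have p: "p (Suc n) = - z * fsin z (d n) * y n + fcos z (d n) * p n + of_real (\<alpha> (Suc n)) * y (Suc n)" for n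
    unfolding d_def y_def p_def by (simp add: Let_def)
  have "fsin z (d n) * p (Suc n) + y n = fcos z (d n) * y (Suc n) + of_real (\<alpha> (Suc n)) * fsin z (d n) * y (Suc n)
      + (1 - (fcos z (d n) * fcos z (d n) + z * (fsin z (d n) * fsin z (d n)))) * y n"
    unfolding p y by (simp add: algebra_simps)
  then have *: "fsin z (d n) * p (Suc n) + y n = fcos z (d n) * y (Suc n) + of_real (\<alpha> (Suc n)) * fsin z (d n) * y (Suc n)"
    by (simp add: fcos_fsin_pythagoras[OF z])
  have "fsin z (d n) * y (Suc (Suc n)) + fsin z (d (Suc n)) * y n =
      fsin z (d n) * fcos z (d (Suc n)) * y (Suc n) + fsin z (d (Suc n)) * (fsin z (d n) * p (Suc n) + y n)"
    unfolding y[of "Suc n"] by (simp add: algebra_simps)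
  then show ?thesis
    unfolding * by (simp add: algebra_simps)
qed

lemma square_integrable_piecewise_bounded:
  assumes f: "continuous_on U f" and M: "\<And>n t. t \<in> {x n<..<x (Suc n)} \<Longrightarrow> cmod (f t) \<le> M n"
    and sum: "summable (\<lambda>n. (x (Suc n) - x n) * (M n)\<^sup>2)"
  shows "square_integrable_on {0<..} f"
proof -
  have m: "f \<in> borel_measurable (lebesgue_on U)"
    by (rule continuous_imp_measurable_on_sets_lebesgue[OF f U_sets])
  define F where "F t = indicator U t *\<^sub>R (cmod (f t))\<^sup>2" for t
  have m2: "(\<lambda>t. (cmod (f t))\<^sup>2) \<in> borel_measurable (lebesgue_on U)"
    using m by measurable
  then have mF: "F \<in> borel_measurable lebesgue"
    unfolding F_def[abs_def] using U_sets by (subst borel_measurable_restrict_space_iff[symmetric]) simp_all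
  have F0: "0 \<le> F t" for t by (simp add: F_def)
  have disj: "disjoint_family (\<lambda>n. {x n<..<x (Suc n)})"
    unfolding disjoint_family_on_def
  proof (intro ballI impI)
    fix m n :: nat assume "m \<noteq> n"
    show "{x m<..<x (Suc m)} \<inter> {x n<..<x (Suc n)} = {}"
    proof (rule ccontr)
      assume "{x m<..<x (Suc m)} \<inter> {x n<..<x (Suc n)} \<noteq> {}"
      then obtain t where "t \<in> {x m<..<x (Suc m)}" "t \<in> {x n<..<x (Suc n)}" by blast
      then have t: "x m < t" "t < x (Suc m)" "x n < t" "t < x (Suc n)" by simp_all
      then have "piece t = m" "piece t = n" by (simp_all add: piece_eqI)
      then show False using \<open>m \<noteq> n\<close> by simp
    qed
  qed
  have le: "(\<integral>\<^sup>+t\<in>{x n<..<x (Suc n)}. ennreal (F t) \<partial>lebesgue) \<le> ennreal ((x (Suc n) - x n) * (M n)\<^sup>2)" for n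
  proof -
    have "(\<integral>\<^sup>+t\<in>{x n<..<x (Suc n)}. ennreal (F t) \<partial>lebesgue) \<le> (\<integral>\<^sup>+t. ennreal ((M n)\<^sup>2) * indicator {x n<..<x (Suc n)} t \<partial>lebesgue)"
    proof (rule nn_integral_mono)
      fix t
      show "ennreal (F t) * indicator {x n<..<x (Suc n)} t \<le> ennreal ((M n)\<^sup>2) * indicator {x n<..<x (Suc n)} t"
      proof (cases "t \<in> {x n<..<x (Suc n)}")
        case True
        have "F t \<le> (cmod (f t))\<^sup>2" by (simp add: F_def indicator_def)
        also have "\<dots> \<le> (M n)\<^sup>2" using M[OF True] by (intro power_mono) auto
        finally show ?thesis using True by (simp add: ennreal_leI)
      qed simp
    qed
    also have "\<dots> = ennreal ((M n)\<^sup>2) * emeasure lebesgue {x n<..<x (Suc n)}"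
      by (rule nn_integral_cmult_indicator) simp
    also have "\<dots> = ennreal ((x (Suc n) - x n) * (M n)\<^sup>2)"
      using x_less[of n] by (simp add: ennreal_mult' mult.commute)
    finally show ?thesis .
  qed
  have "(\<integral>\<^sup>+t. ennreal (F t) \<partial>lebesgue) = (\<integral>\<^sup>+t\<in>(\<Union>n. {x n<..<x (Suc n)}). ennreal (F t) \<partial>lebesgue)"
    unfolding U_eq[symmetric] by (rule nn_integral_cong) (simp add: F_def indicator_def)
  also have "\<dots> = (\<Sum>n. (\<integral>\<^sup>+t\<in>{x n<..<x (Suc n)}. ennreal (F t) \<partial>lebesgue))"
    using mF by (intro nn_integral_disjoint_family disj) simp_all
  also have "\<dots> \<le> (\<Sum>n. ennreal ((x (Suc n) - x n) * (M n)\<^sup>2))"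
    by (intro suminf_le le) simp_all
  also have "\<dots> < \<infinity>"
  proof (subst suminf_ennreal2[OF _ sum])
    show "0 \<le> (x (Suc n) - x n) * (M n)\<^sup>2" for n
      using x_less[of n] by simp
  qed simp
  finally have "integrable lebesgue F"
    using mF F0 by (intro integrableI_bounded) simp_all
  then have "integrable (lebesgue_on U) (\<lambda>t. (cmod (f t))\<^sup>2)"
    unfolding F_def[abs_def] using integrable_lebesgue_on_iff[OF U_sets, of "\<lambda>t. (cmod (f t))\<^sup>2"] by simp
  then show ?thesis
    using m square_integrable_on_U[of f] unfolding square_integrable_on_def[of U] by simp
qed

end

text \<open>The relation between consecutive \<open>rt\<close> gives the product of two consecutive terms of
  \<open>(1 / d n + 1 / d (n + 1)) (rt n)\<^sup>2\<close> in terms of ratios of consecutive \<open>d\<close> alone; it tends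
  to \<open>4\<close>. Along a period the limit of \<open>u n * u (n + 1)\<close> is attained.\<close>

lemma alternating_potential:
  fixes d rt u :: "nat \<Rightarrow> real"
  assumes d_pos: "\<forall>n\<ge>1. d n > 0" and ratio: "(\<lambda>n. d (n + 1) / d n) \<longlonglongrightarrow> 1"
    and rt: "\<forall>n\<ge>1. rt n \<noteq> 0" "\<forall>n\<ge>1. rt (n + 1) = - d (n + 1) / rt n"
    and lim: "(\<lambda>n. (1 / d n + 1 / d (n + 1)) * (rt n)\<^sup>2 - u n) \<longlonglongrightarrow> 0"
    and per: "p \<ge> 1" "\<forall>n\<ge>1. u (n + p) = u n" and n: "n \<ge> 1"
  shows "u n > 0" "u n * u (n + 1) = 4"
proof -
  define s where "s n = (1 / d n + 1 / d (n + 1)) * (rt n)\<^sup>2" for n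
  have s_pos: "s k > 0" if "k \<ge> 1" for k
    using d_pos rt(1) that unfolding s_def by (intro mult_pos_pos add_pos_pos) auto
  have prod: "s k * s (k + 1) = (1 + d (k + 1) / d k) * (1 + 1 / (d (k + 2) / d (k + 1)))" if "k \<ge> 1" for k
  proof -
    have p: "d k \<noteq> 0" "d (k + 1) \<noteq> 0" "d (k + 2) \<noteq> 0" "rt k \<noteq> 0"
      using d_pos rt(1) that by (auto simp: less_le)
    have r: "rt (k + 1) = - d (k + 1) / rt k" using rt(2) that by blast
    have "s k * s (k + 1) = (1 / d k + 1 / d (k + 1)) * (1 / d (k + 1) + 1 / d (k + 2)) * (d (k + 1) * d (k + 1))"
      unfolding s_def r using p by (simp add: power2_eq_square add.assoc)
    also have "\<dots> = (1 + d (k + 1) / d k) * (1 + 1 / (d (k + 2) / d (k + 1)))"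
      using p by (simp add: field_simps)
    finally show ?thesis .
  qed
  have "(\<lambda>k. (1 + d (k + 1) / d k) * (1 + 1 / (d (k + 2) / d (k + 1)))) \<longlonglongrightarrow> (1 + 1) * (1 + 1 / 1)"
  proof (intro tendsto_intros ratio)
    show "(\<lambda>k. d (k + 2) / d (k + 1)) \<longlonglongrightarrow> 1"
      using LIMSEQ_ignore_initial_segment[OF ratio, of 1] by (simp add: add.assoc)
  qed simp
  then have "(\<lambda>k. (1 + d (k + 1) / d k) * (1 + 1 / (d (k + 2) / d (k + 1)))) \<longlonglongrightarrow> 4" by simp
  then have ss: "(\<lambda>k. s k * s (k + 1)) \<longlonglongrightarrow> 4"
    by (rule Lim_transform_eventually)
      (use prod in \<open>auto simp: eventually_sequentially intro!: exI[of _ 1]\<close>)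
  have perk: "u (m + k * p) = u m" if "m \<ge> 1" for m k
  proof (induction k)
    case (Suc k)
    have "u (m + Suc k * p) = u ((m + k * p) + p)" by (simp add: algebra_simps)
    also have "\<dots> = u (m + k * p)" using per(2) that by simp
    finally show ?case using Suc by simp
  qed simp
  have sub: "strict_mono (\<lambda>k. m + k * p)" for m
    using per(1) by (auto simp: strict_mono_def)
  have slim: "(\<lambda>k. s (m + k * p)) \<longlonglongrightarrow> u m" if "m \<ge> 1" for m
  proof -
    have "(\<lambda>k. s (m + k * p) - u (m + k * p)) \<longlonglongrightarrow> 0"
      using LIMSEQ_subseq_LIMSEQ[OF lim sub[of m]] by (simp add: o_def s_def)
    then have "(\<lambda>k. s (m + k * p) - u m) \<longlonglongrightarrow> 0"
      using perk[OF that] by simp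
    then show ?thesis by (simp add: LIM_zero_iff)
  qed
  have "(\<lambda>k. s (n + k * p) * s ((n + 1) + k * p)) \<longlonglongrightarrow> u n * u (n + 1)"
    using n by (intro tendsto_mult slim) auto
  moreover have "(\<lambda>k. s (n + k * p) * s ((n + 1) + k * p)) \<longlonglongrightarrow> 4"
    using LIMSEQ_subseq_LIMSEQ[OF ss sub[of n]] by (simp add: o_def add_ac)
  ultimately show 4: "u n * u (n + 1) = 4"
    by (rule LIMSEQ_unique)
  have "0 \<le> u n"
    by (rule LIMSEQ_le_const[OF slim[OF n]]) (use s_pos n in \<open>auto intro!: exI[of _ 0] less_imp_le\<close>)
  moreover have "u n \<noteq> 0" using 4 by auto
  ultimately show "u n > 0" by simp
qed

lemma near_one_mult:
  fixes v w :: complex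
  assumes "cmod (v - 1) \<le> e" "cmod (w - 1) \<le> e" "e \<le> 1"
  shows "cmod (v * w - 1) \<le> 3 * e"
proof -
  have "cmod v \<le> 2" using norm_triangle_ineq[of "v - 1" 1] assms by simp
  then have "cmod v * cmod (w - 1) \<le> 2 * e"
    using assms by (intro mult_mono) auto
  moreover have eq: "v * w - 1 = v * (w - 1) + (v - 1)" by (simp add: algebra_simps)
  have "cmod (v * w - 1) \<le> cmod v * cmod (w - 1) + cmod (v - 1)"
    unfolding eq by (rule order_trans[OF norm_triangle_ineq]) (simp add: norm_mult)
  ultimately show ?thesis using assms(1) by linarith
qed

text \<open>The \<open>w\<close> are the values of a solution divided by \<open>\<rho>\<close>, whose consecutive products are
  \<open>- d1\<close> and \<open>- d2\<close>, and by alternating constants \<open>\<kappa>\<close>, so that \<open>\<rho>0\<close> and \<open>\<rho>2\<close> share the constant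
  \<open>\<kappa>2\<close>. After this substitution the recurrence has constant coefficients up to the stated error. Only
  the quadratic dependence of the error on the lengths and its linear dependence on
  \<open>(d1 + d2) * \<rho>1\<^sup>2\<close> matter, not the numerical constants.\<close>

lemma one_step_estimate:
  fixes S1 S2 c1 c2 w0 w1 w2 :: complex and d1 d2 \<rho>0 \<rho>1 \<rho>2 \<kappa>1 \<kappa>2 \<alpha> a C C1 C2 \<mu> :: real
  assumes d: "0 < d1" "d1 \<le> 2 * d2" "d2 \<le> 2 * d1"
    and \<rho>: "\<rho>1 \<noteq> 0" "\<rho>1 = - d1 / \<rho>0" "\<rho>2 = - d2 / \<rho>1"
    and \<kappa>: "\<kappa>1 > 0" "\<kappa>2 > 0" and a: "-2 < a" "a < 0"
    and C: "0 < C" "0 < C1" "0 < C2" "4 * C * d1\<^sup>2 \<le> 1 / 2"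
    and S: "cmod (S1 - of_real d1) \<le> C * d1 ^ 3" "cmod (S2 - of_real d2) \<le> C * d2 ^ 3"
    and c: "cmod (c1 - 1) \<le> C * d1\<^sup>2" "cmod (c2 - 1) \<le> C * d2\<^sup>2"
    and \<alpha>: "\<bar>\<alpha> - a * (1 / d1 + 1 / d2)\<bar> \<le> C1 * d1"
    and u: "\<bar>(1 / d1 + 1 / d2) * \<rho>1\<^sup>2 - 2 * \<kappa>2 / \<kappa>1\<bar> \<le> C2 * ((d1 + d2) * \<rho>1\<^sup>2)"
    and \<mu>: "0 < \<mu>" "\<mu> \<le> 2 * \<kappa>2 / \<kappa>1"
    and rec: "S1 * (of_real (\<rho>2 * \<kappa>2) * w2) + S2 * (of_real (\<rho>0 * \<kappa>2) * w0) =
      (S1 * c2 + S2 * c1 + of_real \<alpha> * S1 * S2) * (of_real (\<rho>1 * \<kappa>1) * w1)"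
  shows "cmod (w2 + w0 + of_real (2 * (1 + a)) * w1) \<le>
    (20 * C * d1\<^sup>2 + 2 * ((2 / \<mu>) * (C2 + 108 * C + 4 * C1) * ((d1 + d2) * \<rho>1\<^sup>2))) * (cmod w0 + cmod w1)"
proof -
  have d2: "0 < d2" using d by linarith
  define e where "e = 4 * C * d1\<^sup>2"
  have e: "0 \<le> e" "e \<le> 1 / 2" "e \<le> 1" using C by (simp_all add: e_def)
  define T1 where "T1 = S1 / of_real d1"
  define T2 where "T2 = S2 / of_real d2"
  have ST: "S1 = T1 * of_real d1" "S2 = T2 * of_real d2"
    using d d2 by (simp_all add: T1_def T2_def)
  have d22: "C * d2\<^sup>2 \<le> e"
  proof -
    have "d2\<^sup>2 \<le> (2 * d1)\<^sup>2" using d d2 by (intro power_mono) auto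
    then have "C * d2\<^sup>2 \<le> C * (2 * d1)\<^sup>2" using C by (intro mult_left_mono) auto
    then show ?thesis by (simp add: e_def power2_eq_square)
  qed
  have d12: "C * d1\<^sup>2 \<le> e"
    using mult_nonneg_nonneg[of C "d1\<^sup>2"] C unfolding e_def by simp
  have Tb: "cmod (T - 1) \<le> C * d\<^sup>2" if "cmod (T * of_real d - of_real d) \<le> C * d ^ 3" "0 < d" for T d
  proof -
    have "T * of_real d - of_real d = (T - 1) * of_real d" by (simp add: algebra_simps)
    then have "cmod (T - 1) * d \<le> (C * d\<^sup>2) * d"
      using that by (simp add: norm_mult power2_eq_square power3_eq_cube mult.assoc)
    then show ?thesis using that(2) by simp
  qed
  have T: "cmod (T1 - 1) \<le> e" "cmod (T2 - 1) \<le> e"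
    using Tb[OF S(1)[unfolded ST] d(1)] Tb[OF S(2)[unfolded ST] d2] d12 d22 by linarith+
  have cc: "cmod (c1 - 1) \<le> e" "cmod (c2 - 1) \<le> e"
    using c d12 d22 by linarith+
  define q where "q = 1 / d1 + 1 / d2"
  have q: "0 < q" "q * d1\<^sup>2 \<le> 3 * d1"
  proof -
    show "0 < q" using d d2 by (simp add: q_def add_pos_pos)
    have "d1 * d1 / d2 \<le> 2 * d1"
      using mult_right_mono[OF d(2), of d1] d d2 by (simp add: pos_divide_le_eq mult_ac)
    moreover have "q * d1\<^sup>2 = d1 + d1 * d1 / d2"
      using d d2 by (simp add: q_def power2_eq_square field_simps)
    ultimately show "q * d1\<^sup>2 \<le> 3 * d1" by simp
  qed
  have eq3: "3 * e * q \<le> 36 * C * d1"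
  proof -
    have "3 * e * q = 12 * C * (q * d1\<^sup>2)" by (simp add: e_def mult_ac)
    also have "\<dots> \<le> 12 * C * (3 * d1)" using q(2) C by (intro mult_left_mono) auto
    finally show ?thesis by simp
  qed
  define H where "H = T1 * c2 / of_real d2 + T2 * c1 / of_real d1 + of_real \<alpha> * (T1 * T2)"
  have Hb: "cmod (H - of_real ((1 + a) * q)) \<le> (108 * C + 4 * C1) * d1"
  proof -
    have split: "H - of_real ((1 + a) * q) = ((T1 * c2 - 1) / of_real d2 + (T2 * c1 - 1) / of_real d1)
        + (of_real (\<alpha> - a * q) * (T1 * T2) + of_real (a * q) * (T1 * T2 - 1))"
      using d d2 by (simp add: H_def q_def field_simps)
    have 1: "cmod ((T1 * c2 - 1) / of_real d2) \<le> 3 * e / d2"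
      using near_one_mult[OF T(1) cc(2) e(3)] d2 by (simp add: norm_divide divide_right_mono)
    have 2: "cmod ((T2 * c1 - 1) / of_real d1) \<le> 3 * e / d1"
      using near_one_mult[OF T(2) cc(1) e(3)] d by (simp add: norm_divide divide_right_mono)
    have sum12: "3 * e / d2 + 3 * e / d1 = 3 * e * q"
      by (simp add: q_def distrib_left)
    note TT = near_one_mult[OF T e(3)]
    have "cmod (T1 * T2) \<le> 4"
      using norm_triangle_ineq[of "T1 * T2 - 1" 1] TT e by simp
    then have 3: "cmod (of_real (\<alpha> - a * q) * (T1 * T2)) \<le> (C1 * d1) * 4"
      unfolding norm_mult norm_of_real using \<alpha> d C by (intro mult_mono) (auto simp: q_def)
    have "\<bar>a * q\<bar> \<le> 2 * q"
      using mult_right_mono[of "\<bar>a\<bar>" 2 q] a q by (simp add: abs_mult)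
    then have 4: "cmod (of_real (a * q) * (T1 * T2 - 1)) \<le> (2 * q) * (3 * e)"
      unfolding norm_mult norm_of_real using TT q by (intro mult_mono) auto
    have "cmod (H - of_real ((1 + a) * q)) \<le>
        (3 * e / d2 + 3 * e / d1) + ((C1 * d1) * 4 + (2 * q) * (3 * e))"
      unfolding split
      by (rule order_trans[OF norm_triangle_ineq])
        (intro add_mono order_trans[OF norm_triangle_ineq] 1 2 3 4)
    also have "\<dots> = 3 * (3 * e * q) + 4 * C1 * d1" unfolding sum12 by (simp add: algebra_simps)
    also have "\<dots> \<le> 3 * (36 * C * d1) + 4 * C1 * d1" using eq3 by simp
    finally show ?thesis by (simp add: algebra_simps)
  qed
  define U1 where "U1 = 2 * \<kappa>2 / \<kappa>1"
  have U1: "0 < U1" "\<mu> \<le> U1" using \<kappa> \<mu> by (simp_all add: U1_def)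
  \<comment> \<open>The coefficient of \<open>w1\<close> is \<open>2 * (1 + a) + \<delta>\<close>.\<close>
  define \<delta> where "\<delta> = of_real (2 / U1) * (of_real ((1 + a) * (q * \<rho>1\<^sup>2 - U1)) + of_real (\<rho>1\<^sup>2) * (H - of_real ((1 + a) * q)))"
  define R where "R = (d1 + d2) * \<rho>1\<^sup>2"
  define L where "L = (2 / \<mu>) * (C2 + 108 * C + 4 * C1) * R"
  have R: "0 \<le> R" using d d2 by (simp add: R_def)
  have L0: "0 \<le> L" using R C \<mu> unfolding L_def by (intro mult_nonneg_nonneg) auto
  have \<delta>: "cmod \<delta> \<le> L"
  proof -
    have "cmod (of_real ((1 + a) * (q * \<rho>1\<^sup>2 - U1))) \<le> 1 * (C2 * R)"
      unfolding norm_of_real abs_mult using a u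
      by (intro mult_mono) (auto simp: q_def R_def U1_def)
    moreover have "cmod (of_real (\<rho>1\<^sup>2) * (H - of_real ((1 + a) * q))) \<le> (108 * C + 4 * C1) * R"
    proof -
      have "cmod (of_real (\<rho>1\<^sup>2) * (H - of_real ((1 + a) * q))) \<le> \<rho>1\<^sup>2 * ((108 * C + 4 * C1) * d1)"
        unfolding norm_mult norm_of_real using Hb by (simp add: mult_left_mono)
      also have "\<dots> = (108 * C + 4 * C1) * (d1 * \<rho>1\<^sup>2)" by (simp add: mult_ac)
      also have "\<dots> \<le> (108 * C + 4 * C1) * R"
        using C d2 unfolding R_def by (intro mult_left_mono mult_right_mono) auto
      finally show ?thesis .
    qed
    ultimately have "cmod (of_real ((1 + a) * (q * \<rho>1\<^sup>2 - U1)) + of_real (\<rho>1\<^sup>2) * (H - of_real ((1 + a) * q)))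
        \<le> (C2 + 108 * C + 4 * C1) * R"
      using norm_triangle_ineq[of "of_real ((1 + a) * (q * \<rho>1\<^sup>2 - U1)) :: complex" "of_real (\<rho>1\<^sup>2) * (H - of_real ((1 + a) * q))"]
      by (simp add: algebra_simps)
    moreover have "\<bar>2 / U1\<bar> \<le> 2 / \<mu>"
      using U1 \<mu> by (simp add: divide_left_mono)
    ultimately have "\<bar>2 / U1\<bar> * cmod (of_real ((1 + a) * (q * \<rho>1\<^sup>2 - U1)) + of_real (\<rho>1\<^sup>2) * (H - of_real ((1 + a) * q)))
        \<le> (2 / \<mu>) * ((C2 + 108 * C + 4 * C1) * R)"
      using \<mu> by (intro mult_mono) auto
    then show ?thesis
      unfolding \<delta>_def L_def norm_mult[of "of_real (2 / U1)"] norm_of_real by (simp only: mult.assoc)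
  qed
  have main: "T1 * w2 + T2 * w0 = - ((of_real (2 * (1 + a)) + \<delta>) * w1)"
  proof -
    have \<rho>0: "\<rho>0 \<noteq> 0" using \<rho> by auto
    have "\<rho>0 * \<rho>1 = - d1" unfolding \<rho>(2) using \<rho>0 by simp
    from this[symmetric] have r0: "\<rho>0 = - d1 / \<rho>1" using \<rho>(1) by simp
    have nz: "complex_of_real d1 \<noteq> 0" "complex_of_real d2 \<noteq> 0" "complex_of_real \<rho>1 \<noteq> 0"
      "complex_of_real \<kappa>1 \<noteq> 0" "complex_of_real \<kappa>2 \<noteq> 0" using d d2 \<rho> \<kappa> by simp_all
    have HU: "of_real (2 * (1 + a)) + \<delta> = of_real (2 / U1) * of_real (\<rho>1\<^sup>2) * H"
      using U1(1) unfolding \<delta>_def by (simp add: field_simps)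
    have l: "S1 * (of_real (\<rho>2 * \<kappa>2) * w2) + S2 * (of_real (\<rho>0 * \<kappa>2) * w0) =
        - (of_real d1 * of_real d2 * of_real \<kappa>2 / of_real \<rho>1) * (T1 * w2 + T2 * w0)"
      unfolding ST \<rho>(3) r0 using nz by (simp add: field_simps)
    have r: "(S1 * c2 + S2 * c1 + of_real \<alpha> * S1 * S2) * (of_real (\<rho>1 * \<kappa>1) * w1) =
        of_real d1 * of_real d2 * of_real \<rho>1 * of_real \<kappa>1 * H * w1"
      unfolding ST H_def using nz by (simp add: field_simps)
    have solve: "X = - (p * p * k1 / k2 * Y)"
      if "- (m * n * k2 / p) * X = m * n * p * k1 * Y" "m \<noteq> 0" "n \<noteq> 0" "p \<noteq> 0" "k2 \<noteq> 0"
      for m n p k1 k2 X Y :: complex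
    proof -
      have "X = - (p / (m * n * k2)) * (- (m * n * k2 / p) * X)"
        using that(2-5) by simp
      also have "\<dots> = - (p / (m * n * k2)) * (m * n * p * k1 * Y)"
        unfolding that(1) ..
      also have "\<dots> = - (p * p * k1 / k2 * Y)"
        using that(2-5) by simp
      finally show ?thesis .
    qed
    have "- (of_real d1 * of_real d2 * of_real \<kappa>2 / of_real \<rho>1) * (T1 * w2 + T2 * w0) =
        of_real d1 * of_real d2 * of_real \<rho>1 * of_real \<kappa>1 * (H * w1)"
      using rec unfolding l r by (simp only: mult.assoc)
    from solve[OF this nz(1,2,3,5)]
    have "T1 * w2 + T2 * w0 = - (of_real \<rho>1 * of_real \<rho>1 * of_real \<kappa>1 / of_real \<kappa>2 * (H * w1))" .
    also have "\<dots> = - ((of_real (2 / U1) * of_real (\<rho>1\<^sup>2) * H) * w1)"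
      using nz by (simp add: U1_def power2_eq_square field_simps)
    finally show ?thesis unfolding HU .
  qed
  have b2: "cmod (of_real (2 * (1 + a)) :: complex) \<le> 2" using a by (simp only: norm_of_real) auto
  have w2: "cmod w2 \<le> 4 * cmod w0 + (4 + 2 * L) * cmod w1"
  proof -
    have "1 / 2 \<le> cmod T1" using norm_triangle_ineq2[of 1 "1 - T1"] T(1) e by (simp add: norm_minus_commute)
    then have "1 / 2 * cmod w2 \<le> cmod T1 * cmod w2" by (rule mult_right_mono) simp
    also have "\<dots> = cmod (- ((of_real (2 * (1 + a)) + \<delta>) * w1) - T2 * w0)"
      unfolding main[symmetric] by (simp add: norm_mult)
    also have "\<dots> \<le> cmod ((of_real (2 * (1 + a)) + \<delta>) * w1) + cmod (T2 * w0)"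
      using norm_triangle_ineq4[of "- ((of_real (2 * (1 + a)) + \<delta>) * w1)" "T2 * w0"] by simp
    also have "\<dots> \<le> (2 + L) * cmod w1 + 2 * cmod w0"
    proof (rule add_mono)
      have "cmod (of_real (2 * (1 + a)) + \<delta>) \<le> 2 + L"
        using norm_triangle_ineq[of "of_real (2 * (1 + a))" \<delta>] b2 \<delta> by linarith
      then show "cmod ((of_real (2 * (1 + a)) + \<delta>) * w1) \<le> (2 + L) * cmod w1"
        unfolding norm_mult by (rule mult_right_mono) simp
      have "cmod T2 \<le> 2" using norm_triangle_ineq[of "T2 - 1" 1] T(2) e by simp
      then show "cmod (T2 * w0) \<le> 2 * cmod w0"
        unfolding norm_mult by (rule mult_right_mono) simp
    qed
    finally show ?thesis by (simp add: algebra_simps)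
  qed
  have "w2 + w0 + of_real (2 * (1 + a)) * w1 = (1 - T1) * w2 + (1 - T2) * w0 + ((T1 * w2 + T2 * w0) + of_real (2 * (1 + a)) * w1)"
    by (simp add: algebra_simps)
  also have "\<dots> = (1 - T1) * w2 + (1 - T2) * w0 - \<delta> * w1"
    unfolding main by (simp add: algebra_simps)
  finally have "cmod (w2 + w0 + of_real (2 * (1 + a)) * w1) \<le> cmod (1 - T1) * cmod w2 + cmod (1 - T2) * cmod w0 + cmod \<delta> * cmod w1"
    using norm_triangle_ineq4[of "(1 - T1) * w2 + (1 - T2) * w0" "\<delta> * w1"]
      norm_triangle_ineq[of "(1 - T1) * w2" "(1 - T2) * w0"] by (simp add: norm_mult)
  also have "\<dots> \<le> e * (4 * cmod w0 + (4 + 2 * L) * cmod w1) + e * cmod w0 + L * cmod w1"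
    using T e w2 \<delta> L0 by (intro add_mono mult_mono) (auto simp: norm_minus_commute)
  also have "\<dots> = 5 * e * cmod w0 + (4 * e + 2 * (e * L) + L) * cmod w1"
    by (simp add: algebra_simps)
  also have "\<dots> \<le> (5 * e + 2 * L) * cmod w0 + (5 * e + 2 * L) * cmod w1"
  proof (rule add_mono[OF mult_right_mono mult_right_mono])
    have "e * L \<le> 1 / 2 * L" using e L0 by (intro mult_right_mono) auto
    then show "4 * e + 2 * (e * L) + L \<le> 5 * e + 2 * L" using e by linarith
    show "5 * e \<le> 5 * e + 2 * L" using L0 by simp
  qed simp_all
  also have "\<dots> = (5 * e + 2 * L) * (cmod w0 + cmod w1)" by (simp add: algebra_simps)
  finally have "cmod (w2 + w0 + of_real (2 * (1 + a)) * w1) \<le> (5 * e + 2 * L) * (cmod w0 + cmod w1)" .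
  moreover have "5 * e = 20 * C * d1\<^sup>2" by (simp add: e_def)
  ultimately show ?thesis unfolding L_def R_def by (simp only:)
qed

section \<open>Square integrability of the solution\<close>

context point_interactions
begin

text \<open>On a short interval the solution is interpolated from its end point values by
  \<open>fsin z h * sol = y0 * fsin z (h - e) + y1 * fsin z e\<close>, where \<open>e\<close> is the distance from the left end
  point; this avoids any control of the derivative.\<close>

lemma sol_interval_bound:
  assumes z: "z \<noteq> 0" and C: "\<And>t. 0 \<le> t \<Longrightarrow> t \<le> 1 \<Longrightarrow> cmod (fsin z t - of_real t) \<le> C * t ^ 3"
    and d: "x (Suc n) - x n \<le> 1" "C * (x (Suc n) - x n)\<^sup>2 \<le> 1 / 2" and C0: "0 < C"
    and t: "t \<in> {x n<..<x (Suc n)}"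
  shows "cmod (sol z s t) \<le> 3 * (cmod (fst (state z s n)) + cmod (fst (state z s (Suc n))))"
proof -
  define h where "h = x (Suc n) - x n"
  define e where "e = t - x n"
  have e: "0 < e" "e < h" "0 < h" using t x_less[of n] by (auto simp: e_def h_def)
  have near: "cmod (fsin z \<tau> - of_real \<tau>) \<le> \<tau> / 2" if "0 \<le> \<tau>" "\<tau> \<le> h" for \<tau>
  proof -
    have "cmod (fsin z \<tau> - of_real \<tau>) \<le> C * \<tau> ^ 3"
      using that d(1) by (intro C) (auto simp: h_def)
    also have "\<dots> = (C * \<tau>\<^sup>2) * \<tau>" by (simp add: power2_eq_square power3_eq_cube)
    also have "\<dots> \<le> (1 / 2) * \<tau>"
    proof (rule mult_right_mono)
      have "\<tau>\<^sup>2 \<le> h\<^sup>2" using that by (intro power_mono)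
      then have "C * \<tau>\<^sup>2 \<le> C * h\<^sup>2" using C0 by (intro mult_left_mono) auto
      then show "C * \<tau>\<^sup>2 \<le> 1 / 2" using d(2) by (simp add: h_def)
    qed (fact that(1))
    finally show ?thesis by simp
  qed
  have up: "cmod (fsin z \<tau>) \<le> 3 / 2 * h" if "0 \<le> \<tau>" "\<tau> \<le> h" for \<tau>
  proof -
    have "cmod (fsin z \<tau>) \<le> cmod (fsin z \<tau> - of_real \<tau>) + cmod (of_real \<tau>)"
      using norm_triangle_ineq[of "fsin z \<tau> - of_real \<tau>" "of_real \<tau>"] by simp
    then show ?thesis using near[OF that] that by simp
  qed
  have low: "h / 2 \<le> cmod (fsin z h)"
  proof -
    have "cmod (of_real h) \<le> cmod (fsin z h) + cmod (of_real h - fsin z h)"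
      using norm_triangle_ineq[of "fsin z h" "of_real h - fsin z h"] by simp
    then show ?thesis using near[of h] e by (simp add: norm_minus_commute)
  qed
  define y0 where "y0 = fst (state z s n)"
  define p0 where "p0 = snd (state z s n)"
  define y1 where "y1 = fst (state z s (Suc n))"
  have y1: "y1 = fcos z h * y0 + fsin z h * p0"
    by (simp add: y1_def y0_def p0_def h_def Let_def)
  have add: "fsin z (h - e) = fsin z h * fcos z e - fcos z h * fsin z e"
    by (simp add: fsin_def fcos_def right_diff_distrib sin_diff diff_divide_distrib)
  have "sol z s t = fcos z e * y0 + fsin z e * p0"
    using sol_eq_arc(1)[of n t z s] t by (simp add: arc_def e_def y0_def p0_def)
  then have "fsin z h * sol z s t = y0 * fsin z (h - e) + y1 * fsin z e"
    unfolding add y1 by (simp add: algebra_simps)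
  then have "cmod (fsin z h) * cmod (sol z s t) = cmod (y0 * fsin z (h - e) + y1 * fsin z e)"
    by (metis norm_mult)
  also have "\<dots> \<le> cmod y0 * cmod (fsin z (h - e)) + cmod y1 * cmod (fsin z e)"
    by (rule order_trans[OF norm_triangle_ineq]) (simp add: norm_mult)
  also have "\<dots> \<le> cmod y0 * (3 / 2 * h) + cmod y1 * (3 / 2 * h)"
    using e by (intro add_mono mult_left_mono up) auto
  finally have "cmod (fsin z h) * cmod (sol z s t) \<le> (cmod y0 + cmod y1) * (3 / 2 * h)"
    by (simp only: distrib_right)
  moreover have "h / 2 * cmod (sol z s t) \<le> cmod (fsin z h) * cmod (sol z s t)"
    using low by (rule mult_right_mono) simp
  ultimately have "h / 2 * cmod (sol z s t) \<le> h / 2 * (3 * (cmod y0 + cmod y1))"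
    by (simp add: mult_ac)
  then show ?thesis
    using e(3) by (simp add: y0_def y1_def)
qed

text \<open>The quotients of the solution by \<open>rt n\<close> stay bounded, so its square over the interval of
  length \<open>d n\<close> is dominated by \<open>(d n + d (n + 1)) * (rt n)\<^sup>2\<close>.\<close>

theorem sol_square_integrable:
  fixes d rt u :: "nat \<Rightarrow> real" and a :: real
  assumes z: "z \<noteq> 0" and d: "\<And>n. d (Suc n) = x (Suc n) - x n"
    and d_l2: "summable (\<lambda>n. (d n)\<^sup>2)" and ratio: "(\<lambda>n. d (n + 1) / d n) \<longlonglongrightarrow> 1"
    and rt: "rt 1 \<noteq> 0" "\<forall>n\<ge>1. rt (n + 1) = - d (n + 1) / rt n"
    and A: "summable (\<lambda>n. (d n + d (n + 1)) * (rt n)\<^sup>2)"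
    and per: "p \<ge> 1" "\<forall>n\<ge>1. u (n + p) = u n"
    and B: "(\<lambda>n. (1 / d n + 1 / d (n + 1)) * (rt n)\<^sup>2 - u n) \<in> O(\<lambda>n. (d n + d (n + 1)) * (rt n)\<^sup>2)"
    and \<alpha>: "(\<lambda>n. \<alpha> n - a * (1 / d n + 1 / d (n + 1))) \<in> O(d)"
    and a: "-2 < a" "a < 0"
  shows "square_integrable_on {0<..} (sol z (1, 0))"
proof -
  define R where "R n = (d n + d (n + 1)) * (rt n)\<^sup>2" for n
  have d_pos: "d n > 0" if "n \<ge> 1" for n
    using d[of "n - 1"] x_less[of "n - 1"] that by simp
  have rt0: "rt n \<noteq> 0" if "n \<ge> 1" for n
    using that
  proof (induction n rule: dec_induct)
    case (step n)
    then show ?case using rt(2)[rule_format, of n] d_pos[of "n + 1"] by simp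
  qed (use rt in simp)
  have R0: "0 \<le> R n" if "n \<ge> 1" for n
    using d_pos[of n] d_pos[of "n + 1"] that unfolding R_def by simp
  have R_lim: "R \<longlonglongrightarrow> 0"
    using summable_LIMSEQ_zero[OF A] unfolding R_def .
  obtain C2 where C2: "C2 > 0" "\<forall>\<^sub>F n in sequentially. norm ((1 / d n + 1 / d (n + 1)) * (rt n)\<^sup>2 - u n) \<le> C2 * norm (R n)"
    using landau_o.bigE[OF B] unfolding R_def by blast
  have lim: "(\<lambda>n. (1 / d n + 1 / d (n + 1)) * (rt n)\<^sup>2 - u n) \<longlonglongrightarrow> 0"
  proof (rule Lim_null_comparison[OF C2(2)])
    have "(\<lambda>n. C2 * norm (R n)) \<longlonglongrightarrow> C2 * norm (0 :: real)"
      by (intro tendsto_intros R_lim)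
    then show "(\<lambda>n. C2 * norm (R n)) \<longlonglongrightarrow> 0" by simp
  qed
  have u: "u n > 0" "u n * u (n + 1) = 4" if "n \<ge> 1" for n
    using alternating_potential[OF _ ratio _ rt(2) lim per that] d_pos rt0 by blast+
  \<comment> \<open>Chosen so that \<open>u n = 2 * \<kappa> (n + 1) / \<kappa> n\<close>; this is compatible with period two because consecutive terms of \<open>u\<close> multiply to \<open>4\<close>.\<close>
  define \<kappa> where "\<kappa> n = (if odd n then 1 else u 1 / 2)" for n :: nat
  have \<kappa>_pos: "\<kappa> n > 0" for n using u(1)[of 1] by (simp add: \<kappa>_def)
  have \<kappa>2: "\<kappa> (n + 2) = \<kappa> n" for n by (simp add: \<kappa>_def)
  have u\<kappa>: "u n = 2 * \<kappa> (n + 1) / \<kappa> n" if "n \<ge> 1" for n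
    using that
  proof (induction n rule: dec_induct)
    case (step n)
    have "u (Suc n) = 4 / u n"
      using u(2)[OF step(1)] u(1)[OF step(1)] by (simp add: field_simps)
    also have "\<dots> = 2 * \<kappa> n / \<kappa> (n + 1)"
      unfolding step(3) using \<kappa>_pos[of n] \<kappa>_pos[of "n + 1"] by (simp add: field_simps)
    finally show ?case using \<kappa>2[of n] by simp
  qed (simp add: \<kappa>_def)
  define \<mu> where "\<mu> = min (u 1) (4 / u 1)"
  have \<mu>: "0 < \<mu>" using u(1)[of 1] by (simp add: \<mu>_def)
  have \<mu>_le: "\<mu> \<le> 2 * \<kappa> (n + 1) / \<kappa> n" for n
    using u(1)[of 1] by (cases "odd n") (simp_all add: \<mu>_def \<kappa>_def)
  obtain C where C: "C > 0" "\<And>t. 0 \<le> t \<Longrightarrow> t \<le> 1 \<Longrightarrow> cmod (fsin z t - of_real t) \<le> C * t ^ 3"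
    "\<And>t. 0 \<le> t \<Longrightarrow> t \<le> 1 \<Longrightarrow> cmod (fcos z t - 1) \<le> C * t\<^sup>2"
    using free_solution_estimates[OF z] by metis
  obtain C1 where C1: "C1 > 0" "\<forall>\<^sub>F n in sequentially. norm (\<alpha> n - a * (1 / d n + 1 / d (n + 1))) \<le> C1 * norm (d n)"
    using landau_o.bigE[OF \<alpha>] by blast
  have d2_lim: "(\<lambda>n. (d n)\<^sup>2) \<longlonglongrightarrow> 0"
    using d_l2 by (rule summable_LIMSEQ_zero)
  have "(\<lambda>n. sqrt ((d n)\<^sup>2)) \<longlonglongrightarrow> sqrt 0"
    by (rule tendsto_real_sqrt[OF d2_lim])
  then have d_lim: "(\<lambda>n. \<bar>d n\<bar>) \<longlonglongrightarrow> 0" by simp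
  have "(\<lambda>n. 4 * C * (d n)\<^sup>2) \<longlonglongrightarrow> 4 * C * 0"
    by (intro tendsto_intros d2_lim)
  then have "\<forall>\<^sub>F n in sequentially. 4 * C * (d n)\<^sup>2 < 1 / 2"
    by (rule order_tendstoD) simp
  moreover have "\<forall>\<^sub>F n in sequentially. \<bar>d n\<bar> < 1"
    using d_lim by (rule order_tendstoD) simp
  moreover have "\<forall>\<^sub>F n in sequentially. d (n + 1) / d n < 2" "\<forall>\<^sub>F n in sequentially. d (n + 1) / d n > 1 / 2"
    by (rule order_tendstoD(2)[OF ratio], simp, rule order_tendstoD(1)[OF ratio], simp)
  ultimately have "\<forall>\<^sub>F n in sequentially. 4 * C * (d n)\<^sup>2 < 1 / 2 \<and> \<bar>d n\<bar> < 1 \<and> d (n + 1) / d n < 2 \<and> d (n + 1) / d n > 1 / 2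
      \<and> norm (\<alpha> n - a * (1 / d n + 1 / d (n + 1))) \<le> C1 * norm (d n)
      \<and> norm ((1 / d n + 1 / d (n + 1)) * (rt n)\<^sup>2 - u n) \<le> C2 * norm (R n) \<and> n \<ge> 1"
    using C1(2) C2(2) eventually_ge_at_top[of 1] by (intro eventually_conj)
  then obtain N where N: "\<And>n. n \<ge> N \<Longrightarrow> 4 * C * (d n)\<^sup>2 < 1 / 2 \<and> \<bar>d n\<bar> < 1 \<and> d (n + 1) / d n < 2 \<and> d (n + 1) / d n > 1 / 2
      \<and> norm (\<alpha> n - a * (1 / d n + 1 / d (n + 1))) \<le> C1 * norm (d n)
      \<and> norm ((1 / d n + 1 / d (n + 1)) * (rt n)\<^sup>2 - u n) \<le> C2 * norm (R n) \<and> n \<ge> 1"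
    unfolding eventually_sequentially by blast
  have N1: "N \<ge> 1" using N[of N] by simp
  define y where "y n = fst (state z (1, 0) n)" for n
  define w where "w n = y n / of_real (rt n * \<kappa> n)" for n
  have yw: "of_real (rt n * \<kappa> n) * w n = y n" if "n \<ge> 1" for n
    using rt0[OF that] \<kappa>_pos[of n] by (simp add: w_def)
  define \<eta> where "\<eta> n = 20 * C * (d (n + 1))\<^sup>2 + 2 * ((2 / \<mu>) * (C2 + 108 * C + 4 * C1) * R (n + 1))" for n
  have \<eta>: "summable \<eta>"
  proof -
    have "summable (\<lambda>n. (d (n + 1))\<^sup>2)" "summable (\<lambda>n. R (n + 1))"
      using summable_ignore_initial_segment[OF d_l2, of 1] summable_ignore_initial_segment[OF A, of 1]
      by (simp_all add: R_def)
    then show ?thesis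
      unfolding \<eta>_def[abs_def] by (intro summable_add summable_mult)
  qed
  have \<eta>0: "0 \<le> \<eta> n" for n
    using C(1) C1(1) C2(1) \<mu> R0[of "n + 1"] unfolding \<eta>_def
    by (intro add_nonneg_nonneg mult_nonneg_nonneg) auto
  have step: "cmod (w (n + 2) + w n + of_real (2 * (1 + a)) * w (n + 1)) \<le> \<eta> n * (cmod (w n) + cmod (w (n + 1)))"
    if n: "n \<ge> N" for n
  proof -
    have n1: "n \<ge> 1" using n N1 by simp
    have dp: "d (n + 1) > 0" "d (n + 2) > 0" using d_pos by simp_all
    have Nn: "4 * C * (d (n + 1))\<^sup>2 < 1 / 2" "\<bar>d (n + 1)\<bar> < 1" "\<bar>d (n + 2)\<bar> < 1"
      "d (n + 2) / d (n + 1) < 2" "d (n + 2) / d (n + 1) > 1 / 2"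
      "norm (\<alpha> (n + 1) - a * (1 / d (n + 1) + 1 / d (n + 2))) \<le> C1 * norm (d (n + 1))"
      "norm ((1 / d (n + 1) + 1 / d (n + 2)) * (rt (n + 1))\<^sup>2 - u (n + 1)) \<le> C2 * norm (R (n + 1))"
      using N[of "n + 1"] N[of "n + 2"] n by (simp_all add: add.assoc)
    show ?thesis
      unfolding \<eta>_def R_def
    proof (rule one_step_estimate[where ?S1.0 = "fsin z (d (n + 1))" and ?S2.0 = "fsin z (d (n + 2))"
          and ?c1.0 = "fcos z (d (n + 1))" and ?c2.0 = "fcos z (d (n + 2))" and \<alpha> = "\<alpha> (n + 1)"
          and ?\<rho>0.0 = "rt n" and ?\<rho>2.0 = "rt (n + 2)" and ?\<kappa>1.0 = "\<kappa> (n + 1)" and ?\<kappa>2.0 = "\<kappa> (n + 2)"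
          and ?d2.0 = "d (n + 1 + 1)"])
      show "0 < d (n + 1)" by fact
      show "d (n + 1) \<le> 2 * d (n + 1 + 1)" "d (n + 1 + 1) \<le> 2 * d (n + 1)"
        using Nn(4,5) dp by (simp_all add: field_simps)
      show "rt (n + 1) \<noteq> 0" by (rule rt0) simp
      show "rt (n + 1) = - d (n + 1) / rt n" using rt(2) n1 by blast
      show "rt (n + 2) = - d (n + 1 + 1) / rt (n + 1)" using rt(2)[rule_format, of "n + 1"] by simp
      show "\<kappa> (n + 1) > 0" "\<kappa> (n + 2) > 0" by (rule \<kappa>_pos)+
      show "- 2 < a" "a < 0" by (rule a)+
      show "0 < C" "0 < C1" "0 < C2" by fact+
      show "4 * C * (d (n + 1))\<^sup>2 \<le> 1 / 2" using Nn(1) by simp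
      show "cmod (fsin z (d (n + 1)) - of_real (d (n + 1))) \<le> C * d (n + 1) ^ 3"
        "cmod (fcos z (d (n + 1)) - 1) \<le> C * (d (n + 1))\<^sup>2"
        using Nn(2) dp by (intro C; simp)+
      show "cmod (fsin z (d (n + 2)) - of_real (d (n + 1 + 1))) \<le> C * d (n + 1 + 1) ^ 3"
        "cmod (fcos z (d (n + 2)) - 1) \<le> C * (d (n + 1 + 1))\<^sup>2"
        using Nn(3) dp C(2,3)[of "d (n + 2)"] by simp_all
      show "\<bar>\<alpha> (n + 1) - a * (1 / d (n + 1) + 1 / d (n + 1 + 1))\<bar> \<le> C1 * d (n + 1)"
        using Nn(6) dp by simp
      show "\<bar>(1 / d (n + 1) + 1 / d (n + 1 + 1)) * (rt (n + 1))\<^sup>2 - 2 * \<kappa> (n + 2) / \<kappa> (n + 1)\<bar>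
          \<le> C2 * ((d (n + 1) + d (n + 1 + 1)) * (rt (n + 1))\<^sup>2)"
        using Nn(7) R0[of "n + 1"] u\<kappa>[of "n + 1"] by (simp add: R_def)
      show "0 < \<mu>" by fact
      show "\<mu> \<le> 2 * \<kappa> (n + 2) / \<kappa> (n + 1)" using \<mu>_le[of "n + 1"] by simp
      have "fsin z (d (n + 1)) * y (n + 2) + fsin z (d (n + 2)) * y n =
          (fsin z (d (n + 1)) * fcos z (d (n + 2)) + fsin z (d (n + 2)) * fcos z (d (n + 1))
            + of_real (\<alpha> (n + 1)) * fsin z (d (n + 1)) * fsin z (d (n + 2))) * y (n + 1)"
        using state_recurrence[OF z, of n "(1, 0)"] d[of n] d[of "n + 1"] by (simp add: y_def)
      moreover have "of_real (rt (n + 2) * \<kappa> (n + 2)) * w (n + 2) = y (n + 2)"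
        "of_real (rt n * \<kappa> (n + 2)) * w n = y n" "of_real (rt (n + 1) * \<kappa> (n + 1)) * w (n + 1) = y (n + 1)"
        using yw[of "n + 2"] yw[OF n1] yw[of "n + 1"] \<kappa>2[of n] by simp_all
      ultimately show "fsin z (d (n + 1)) * (of_real (rt (n + 2) * \<kappa> (n + 2)) * w (n + 2)) +
          fsin z (d (n + 2)) * (of_real (rt n * \<kappa> (n + 2)) * w n) =
        (fsin z (d (n + 1)) * fcos z (d (n + 2)) + fsin z (d (n + 2)) * fcos z (d (n + 1))
            + of_real (\<alpha> (n + 1)) * fsin z (d (n + 1)) * fsin z (d (n + 2))) *
          (of_real (rt (n + 1) * \<kappa> (n + 1)) * w (n + 1))"
        by (simp only:)
    qed
  qed
  have "\<bar>1 + a\<bar> < 1" using a by simp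
  from perturbed_oscillation_bounded[OF this \<eta> \<eta>0 step]
  obtain M where M: "\<And>n. n \<ge> N \<Longrightarrow> cmod (w n) \<le> M" by metis
  define M' where "M' = (1 + u 1 / 2) * M"
  have yb: "cmod (y n) \<le> \<bar>rt n\<bar> * M'" if "n \<ge> N" for n
  proof -
    have "\<kappa> n \<le> 1 + u 1 / 2" using u(1)[of 1] by (simp add: \<kappa>_def)
    have "cmod (y n) = (\<bar>rt n\<bar> * \<kappa> n) * cmod (w n)"
      using yw[of n] that N1 \<kappa>_pos[of n] by (metis abs_mult abs_of_pos norm_mult norm_of_real order_trans)
    also have "\<dots> \<le> (\<bar>rt n\<bar> * (1 + u 1 / 2)) * M"
      using M[OF that] \<open>\<kappa> n \<le> 1 + u 1 / 2\<close> \<kappa>_pos[of n] u(1)[of 1]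
      by (intro mult_mono) auto
    finally show ?thesis by (simp only: M'_def mult.assoc)
  qed
  obtain B where B: "\<And>t. 0 \<le> t \<Longrightarrow> t \<le> x N \<Longrightarrow> cmod (sol z (1, 0) t) \<le> B \<and> cmod (sol' z (1, 0) t) \<le> B"
    using sol_bounded[OF z, of "x N" "(1, 0)"] by metis
  \<comment> \<open>The first intervals may be long; there a crude bound suffices.\<close>
  define K where "K n = (if n < N then B else 3 * (cmod (y n) + cmod (y (Suc n))))" for n
  show ?thesis
  proof (rule square_integrable_piecewise_bounded)
    show "continuous_on U (sol z (1, 0))"
      using sol_derivative(1)[OF z] by (meson continuous_at_imp_continuous_on has_vector_derivative_continuous)
    show "cmod (sol z (1, 0) t) \<le> K n" if t: "t \<in> {x n<..<x (Suc n)}" for n t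
    proof (cases "n < N")
      case True
      then have "x (Suc n) \<le> x N" using strict_mono_less_eq[OF x_mono] by simp
      then show ?thesis using B[of t] t x_nonneg[of n] True by (simp add: K_def)
    next
      case False
      have "x (Suc n) - x n \<le> 1" "C * (x (Suc n) - x n)\<^sup>2 \<le> 1 / 2"
      proof -
        have "4 * C * (d (Suc n))\<^sup>2 < 1 / 2" "\<bar>d (Suc n)\<bar> < 1" "0 \<le> C * (d (Suc n))\<^sup>2"
          using N[of "Suc n"] False C(1) by simp_all
        then show "x (Suc n) - x n \<le> 1" "C * (x (Suc n) - x n)\<^sup>2 \<le> 1 / 2"
          unfolding d by linarith+
      qed
      from sol_interval_bound[OF z C(2) this C(1) t, of "(1, 0)"]
      show ?thesis using False by (simp add: K_def y_def)
    qed
    show "summable (\<lambda>n. (x (Suc n) - x n) * (K n)\<^sup>2)"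
    proof (rule summable_comparison_test)
      have sR: "summable R" using A unfolding R_def .
      then have "summable (\<lambda>n. R (Suc n))" by (simp add: summable_Suc_iff)
      with sR show "summable (\<lambda>n. 18 * M'\<^sup>2 * (R n + R (Suc n)))"
        by (intro summable_mult summable_add)
      show "\<exists>N'. \<forall>n\<ge>N'. norm ((x (Suc n) - x n) * (K n)\<^sup>2) \<le> 18 * M'\<^sup>2 * (R n + R (Suc n))"
      proof (intro exI allI impI)
        fix n assume n: "n \<ge> N"
        then have n1: "n \<ge> 1" using N1 by simp
        have dp: "d n > 0" "d (Suc n) > 0" "d (Suc (Suc n)) > 0" using d_pos n1 by simp_all
        have sq: "(cmod (y k))\<^sup>2 \<le> (rt k)\<^sup>2 * M'\<^sup>2" if "k \<ge> N" for k
          using power_mono[OF yb[OF that], of 2] by (simp add: power_mult_distrib)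
        have "(K n)\<^sup>2 = 9 * (cmod (y n) + cmod (y (Suc n)))\<^sup>2"
          using n by (simp add: K_def power2_eq_square algebra_simps)
        also have "\<dots> \<le> 9 * (2 * ((cmod (y n))\<^sup>2 + (cmod (y (Suc n)))\<^sup>2))"
          using zero_le_power2[of "cmod (y n) - cmod (y (Suc n))"] unfolding power2_diff power2_sum by simp
        also have "\<dots> \<le> 18 * M'\<^sup>2 * ((rt n)\<^sup>2 + (rt (Suc n))\<^sup>2)"
          using sq[of n] sq[of "Suc n"] n by (simp add: algebra_simps)
        finally have "d (Suc n) * (K n)\<^sup>2 \<le> d (Suc n) * (18 * M'\<^sup>2 * ((rt n)\<^sup>2 + (rt (Suc n))\<^sup>2))"
          using dp by (intro mult_left_mono) auto
        also have "\<dots> = 18 * M'\<^sup>2 * (d (Suc n) * (rt n)\<^sup>2 + d (Suc n) * (rt (Suc n))\<^sup>2)"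
          by (simp add: algebra_simps)
        also have "\<dots> \<le> 18 * M'\<^sup>2 * (R n + R (Suc n))"
          using dp unfolding R_def by (intro mult_left_mono add_mono mult_right_mono) auto
        finally show "norm ((x (Suc n) - x n) * (K n)\<^sup>2) \<le> 18 * M'\<^sup>2 * (R n + R (Suc n))"
          using dp(2) unfolding d by simp
      qed
    qed
  qed
qed

end

section \<open>Deficiency indices of the Hamiltonian\<close>

theorem proposition7:
  fixes d r rt \<alpha> x :: "nat \<Rightarrow> real" and a :: real
  assumes d_pos: "\<forall>n\<ge>1. d n > 0"
    and d_l2: "summable (\<lambda>n. (d (Suc n))\<^sup>2)"
    and d_not_l1: "\<not> summable (\<lambda>n. \<bar>d (Suc n)\<bar>)"
    and d_ratio: "(\<lambda>n. d (n + 1) / d n) \<longlonglongrightarrow> 1"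
    and r: "\<forall>n\<ge>1. r n = sqrt (d n + d (n + 1))"
    and rt_1: "rt 1 = 1"
    and rt_Suc: "\<forall>n\<ge>1. rt (n + 1) = - d (n + 1) / rt n"
    and A: "summable (\<lambda>n. (r (Suc n) * rt (Suc n))\<^sup>2)"
    and B: "\<exists>u :: nat \<Rightarrow> real. (\<exists>p\<ge>1. \<forall>n\<ge>1. u (n + p) = u n) \<and>
      (\<lambda>n. (1 / d n + 1 / d (n + 1)) * (rt n)\<^sup>2 - u n) \<in> O(\<lambda>n. (r n)\<^sup>2 * (rt n)\<^sup>2)"
    and \<alpha>: "(\<lambda>n. \<alpha> n - a * (1 / d n + 1 / d (n + 1))) \<in> O(d)"
    and a: "-2 < a" "a < 0"
    and x_0: "x 0 = 0"
    and x_Suc: "\<forall>n\<ge>1. x n = x (n - 1) + d n"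
  shows "symmetric_operator (hamiltonian x \<alpha>) \<and>
    deficiency_index_plus (hamiltonian x \<alpha>) = 1 \<and>
    deficiency_index_minus (hamiltonian x \<alpha>) = 1"
proof -
  have d: "d (Suc n) = x (Suc n) - x n" for n
    using x_Suc[rule_format, of "Suc n"] by simp
  have mono: "strict_mono x"
    unfolding strict_mono_Suc_iff using d d_pos by (metis One_nat_def Suc_le_mono diff_gt_0_iff_gt le0)
  have xsum: "x n = (\<Sum>k<n. d (Suc k))" for n
    by (induction n) (simp_all add: x_0 d)
  have lim: "filterlim x at_top sequentially"
    unfolding filterlim_at_top
  proof
    fix Z
    have "\<exists>n. Z < x n"
    proof (rule ccontr)
      assume "\<not> (\<exists>n. Z < x n)"
      moreover have "(\<Sum>k<n. \<bar>d (Suc k)\<bar>) = x n" for n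
        unfolding xsum
      proof (rule sum.cong)
        show "\<bar>d (Suc k)\<bar> = d (Suc k)" for k
          using d_pos[rule_format, of "Suc k"] by simp
      qed simp
      ultimately have "(\<Sum>k<n. \<bar>d (Suc k)\<bar>) \<le> Z" for n
        by (simp add: not_less)
      then have "summable (\<lambda>n. \<bar>d (Suc n)\<bar>)"
        by (intro summableI_nonneg_bounded) auto
      then show False using d_not_l1 by blast
    qed
    then obtain n where n: "Z < x n" by blast
    show "\<forall>\<^sub>F k in sequentially. Z \<le> x k"
      using eventually_ge_at_top[of n]
    proof eventually_elim
      case (elim k)
      then have "x n \<le> x k" using strict_mono_less_eq[OF mono] by blast
      then show ?case using n by linarith
    qed
  qed
  interpret point_interactions x \<alpha>
    by unfold_locales (fact x_0 mono lim)+
  obtain u p where u: "p \<ge> 1" "\<forall>n\<ge>1. u (n + p) = u n"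
    "(\<lambda>n. (1 / d n + 1 / d (n + 1)) * (rt n)\<^sup>2 - u n) \<in> O(\<lambda>n. (r n)\<^sup>2 * (rt n)\<^sup>2)"
    using B by blast
  have r2: "(r n)\<^sup>2 = d n + d (n + 1)" if "n \<ge> 1" for n
    using r d_pos that by (simp add: add_nonneg_nonneg less_imp_le)
  have "(\<lambda>n. (r n)\<^sup>2 * (rt n)\<^sup>2) \<in> \<Theta>(\<lambda>n. (d n + d (n + 1)) * (rt n)\<^sup>2)"
    by (rule bigthetaI_cong, rule eventually_mono[OF eventually_ge_at_top[of 1]]) (simp add: r2)
  then have B': "(\<lambda>n. (1 / d n + 1 / d (n + 1)) * (rt n)\<^sup>2 - u n) \<in> O(\<lambda>n. (d n + d (n + 1)) * (rt n)\<^sup>2)"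
    using u(3) landau_o.big.cong_bigtheta by blast
  have "summable (\<lambda>n. (d (Suc n) + d (Suc n + 1)) * (rt (Suc n))\<^sup>2)"
    using A by (simp add: power_mult_distrib r2)
  then have A': "summable (\<lambda>n. (d n + d (n + 1)) * (rt n)\<^sup>2)"
    by (subst (asm) summable_Suc_iff)
  have d2: "summable (\<lambda>n. (d n)\<^sup>2)"
    using d_l2 by (subst (asm) summable_Suc_iff)
  have rt1: "rt 1 \<noteq> 0" using rt_1 by simp
  have "cdim_l2 (eigenspace_graph (adjoint_graph (hamiltonian x \<alpha>)) z) = 1" if "z \<noteq> 0" for z
    by (rule eigenspace_dim_eq_1[OF that
          sol_square_integrable[OF that d d2 d_ratio rt1 rt_Suc A' u(1,2) B' \<alpha> a]])
  then show ?thesis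
    unfolding deficiency_index_plus_def deficiency_index_minus_def
    using hamiltonian_symmetric by simp
qed

end
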